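(* Let $(H,A,C)$ and $(H',A',C')$ be two Doi Hom-Hopf data, with $(H,\alpha),(A,\beta),(C,\gamma)$ and $(H',\alpha'),(A',\beta'),(C',\gamma')$. Let $\xi=(\varphi,\psi,\phi):(H,A,C)\to(H',A',C')$ consist of a monoidal Hom-Hopf algebra map $\varphi:H\to H'$, a monoidal Hom-algebra map $\psi:A\to A'$ and a monoidal Hom-coalgebra map $\phi:C\to C'$ satisfying $$\phi(h\cdot c)=\varphi(h)\cdot\phi(c),\qquad \rho_{A'}(\psi(a))=\psi(a_{[0]})\otimes\varphi(a_{[1]})$$ for all $c\in C$, $h\in H$, $a\in A$. Then there is a functor $$F:{}_A\widetilde{\mathscr H}(\mathscr M_k)(H)^C\to{}_{A'}\widetilde{\mathscr H}(\mathscr M_k)(H')^{C'},\qquad F(M)=A'\otimes_AM,$$ where $(A',\beta')$ is a right $(A,\beta)$-Hom-module via $\psi$, and for $(M,\mu)$ the structure maps of $F(M)$ are $$b'\cdot(a'\otimes_Am)=\beta'^{-1}(b')a'\otimes_A\mu(m),\qquad \rho_{F(M)}(a'\otimes_Am)=a'_{[0]}\otimes_Am_{[0]}\otimes a'_{[1]}\cdot\phi(m_{[1]})$$ for all $a',b'\in A'$, $m\in M$.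
   Context: $k$ is a commutative ring and $\otimes=\otimes_k$. $\widetilde{\mathscr H}(\mathscr M_k)$ has objects pairs $(M,\mu)$, $M$ a $k$-module and $\mu$ a $k$-linear automorphism; morphisms are $k$-linear maps commuting with the automorphisms. It is symmetric monoidal (with the flip) via $(M,\mu)\otimes(N,\nu)=(M\otimes N,\mu\otimes\nu)$, with associator $(m\otimes n)\otimes p\mapsto\mu(m)\otimes(n\otimes\pi^{-1}(p))$. All structure maps below, and all maps of Hom-structures, are morphisms in this category. Monoidal Hom-algebra $(A,\beta)$: multiplication and $1_A$ with $\beta(ab)=\beta(a)\beta(b)$, $\beta(1_A)=1_A$, $\beta(a)(bc)=(ab)\beta(c)$, $a1_A=1_Aa=\beta(a)$. Monoidal Hom-coalgebra $(C,\gamma)$: $\Delta(c)=c_{(1)}\otimes c_{(2)}$ and $\varepsilon$, commuting with $\gamma$ ($\varepsilon\gamma=\varepsilon$), with $\gamma^{-1}(c_{(1)})\otimes c_{(2)(1)}\otimes c_{(2)(2)}=c_{(1)(1)}\otimes c_{(1)(2)}\otimes\gamma^{-1}(c_{(2)})$ and $\varepsilon(c_{(1)})c_{(2)}=\varepsilon(c_{(2)})c_{(1)}=\gamma^{-1}(c)$. Monoidal Hom-bialgebra: both structures with the same automorphism, $\Delta,\varepsilon$ multiplicative and unital. Monoidal Hom-Hopf algebra $(H,\alpha)$: a monoidal Hom-bialgebra with $k$-linear $S:H\to H$, $S\alpha=\alpha S$, $S(h_{(1)})h_{(2)}=h_{(1)}S(h_{(2)})=\varepsilon(h)1_H$. Left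 $(A,\beta)$-Hom-module $(M,\mu)$: $\beta(a)\cdot(b\cdot m)=(ab)\cdot\mu(m)$, $1_A\cdot m=\mu(m)$, $\mu(a\cdot m)=\beta(a)\cdot\mu(m)$; right $(A,\beta)$-Hom-module: $(m\cdot a)\cdot\beta(b)=\mu(m)\cdot(ab)$, $m\cdot1_A=\mu(m)$, $\mu(m\cdot a)=\mu(m)\cdot\beta(a)$. Right $(C,\gamma)$-Hom-comodule $(M,\mu)$: $\rho_M(m)=m_{[0]}\otimes m_{[1]}\in M\otimes C$ with $m_{[0][0]}\otimes m_{[0][1]}\otimes\gamma^{-1}(m_{[1]})=\mu^{-1}(m_{[0]})\otimes\Delta(m_{[1]})$, $m_{[0]}\varepsilon(m_{[1]})=\mu^{-1}(m)$, $\rho_M(\mu(m))=\mu(m_{[0]})\otimes\gamma(m_{[1]})$. A Doi Hom-Hopf datum $(H,A,C)$: a monoidal Hom-Hopf algebra $(H,\alpha)$; a right $(H,\alpha)$-Hom-comodule algebra $(A,\beta)$ (monoidal Hom-algebra and right $(H,\alpha)$-Hom-comodule with $\rho_A(ab)=a_{[0]}b_{[0]}\otimes a_{[1]}b_{[1]}$, $\rho_A(1_A)=1_A\otimes1_H$); a left $(H,\alpha)$-Hom-module coalgebra $(C,\gamma)$ (monoidal Hom-coalgebra and left $(H,\alpha)$-Hom-module with $\Delta_C(h\cdot c)=h_{(1)}\cdot c_{(1)}\otimes h_{(2)}\cdot c_{(2)}$, $\varepsilon_C(h\cdot c)=\varepsilon_H(h)\varepsilon_C(c)$). ${}_A\widetilde{\mathscr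 H}(\mathscr M_k)(H)^C$ is the category of Doi Hom-Hopf modules: $(M,\mu)$ a left $(A,\beta)$-Hom-module and right $(C,\gamma)$-Hom-comodule with $\rho_M(a\cdot m)=a_{[0]}\cdot m_{[0]}\otimes a_{[1]}\cdot m_{[1]}$; morphisms are $A$-linear $C$-colinear morphisms of $\widetilde{\mathscr H}(\mathscr M_k)$. $A'\otimes_AM$ is the coequalizer in $\widetilde{\mathscr H}(\mathscr M_k)$ of the two actions, i.e. the quotient of $A'\otimes M$ by the submodule generated by all $a'\psi(a)\otimes m-\beta'(a')\otimes a\cdot\mu^{-1}(m)$, with automorphism induced by $\beta'\otimes\mu$. On morphisms $F(f)=\mathrm{id}_{A'}\otimes_Af$. *)

theory Defs
  imports "HOL-Algebra.Module" "HOL-Algebra.AbelCoset" "HOL-Library.FuncSet"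
begin

section \<open>Linear maps, quotients and tensor products of modules\<close>

definition linear_map ::
  "('k, 'r) ring_scheme \<Rightarrow> ('k, 'm, 'x) module_scheme \<Rightarrow> ('k, 'n, 'y) module_scheme \<Rightarrow>
    ('m \<Rightarrow> 'n) \<Rightarrow> bool" where
  "linear_map R M N f \<longleftrightarrow>
    f \<in> carrier M \<rightarrow> carrier N \<and>
    (\<forall>x\<in>carrier M. \<forall>y\<in>carrier M. f (x \<oplus>\<^bsub>M\<^esub> y) = f x \<oplus>\<^bsub>N\<^esub> f y) \<and>
    (\<forall>r\<in>carrier R. \<forall>x\<in>carrier M. f (r \<odot>\<^bsub>M\<^esub> x) = r \<odot>\<^bsub>N\<^esub> f x)"

definition bilinear_map ::
  "('k, 'r) ring_scheme \<Rightarrow> ('k, 'm, 'x) module_scheme \<Rightarrow> ('k, 'n, 'y) module_scheme \<Rightarrow>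
    ('k, 'p, 'z) module_scheme \<Rightarrow> ('m \<Rightarrow> 'n \<Rightarrow> 'p) \<Rightarrow> bool" where
  "bilinear_map R M N P f \<longleftrightarrow>
    (\<forall>x\<in>carrier M. linear_map R N P (\<lambda>y. f x y)) \<and>
    (\<forall>y\<in>carrier N. linear_map R M P (\<lambda>x. f x y))"

definition self_module :: "('k, 'r) ring_scheme \<Rightarrow> ('k, 'k) module" where
  "self_module R =
    \<lparr>carrier = carrier R, mult = mult R, one = one R, zero = zero R, add = add R,
     smult = mult R\<rparr>"

definition submodule_gen ::
  "('k, 'r) ring_scheme \<Rightarrow> ('k, 'm, 'x) module_scheme \<Rightarrow> 'm set \<Rightarrow> 'm set" where
  "submodule_gen R M S = \<Inter>{N. submodule N R M \<and> S \<subseteq> N}"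

text \<open>The type \<^typ>\<open>('k, 'm) module\<close> extends the type of rings, hence has the fields
  \<^const>\<open>mult\<close> and \<^const>\<open>one\<close>, on which the locale \<^locale>\<open>module\<close> imposes no condition. They
  carry meaning below only for Hom-algebras, and are left undefined in quotients and free modules.\<close>

definition quotient_module ::
  "('k, 'm, 'x) module_scheme \<Rightarrow> 'm set \<Rightarrow> ('k, 'm set) module" where
  "quotient_module M N =
    \<lparr>carrier = a_rcosets\<^bsub>M\<^esub> N, mult = undefined, one = undefined,
     zero = N, add = set_add M, smult = (\<lambda>r X. \<Union>x\<in>X. N +>\<^bsub>M\<^esub> (r \<odot>\<^bsub>M\<^esub> x))\<rparr>"

definition free_module :: "('k, 'r) ring_scheme \<Rightarrow> 'i set \<Rightarrow> ('k, 'i \<Rightarrow> 'k) module" where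
  "free_module R I =
    \<lparr>carrier = {u. (\<forall>i. u i \<in> carrier R) \<and> finite {i. u i \<noteq> \<zero>\<^bsub>R\<^esub>} \<and> (\<forall>i. i \<notin> I \<longrightarrow> u i = \<zero>\<^bsub>R\<^esub>)},
     mult = undefined, one = undefined,
     zero = (\<lambda>i. \<zero>\<^bsub>R\<^esub>), add = (\<lambda>u v i. u i \<oplus>\<^bsub>R\<^esub> v i), smult = (\<lambda>r u i. r \<otimes>\<^bsub>R\<^esub> u i)\<rparr>"

definition free_gen :: "('k, 'r) ring_scheme \<Rightarrow> 'i \<Rightarrow> 'i \<Rightarrow> 'k" where
  "free_gen R i = (\<lambda>j. if j = i then \<one>\<^bsub>R\<^esub> else \<zero>\<^bsub>R\<^esub>)"

definition tensor_relations ::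
  "('k, 'r) ring_scheme \<Rightarrow> ('k, 'm, 'x) module_scheme \<Rightarrow> ('k, 'n, 'y) module_scheme \<Rightarrow>
    ('m \<times> 'n \<Rightarrow> 'k) set" where
  "tensor_relations R M N =
    (let Fr = free_module R (carrier M \<times> carrier N); e = (\<lambda>x y. free_gen R (x, y)) in
      {e (x \<oplus>\<^bsub>M\<^esub> x') y \<ominus>\<^bsub>Fr\<^esub> (e x y \<oplus>\<^bsub>Fr\<^esub> e x' y) | x x' y.
        x \<in> carrier M \<and> x' \<in> carrier M \<and> y \<in> carrier N} \<union>
      {e x (y \<oplus>\<^bsub>N\<^esub> y') \<ominus>\<^bsub>Fr\<^esub> (e x y \<oplus>\<^bsub>Fr\<^esub> e x y') | x y y'.
        x \<in> carrier M \<and> y \<in> carrier N \<and> y' \<in> carrier N} \<union>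
      {e (r \<odot>\<^bsub>M\<^esub> x) y \<ominus>\<^bsub>Fr\<^esub> r \<odot>\<^bsub>Fr\<^esub> e x y | r x y.
        r \<in> carrier R \<and> x \<in> carrier M \<and> y \<in> carrier N} \<union>
      {e x (r \<odot>\<^bsub>N\<^esub> y) \<ominus>\<^bsub>Fr\<^esub> r \<odot>\<^bsub>Fr\<^esub> e x y | r x y.
        r \<in> carrier R \<and> x \<in> carrier M \<and> y \<in> carrier N})"

definition tensor_kernel ::
  "('k, 'r) ring_scheme \<Rightarrow> ('k, 'm, 'x) module_scheme \<Rightarrow> ('k, 'n, 'y) module_scheme \<Rightarrow>
    ('m \<times> 'n \<Rightarrow> 'k) set" where
  "tensor_kernel R M N =
    submodule_gen R (free_module R (carrier M \<times> carrier N)) (tensor_relations R M N)"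

type_synonym ('k, 'm, 'n) tensor_elt = "('m \<times> 'n \<Rightarrow> 'k) set"

definition tensor_module ::
  "('k, 'r) ring_scheme \<Rightarrow> ('k, 'm, 'x) module_scheme \<Rightarrow> ('k, 'n, 'y) module_scheme \<Rightarrow>
    ('k, ('k, 'm, 'n) tensor_elt) module" where
  "tensor_module R M N =
    quotient_module (free_module R (carrier M \<times> carrier N)) (tensor_kernel R M N)"

definition tens ::
  "('k, 'r) ring_scheme \<Rightarrow> ('k, 'm, 'x) module_scheme \<Rightarrow> ('k, 'n, 'y) module_scheme \<Rightarrow>
    'm \<Rightarrow> 'n \<Rightarrow> ('k, 'm, 'n) tensor_elt" where
  "tens R M N x y =
    tensor_kernel R M N +>\<^bsub>free_module R (carrier M \<times> carrier N)\<^esub> free_gen R (x, y)"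

text \<open>\<open>tensor_lift R P f t\<close> is the value at \<open>t\<close> of the linear map \<open>M \<otimes> N \<rightarrow> P\<close> induced by the
  bilinear map \<open>f\<close>. For bilinear \<open>f\<close> it does not depend on the chosen representative of \<open>t\<close>.
  It renders Sweedler notation: an expression \<open>E(c\<^sub>(\<^sub>1\<^sub>), c\<^sub>(\<^sub>2\<^sub>))\<close> with values in \<open>P\<close> becomes
  \<open>tensor_lift R P (\<lambda>x y. E(x, y)) (\<Delta> c)\<close>.\<close>

definition tensor_lift ::
  "('k, 'r) ring_scheme \<Rightarrow> ('k, 'p, 'z) module_scheme \<Rightarrow> ('m \<Rightarrow> 'n \<Rightarrow> 'p) \<Rightarrow>
    ('k, 'm, 'n) tensor_elt \<Rightarrow> 'p" where
  "tensor_lift R P f t =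
    (let u = (SOME u. u \<in> t) in
      \<Oplus>\<^bsub>P\<^esub>i\<in>{i. u i \<noteq> \<zero>\<^bsub>R\<^esub>}. u i \<odot>\<^bsub>P\<^esub> f (fst i) (snd i))"


section \<open>The category \<open>\<H>\<^sup>~(\<M>\<^sub>k)\<close>\<close>

record ('k, 'm) hom_obj = "('k, 'm) module" +
  aut :: "'m \<Rightarrow> 'm"

locale hom_object = module R M
  for R :: "('k, 'r) ring_scheme" and M :: "('k, 'm, 'x) hom_obj_scheme" (structure) +
  assumes aut_linear: "linear_map R M M (aut M)"
    and aut_bij: "bij_betw (aut M) (carrier M) (carrier M)"

definition inv_aut :: "('k, 'm, 'x) hom_obj_scheme \<Rightarrow> 'm \<Rightarrow> 'm" where
  "inv_aut M = inv_into (carrier M) (aut M)"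

definition hom_map ::
  "('k, 'r) ring_scheme \<Rightarrow> ('k, 'm, 'x) hom_obj_scheme \<Rightarrow> ('k, 'n, 'y) hom_obj_scheme \<Rightarrow>
    ('m \<Rightarrow> 'n) \<Rightarrow> bool" where
  "hom_map R M N f \<longleftrightarrow> linear_map R M N f \<and> (\<forall>x\<in>carrier M. f (aut M x) = aut N (f x))"

text \<open>A morphism \<open>M \<otimes> N \<rightarrow> P\<close>, given by the corresponding bilinear map.\<close>

definition hom_bimap ::
  "('k, 'r) ring_scheme \<Rightarrow> ('k, 'm, 'x) hom_obj_scheme \<Rightarrow> ('k, 'n, 'y) hom_obj_scheme \<Rightarrow>
    ('k, 'p, 'z) hom_obj_scheme \<Rightarrow> ('m \<Rightarrow> 'n \<Rightarrow> 'p) \<Rightarrow> bool" where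
  "hom_bimap R M N P f \<longleftrightarrow>
    bilinear_map R M N P f \<and>
    (\<forall>x\<in>carrier M. \<forall>y\<in>carrier N. aut P (f x y) = f (aut M x) (aut N y))"

definition tensor ::
  "('k, 'r) ring_scheme \<Rightarrow> ('k, 'm, 'x) hom_obj_scheme \<Rightarrow> ('k, 'n, 'y) hom_obj_scheme \<Rightarrow>
    ('k, ('k, 'm, 'n) tensor_elt) hom_obj" where
  "tensor R M N =
    module.extend (tensor_module R M N)
      (hom_obj.fields
        (tensor_lift R (tensor_module R M N) (\<lambda>x y. tens R M N (aut M x) (aut N y))))"


section \<open>Monoidal Hom-structures\<close>

locale hom_algebra = hom_object R A
  for R :: "('k, 'r) ring_scheme" and A :: "('k, 'a, 'x) hom_obj_scheme" (structure) +
  assumes mult_bimap: "hom_bimap R A A A (mult A)"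
    and one_in_carrier: "\<one> \<in> carrier A"
    and aut_one: "aut A \<one> = \<one>"
    and hom_assoc: "\<lbrakk>a \<in> carrier A; b \<in> carrier A; c \<in> carrier A\<rbrakk> \<Longrightarrow>
          aut A a \<otimes> (b \<otimes> c) = (a \<otimes> b) \<otimes> aut A c"
    and hom_r_one: "a \<in> carrier A \<Longrightarrow> a \<otimes> \<one> = aut A a"
    and hom_l_one: "a \<in> carrier A \<Longrightarrow> \<one> \<otimes> a = aut A a"

record ('k, 'c) hom_coalg = "('k, 'c) hom_obj" +
  comult :: "'c \<Rightarrow> ('k, 'c, 'c) tensor_elt"
  counit :: "'c \<Rightarrow> 'k"

text \<open>Threefold tensor products are written \<open>C \<otimes> (C \<otimes> C)\<close>; the identification with
  \<open>(C \<otimes> C) \<otimes> C\<close> implicit in the elementwise axioms is the ordinary one.\<close>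

locale hom_coalgebra = hom_object R C
  for R :: "('k, 'r) ring_scheme" and C :: "('k, 'c, 'x) hom_coalg_scheme" (structure) +
  assumes comult_map: "hom_map R C (tensor R C C) (comult C)"
    and counit_linear: "linear_map R C (self_module R) (counit C)"
    and counit_aut: "c \<in> carrier C \<Longrightarrow> counit C (aut C c) = counit C c"
    and hom_coassoc: "c \<in> carrier C \<Longrightarrow>
          tensor_lift R (tensor R C (tensor R C C))
            (\<lambda>x y. tens R C (tensor R C C) (inv_aut C x) (comult C y)) (comult C c) =
          tensor_lift R (tensor R C (tensor R C C))
            (\<lambda>x y. tensor_lift R (tensor R C (tensor R C C))
              (\<lambda>u v. tens R C (tensor R C C) u (tens R C C v (inv_aut C y))) (comult C x))
            (comult C c)"
    and hom_l_counit: "c \<in> carrier C \<Longrightarrow>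
          tensor_lift R C (\<lambda>x y. counit C x \<odot> y) (comult C c) = inv_aut C c"
    and hom_r_counit: "c \<in> carrier C \<Longrightarrow>
          tensor_lift R C (\<lambda>x y. counit C y \<odot> x) (comult C c) = inv_aut C c"

locale hom_bialgebra = hom_algebra R H + hom_coalgebra R H
  for R :: "('k, 'r) ring_scheme" and H :: "('k, 'h, 'x) hom_coalg_scheme" (structure) +
  assumes comult_mult: "\<lbrakk>g \<in> carrier H; h \<in> carrier H\<rbrakk> \<Longrightarrow>
          comult H (g \<otimes> h) =
          tensor_lift R (tensor R H H) (\<lambda>g1 g2.
            tensor_lift R (tensor R H H) (\<lambda>h1 h2. tens R H H (g1 \<otimes> h1) (g2 \<otimes> h2))
              (comult H h)) (comult H g)"
    and comult_one: "comult H \<one> = tens R H H \<one> \<one>"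
    and counit_mult: "\<lbrakk>g \<in> carrier H; h \<in> carrier H\<rbrakk> \<Longrightarrow>
          counit H (g \<otimes> h) = counit H g \<otimes>\<^bsub>R\<^esub> counit H h"
    and counit_one: "counit H \<one> = \<one>\<^bsub>R\<^esub>"

record ('k, 'h) hom_hopf = "('k, 'h) hom_coalg" +
  antipode :: "'h \<Rightarrow> 'h"

locale hom_hopf_algebra = hom_bialgebra R H
  for R :: "('k, 'r) ring_scheme" and H :: "('k, 'h, 'x) hom_hopf_scheme" (structure) +
  assumes antipode_map: "hom_map R H H (antipode H)"
    and antipode_l: "h \<in> carrier H \<Longrightarrow>
          tensor_lift R H (\<lambda>x y. antipode H x \<otimes> y) (comult H h) = counit H h \<odot> \<one>"
    and antipode_r: "h \<in> carrier H \<Longrightarrow>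
          tensor_lift R H (\<lambda>x y. x \<otimes> antipode H y) (comult H h) = counit H h \<odot> \<one>"

definition hom_algebra_map ::
  "('k, 'r) ring_scheme \<Rightarrow> ('k, 'a, 'x) hom_obj_scheme \<Rightarrow> ('k, 'b, 'y) hom_obj_scheme \<Rightarrow>
    ('a \<Rightarrow> 'b) \<Rightarrow> bool" where
  "hom_algebra_map R A B f \<longleftrightarrow>
    hom_map R A B f \<and>
    (\<forall>x\<in>carrier A. \<forall>y\<in>carrier A. f (x \<otimes>\<^bsub>A\<^esub> y) = f x \<otimes>\<^bsub>B\<^esub> f y) \<and>
    f \<one>\<^bsub>A\<^esub> = \<one>\<^bsub>B\<^esub>"

definition hom_coalgebra_map ::
  "('k, 'r) ring_scheme \<Rightarrow> ('k, 'c, 'x) hom_coalg_scheme \<Rightarrow> ('k, 'd, 'y) hom_coalg_scheme \<Rightarrow>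
    ('c \<Rightarrow> 'd) \<Rightarrow> bool" where
  "hom_coalgebra_map R C D f \<longleftrightarrow>
    hom_map R C D f \<and>
    (\<forall>c\<in>carrier C.
      comult D (f c) = tensor_lift R (tensor R D D) (\<lambda>x y. tens R D D (f x) (f y)) (comult C c)) \<and>
    (\<forall>c\<in>carrier C. counit D (f c) = counit C c)"

text \<open>A map of Hom-Hopf algebras is a map of the underlying Hom-bialgebras; as for ordinary Hopf
  algebras, it then commutes with the antipodes.\<close>

definition hom_hopf_map ::
  "('k, 'r) ring_scheme \<Rightarrow> ('k, 'h, 'x) hom_hopf_scheme \<Rightarrow> ('k, 'g, 'y) hom_hopf_scheme \<Rightarrow>
    ('h \<Rightarrow> 'g) \<Rightarrow> bool" where
  "hom_hopf_map R H G f \<longleftrightarrow> hom_algebra_map R H G f \<and> hom_coalgebra_map R H G f"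


section \<open>Hom-modules and Hom-comodules\<close>

locale left_hom_module = A: hom_algebra R A + M: hom_object R M
  for R :: "('k, 'r) ring_scheme" and A :: "('k, 'a, 'x) hom_obj_scheme"
    and M :: "('k, 'm, 'y) hom_obj_scheme" +
  fixes act :: "'a \<Rightarrow> 'm \<Rightarrow> 'm"
  assumes act_bimap: "hom_bimap R A M M act"
    and act_assoc: "\<lbrakk>a \<in> carrier A; b \<in> carrier A; m \<in> carrier M\<rbrakk> \<Longrightarrow>
          act (aut A a) (act b m) = act (a \<otimes>\<^bsub>A\<^esub> b) (aut M m)"
    and act_one: "m \<in> carrier M \<Longrightarrow> act \<one>\<^bsub>A\<^esub> m = aut M m"

locale right_hom_module = A: hom_algebra R A + M: hom_object R M
  for R :: "('k, 'r) ring_scheme" and A :: "('k, 'a, 'x) hom_obj_scheme"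
    and M :: "('k, 'm, 'y) hom_obj_scheme" +
  fixes act :: "'m \<Rightarrow> 'a \<Rightarrow> 'm"
  assumes act_bimap: "hom_bimap R M A M act"
    and act_assoc: "\<lbrakk>m \<in> carrier M; a \<in> carrier A; b \<in> carrier A\<rbrakk> \<Longrightarrow>
          act (act m a) (aut A b) = act (aut M m) (a \<otimes>\<^bsub>A\<^esub> b)"
    and act_one: "m \<in> carrier M \<Longrightarrow> act m \<one>\<^bsub>A\<^esub> = aut M m"

locale right_hom_comodule = C: hom_coalgebra R C + M: hom_object R M
  for R :: "('k, 'r) ring_scheme" and C :: "('k, 'c, 'x) hom_coalg_scheme"
    and M :: "('k, 'm, 'y) hom_obj_scheme" +
  fixes coact :: "'m \<Rightarrow> ('k, 'm, 'c) tensor_elt"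
  assumes coact_map: "hom_map R M (tensor R M C) coact"
    and coact_coassoc: "m \<in> carrier M \<Longrightarrow>
          tensor_lift R (tensor R M (tensor R C C))
            (\<lambda>x c. tensor_lift R (tensor R M (tensor R C C))
              (\<lambda>y d. tens R M (tensor R C C) y (tens R C C d (inv_aut C c))) (coact x))
            (coact m) =
          tensor_lift R (tensor R M (tensor R C C))
            (\<lambda>x c. tens R M (tensor R C C) (inv_aut M x) (comult C c)) (coact m)"
    and coact_counit: "m \<in> carrier M \<Longrightarrow>
          tensor_lift R M (\<lambda>x c. counit C c \<odot>\<^bsub>M\<^esub> x) (coact m) = inv_aut M m"

locale right_hom_comodule_algebra = A: hom_algebra R A + right_hom_comodule R H A coact +
    H: hom_hopf_algebra R H
  for R :: "('k, 'r) ring_scheme" and H :: "('k, 'h, 'x) hom_hopf_scheme"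
    and A :: "('k, 'a, 'y) hom_obj_scheme" and coact +
  assumes coact_mult: "\<lbrakk>a \<in> carrier A; b \<in> carrier A\<rbrakk> \<Longrightarrow>
          coact (a \<otimes>\<^bsub>A\<^esub> b) =
          tensor_lift R (tensor R A H) (\<lambda>a0 a1.
            tensor_lift R (tensor R A H) (\<lambda>b0 b1. tens R A H (a0 \<otimes>\<^bsub>A\<^esub> b0) (a1 \<otimes>\<^bsub>H\<^esub> b1))
              (coact b)) (coact a)"
    and coact_one: "coact \<one>\<^bsub>A\<^esub> = tens R A H \<one>\<^bsub>A\<^esub> \<one>\<^bsub>H\<^esub>"

locale left_hom_module_coalgebra = C: hom_coalgebra R C + left_hom_module R H C act +
    H: hom_hopf_algebra R H
  for R :: "('k, 'r) ring_scheme" and H :: "('k, 'h, 'x) hom_hopf_scheme"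
    and C :: "('k, 'c, 'y) hom_coalg_scheme" and act +
  assumes comult_act: "\<lbrakk>h \<in> carrier H; c \<in> carrier C\<rbrakk> \<Longrightarrow>
          comult C (act h c) =
          tensor_lift R (tensor R C C) (\<lambda>h1 h2.
            tensor_lift R (tensor R C C) (\<lambda>c1 c2. tens R C C (act h1 c1) (act h2 c2))
              (comult C c)) (comult H h)"
    and counit_act: "\<lbrakk>h \<in> carrier H; c \<in> carrier C\<rbrakk> \<Longrightarrow>
          counit C (act h c) = counit H h \<otimes>\<^bsub>R\<^esub> counit C c"


section \<open>Categories and functors\<close>

text \<open>The hom-sets need not be disjoint, so composition is indexed by the objects involved:
  \<open>Comp C X Y Z g f\<close> is \<open>g \<circ> f\<close> for \<open>f : X \<rightarrow> Y\<close> and \<open>g : Y \<rightarrow> Z\<close>.\<close>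

record ('o, 'f) category_data =
  Ob :: "'o set"
  Hom :: "'o \<Rightarrow> 'o \<Rightarrow> 'f set"
  Ident :: "'o \<Rightarrow> 'f"
  Comp :: "'o \<Rightarrow> 'o \<Rightarrow> 'o \<Rightarrow> 'f \<Rightarrow> 'f \<Rightarrow> 'f"

locale category =
  fixes C :: "('o, 'f) category_data"
  assumes Ident_closed: "X \<in> Ob C \<Longrightarrow> Ident C X \<in> Hom C X X"
    and Comp_closed: "\<lbrakk>X \<in> Ob C; Y \<in> Ob C; Z \<in> Ob C; f \<in> Hom C X Y; g \<in> Hom C Y Z\<rbrakk> \<Longrightarrow>
          Comp C X Y Z g f \<in> Hom C X Z"
    and Comp_Ident: "\<lbrakk>X \<in> Ob C; Y \<in> Ob C; f \<in> Hom C X Y\<rbrakk> \<Longrightarrow> Comp C X X Y f (Ident C X) = f"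
    and Ident_Comp: "\<lbrakk>X \<in> Ob C; Y \<in> Ob C; f \<in> Hom C X Y\<rbrakk> \<Longrightarrow> Comp C X Y Y (Ident C Y) f = f"
    and Comp_assoc: "\<lbrakk>W \<in> Ob C; X \<in> Ob C; Y \<in> Ob C; Z \<in> Ob C;
            f \<in> Hom C W X; g \<in> Hom C X Y; h \<in> Hom C Y Z\<rbrakk> \<Longrightarrow>
          Comp C W Y Z h (Comp C W X Y g f) = Comp C W X Z (Comp C X Y Z h g) f"

locale category_functor = C: category C + D: category D
  for C :: "('o, 'f) category_data" and D :: "('p, 'g) category_data" +
  fixes F_ob :: "'o \<Rightarrow> 'p" and F_mor :: "'o \<Rightarrow> 'o \<Rightarrow> 'f \<Rightarrow> 'g"
  assumes F_ob_closed: "X \<in> Ob C \<Longrightarrow> F_ob X \<in> Ob D"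
    and F_mor_closed: "\<lbrakk>X \<in> Ob C; Y \<in> Ob C; f \<in> Hom C X Y\<rbrakk> \<Longrightarrow>
          F_mor X Y f \<in> Hom D (F_ob X) (F_ob Y)"
    and F_Ident: "X \<in> Ob C \<Longrightarrow> F_mor X X (Ident C X) = Ident D (F_ob X)"
    and F_Comp: "\<lbrakk>X \<in> Ob C; Y \<in> Ob C; Z \<in> Ob C; f \<in> Hom C X Y; g \<in> Hom C Y Z\<rbrakk> \<Longrightarrow>
          F_mor X Z (Comp C X Y Z g f) =
          Comp D (F_ob X) (F_ob Y) (F_ob Z) (F_mor Y Z g) (F_mor X Y f)"


section \<open>Doi Hom-Hopf data and modules\<close>

record ('k, 'h, 'a, 'c) doi_datum =
  hopf :: "('k, 'h) hom_hopf"
  alg :: "('k, 'a) hom_obj"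
  alg_coact :: "'a \<Rightarrow> ('k, 'a, 'h) tensor_elt"
  coalg :: "('k, 'c) hom_coalg"
  coalg_act :: "'h \<Rightarrow> 'c \<Rightarrow> 'c"

definition doi_hom_hopf_datum ::
  "('k, 'r) ring_scheme \<Rightarrow> ('k, 'h, 'a, 'c) doi_datum \<Rightarrow> bool" where
  "doi_hom_hopf_datum R D \<longleftrightarrow>
    hom_hopf_algebra R (hopf D) \<and>
    right_hom_comodule_algebra R (hopf D) (alg D) (alg_coact D) \<and>
    left_hom_module_coalgebra R (hopf D) (coalg D) (coalg_act D)"

definition doi_datum_map ::
  "('k, 'r) ring_scheme \<Rightarrow> ('k, 'h, 'a, 'c) doi_datum \<Rightarrow> ('k, 'h1, 'a1, 'c1) doi_datum \<Rightarrow>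
    ('h \<Rightarrow> 'h1) \<Rightarrow> ('a \<Rightarrow> 'a1) \<Rightarrow> ('c \<Rightarrow> 'c1) \<Rightarrow> bool" where
  "doi_datum_map R D D' \<phi> \<psi> \<chi> \<longleftrightarrow>
    hom_hopf_map R (hopf D) (hopf D') \<phi> \<and>
    hom_algebra_map R (alg D) (alg D') \<psi> \<and>
    hom_coalgebra_map R (coalg D) (coalg D') \<chi> \<and>
    (\<forall>h\<in>carrier (hopf D). \<forall>c\<in>carrier (coalg D).
      \<chi> (coalg_act D h c) = coalg_act D' (\<phi> h) (\<chi> c)) \<and>
    (\<forall>a\<in>carrier (alg D).
      alg_coact D' (\<psi> a) =
      tensor_lift R (tensor R (alg D') (hopf D'))
        (\<lambda>a0 a1. tens R (alg D') (hopf D') (\<psi> a0) (\<phi> a1)) (alg_coact D a))"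

record ('k, 'a, 'c, 'm) doi_obj = "('k, 'm) hom_obj" +
  act :: "'a \<Rightarrow> 'm \<Rightarrow> 'm"
  coact :: "'m \<Rightarrow> ('k, 'm, 'c) tensor_elt"

definition doi_hom_hopf_module ::
  "('k, 'r) ring_scheme \<Rightarrow> ('k, 'h, 'a, 'c) doi_datum \<Rightarrow> ('k, 'a, 'c, 'm) doi_obj \<Rightarrow> bool" where
  "doi_hom_hopf_module R D M \<longleftrightarrow>
    left_hom_module R (alg D) M (act M) \<and>
    right_hom_comodule R (coalg D) M (coact M) \<and>
    (\<forall>a\<in>carrier (alg D). \<forall>m\<in>carrier M.
      coact M (act M a m) =
      tensor_lift R (tensor R M (coalg D)) (\<lambda>a0 a1.
        tensor_lift R (tensor R M (coalg D))
          (\<lambda>m0 m1. tens R M (coalg D) (act M a0 m0) (coalg_act D a1 m1)) (coact M m))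
        (alg_coact D a))"

definition doi_hom_hopf_morphism ::
  "('k, 'r) ring_scheme \<Rightarrow> ('k, 'h, 'a, 'c) doi_datum \<Rightarrow>
    ('k, 'a, 'c, 'm) doi_obj \<Rightarrow> ('k, 'a, 'c, 'n) doi_obj \<Rightarrow> ('m \<Rightarrow> 'n) \<Rightarrow> bool" where
  "doi_hom_hopf_morphism R D M N f \<longleftrightarrow>
    hom_map R M N f \<and>
    (\<forall>a\<in>carrier (alg D). \<forall>m\<in>carrier M. f (act M a m) = act N a (f m)) \<and>
    (\<forall>m\<in>carrier M.
      coact N (f m) =
      tensor_lift R (tensor R N (coalg D)) (\<lambda>m0 m1. tens R N (coalg D) (f m0) m1) (coact M m))"

text \<open>The objects are the Doi Hom-Hopf modules with carrier in the type \<open>'m\<close>. Morphisms are taken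
  to be undefined outside the carrier of their domain, so that equality of morphisms is equality on
  that carrier.\<close>

definition doi_category ::
  "('k, 'r) ring_scheme \<Rightarrow> ('k, 'h, 'a, 'c) doi_datum \<Rightarrow>
    (('k, 'a, 'c, 'm) doi_obj, 'm \<Rightarrow> 'm) category_data" where
  "doi_category R D =
    \<lparr>Ob = {M. doi_hom_hopf_module R D M},
     Hom = (\<lambda>M N. {f \<in> extensional (carrier M). doi_hom_hopf_morphism R D M N f}),
     Ident = (\<lambda>M. \<lambda>x\<in>carrier M. x),
     Comp = (\<lambda>M N P g f. compose (carrier M) g f)\<rparr>"


section \<open>Tensor products over a Hom-algebra\<close>

text \<open>For a right \<open>A\<close>-Hom-module \<open>X\<close> with action \<open>ra\<close> and a left \<open>A\<close>-Hom-module \<open>M\<close> with action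
  \<open>la\<close>. The shape \<open>aut X x \<otimes> a\<cdot>\<mu>\<inverse>(m)\<close> of the second term comes from the associator
  \<open>(X \<otimes> A) \<otimes> M \<rightarrow> X \<otimes> (A \<otimes> M)\<close> of \<open>\<H>\<^sup>~(\<M>\<^sub>k)\<close>.\<close>

definition balanced_kernel ::
  "('k, 'r) ring_scheme \<Rightarrow> ('k, 'a, 'x) hom_obj_scheme \<Rightarrow>
    ('k, 'b, 'y) hom_obj_scheme \<Rightarrow> ('b \<Rightarrow> 'a \<Rightarrow> 'b) \<Rightarrow>
    ('k, 'm, 'z) hom_obj_scheme \<Rightarrow> ('a \<Rightarrow> 'm \<Rightarrow> 'm) \<Rightarrow> ('k, 'b, 'm) tensor_elt set" where
  "balanced_kernel R A X ra M la =
    submodule_gen R (tensor R X M)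
      {tens R X M (ra x a) m \<ominus>\<^bsub>tensor R X M\<^esub> tens R X M (aut X x) (la a (inv_aut M m)) | x a m.
        x \<in> carrier X \<and> a \<in> carrier A \<and> m \<in> carrier M}"

definition balanced_tensor ::
  "('k, 'r) ring_scheme \<Rightarrow> ('k, 'a, 'x) hom_obj_scheme \<Rightarrow>
    ('k, 'b, 'y) hom_obj_scheme \<Rightarrow> ('b \<Rightarrow> 'a \<Rightarrow> 'b) \<Rightarrow>
    ('k, 'm, 'z) hom_obj_scheme \<Rightarrow> ('a \<Rightarrow> 'm \<Rightarrow> 'm) \<Rightarrow>
    ('k, ('k, 'b, 'm) tensor_elt set) hom_obj" where
  "balanced_tensor R A X ra M la =
    (let K = balanced_kernel R A X ra M la in
      module.extend (quotient_module (tensor R X M) K)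
        (hom_obj.fields (\<lambda>T. \<Union>t\<in>T. K +>\<^bsub>tensor R X M\<^esub> aut (tensor R X M) t)))"

definition balanced_tens ::
  "('k, 'r) ring_scheme \<Rightarrow> ('k, 'a, 'x) hom_obj_scheme \<Rightarrow>
    ('k, 'b, 'y) hom_obj_scheme \<Rightarrow> ('b \<Rightarrow> 'a \<Rightarrow> 'b) \<Rightarrow>
    ('k, 'm, 'z) hom_obj_scheme \<Rightarrow> ('a \<Rightarrow> 'm \<Rightarrow> 'm) \<Rightarrow>
    'b \<Rightarrow> 'm \<Rightarrow> ('k, 'b, 'm) tensor_elt set" where
  "balanced_tens R A X ra M la x m =
    balanced_kernel R A X ra M la +>\<^bsub>tensor R X M\<^esub> tens R X M x m"

definition restricted_act ::
  "('k, 'h1, 'a1, 'c1) doi_datum \<Rightarrow> ('a \<Rightarrow> 'a1) \<Rightarrow> 'a1 \<Rightarrow> 'a \<Rightarrow> 'a1" where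
  "restricted_act D' \<psi> a' a = a' \<otimes>\<^bsub>alg D'\<^esub> \<psi> a"

definition induced_obj ::
  "('k, 'r) ring_scheme \<Rightarrow> ('k, 'h, 'a, 'c) doi_datum \<Rightarrow> ('k, 'h1, 'a1, 'c1) doi_datum \<Rightarrow>
    ('a \<Rightarrow> 'a1) \<Rightarrow> ('k, 'a, 'c, 'm) doi_obj \<Rightarrow> ('k, ('k, 'a1, 'm) tensor_elt set) hom_obj" where
  "induced_obj R D D' \<psi> M =
    balanced_tensor R (alg D) (alg D') (restricted_act D' \<psi>) M (act M)"

definition induced_tens ::
  "('k, 'r) ring_scheme \<Rightarrow> ('k, 'h, 'a, 'c) doi_datum \<Rightarrow> ('k, 'h1, 'a1, 'c1) doi_datum \<Rightarrow>
    ('a \<Rightarrow> 'a1) \<Rightarrow> ('k, 'a, 'c, 'm) doi_obj \<Rightarrow>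
    'a1 \<Rightarrow> 'm \<Rightarrow> ('k, 'a1, 'm) tensor_elt set" where
  "induced_tens R D D' \<psi> M a' m =
    balanced_tens R (alg D) (alg D') (restricted_act D' \<psi>) M (act M) a' m"

end

theory Submission
  imports Defs
begin

text \<open>
  The functor exists because every structure map of \<open>A' \<otimes>\<^sub>A M\<close> is given by a formula that respects
  the defining relations. A linear map out of \<open>A' \<otimes>\<^sub>A M\<close> is the same as a bilinear map \<open>f\<close> on
  \<open>A' \<times> M\<close> that is balanced, \<open>f (a' \<psi>(a), m) = f (\<beta>'(a'), a \<cdot> \<mu>\<inverse>(m))\<close> (\<open>quotient_lift_bt\<close>), and two
  linear maps that agree on all \<open>a' \<otimes>\<^sub>A m\<close> are equal (\<open>Q_eqI\<close>). The action, the coaction and \<open>F(f)\<close> are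
  therefore obtained by checking that their formulas are balanced, and each axiom by comparing two
  linear maps on the generators \<open>a' \<otimes>\<^sub>A m\<close>.

  For the action, balancedness is Hom-associativity of \<open>A'\<close>: with \<open>x = \<beta>'\<inverse>(b')\<close> one has
  \<open>x (a' \<psi>(a)) = (\<beta>'\<inverse>(x) a') \<psi>(\<beta>(a))\<close>, and the relation moves \<open>\<beta>(a)\<close> across (\<open>act_balanced\<close>). For the
  coaction, multiplicativity of \<open>\<rho>\<^bsub>A'\<^esub>\<close>, the compatibility \<open>\<rho>\<^bsub>A'\<^esub>(\<psi>(a)) = \<psi>(a\<^sub>0) \<otimes> \<phi>(a\<^sub>1)\<close> and the
  compatibility of \<open>\<rho>\<^sub>M\<close> with the action reduce the claim to a termwise comparison in which \<open>C'\<close> being a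
  Hom-module and \<open>\<chi>(h \<cdot> c) = \<phi>(h) \<cdot> \<chi>(c)\<close> are used (\<open>comap_balanced\<close>). Coassociativity of the coaction on
  \<open>a' \<otimes>\<^sub>A m\<close> follows from that of \<open>\<rho>\<^sub>M\<close> and then that of \<open>\<rho>\<^bsub>A'\<^esub>\<close>, together with the
  multiplicativity of \<open>\<Delta>\<^bsub>C'\<^esub>\<close> (\<open>coQ_coassoc\<close>); the counit axiom and the compatibility of action and
  coaction are similar (\<open>coQ_counit\<close>, \<open>coQ_actQ\<close>).

  These are calculations in Sweedler notation. An expression \<open>E(c\<^sub>1, c\<^sub>2)\<close> is rendered as
  \<open>tensor_lift R P (\<lambda>x y. E x y) (\<Delta> c)\<close>, and the calculations rest on a few rules for
  \<^const>\<open>tensor_lift\<close>: congruence, exchange with linear maps, interchange of independent sums, and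
  substitution of one sum into another (\<open>tensor_lift_cong\<close>, \<open>linear_map_tensor_lift\<close>,
  \<open>tensor_lift_swap\<close>, \<open>tensor_lift_bind2\<close>). An axiom that is an equation in a tensor product, such as
  coassociativity, is turned into a rule for arbitrary multilinear \<open>E\<close> (\<open>coassoc_lift\<close>).
\<close>

section \<open>Linear maps, submodules and quotients\<close>

lemma linear_mapI:
  assumes "\<And>x. x \<in> carrier M \<Longrightarrow> f x \<in> carrier N"
    and "\<And>x y. \<lbrakk>x \<in> carrier M; y \<in> carrier M\<rbrakk> \<Longrightarrow> f (x \<oplus>\<^bsub>M\<^esub> y) = f x \<oplus>\<^bsub>N\<^esub> f y"
    and "\<And>r x. \<lbrakk>r \<in> carrier R; x \<in> carrier M\<rbrakk> \<Longrightarrow> f (r \<odot>\<^bsub>M\<^esub> x) = r \<odot>\<^bsub>N\<^esub> f x"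
  shows "linear_map R M N f"
  using assms by (auto simp: linear_map_def)

lemma linear_map_closed: "\<lbrakk>linear_map R M N f; x \<in> carrier M\<rbrakk> \<Longrightarrow> f x \<in> carrier N"
  by (auto simp: linear_map_def)

lemma linear_map_add:
  "\<lbrakk>linear_map R M N f; x \<in> carrier M; y \<in> carrier M\<rbrakk> \<Longrightarrow> f (x \<oplus>\<^bsub>M\<^esub> y) = f x \<oplus>\<^bsub>N\<^esub> f y"
  by (simp add: linear_map_def)

lemma linear_map_smult:
  "\<lbrakk>linear_map R M N f; r \<in> carrier R; x \<in> carrier M\<rbrakk> \<Longrightarrow> f (r \<odot>\<^bsub>M\<^esub> x) = r \<odot>\<^bsub>N\<^esub> f x"
  by (simp add: linear_map_def)

lemma linear_map_zero:
  assumes "module R M" "module R N" "linear_map R M N f"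
  shows "f \<zero>\<^bsub>M\<^esub> = \<zero>\<^bsub>N\<^esub>"
proof -
  interpret M: module R M by fact
  interpret N: module R N by fact
  have "f (\<zero>\<^bsub>R\<^esub> \<odot>\<^bsub>M\<^esub> \<zero>\<^bsub>M\<^esub>) = \<zero>\<^bsub>R\<^esub> \<odot>\<^bsub>N\<^esub> f \<zero>\<^bsub>M\<^esub>"
    by (rule linear_map_smult[OF assms(3)]) simp_all
  moreover have "f \<zero>\<^bsub>M\<^esub> \<in> carrier N" by (rule linear_map_closed[OF assms(3)]) simp
  ultimately show ?thesis by simp
qed

lemma linear_map_minus:
  assumes "module R M" "module R N" "linear_map R M N f" "x \<in> carrier M" "y \<in> carrier M"
  shows "f (x \<ominus>\<^bsub>M\<^esub> y) = f x \<ominus>\<^bsub>N\<^esub> f y"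
proof -
  interpret M: module R M by fact
  interpret N: module R N by fact
  have "f (x \<ominus>\<^bsub>M\<^esub> y) \<oplus>\<^bsub>N\<^esub> f y = f x"
    using linear_map_add[OF assms(3), of "x \<ominus>\<^bsub>M\<^esub> y" y] assms(4,5)
    by (simp add: M.M.minus_eq M.M.a_assoc M.M.l_neg)
  then show ?thesis
    using linear_map_closed[OF assms(3)] assms(4,5)
    by (metis M.M.minus_closed N.M.add.inv_solve_right' N.M.minus_eq)
qed

lemma linear_map_finsum:
  assumes "module R M" "module R N" "linear_map R M N f" "g \<in> A \<rightarrow> carrier M"
  shows "f (finsum M g A) = finsum N (\<lambda>i. f (g i)) A"
proof -
  interpret M: module R M by fact
  interpret N: module R N by fact
  have ?thesis if "finite A"
    using that assms(4)
  proof (induction A rule: finite_induct)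
    case empty
    then show ?case using linear_map_zero[OF assms(1-3)] by simp
  next
    case (insert i A)
    have *: "g i \<in> carrier M" "g \<in> A \<rightarrow> carrier M" "(\<lambda>i. f (g i)) \<in> A \<rightarrow> carrier N" "f (g i) \<in> carrier N"
      using insert.prems linear_map_closed[OF assms(3)] by auto
    with insert show ?case
      by (simp add: linear_map_add[OF assms(3)])
  qed
  moreover have ?thesis if "infinite A"
    using that linear_map_zero[OF assms(1-3)] by simp
  ultimately show ?thesis by blast
qed

lemma linear_map_id: "linear_map R M M (\<lambda>x. x)"
  by (simp add: linear_map_def)

lemma linear_map_comp:
  "\<lbrakk>linear_map R N P f; linear_map R M N g\<rbrakk> \<Longrightarrow> linear_map R M P (\<lambda>x. f (g x))"
  by (auto simp: linear_map_def Pi_iff)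

lemma linear_map_cong:
  assumes "module R M" "\<And>x. x \<in> carrier M \<Longrightarrow> f x = g x" "linear_map R M N f"
  shows "linear_map R M N g"
proof -
  interpret M: module R M by fact
  show ?thesis using assms(2,3) by (auto simp: linear_map_def Pi_iff)
qed

lemma linear_equalizer_submodule:
  assumes "module R M" "module R N" "linear_map R M N f" "linear_map R M N g"
  shows "submodule {x \<in> carrier M. f x = g x} R M"
proof -
  interpret M: module R M by fact
  interpret N: module R N by fact
  have inv: "h (\<ominus>\<^bsub>M\<^esub> a) = \<ominus>\<^bsub>N\<^esub> h a" if "linear_map R M N h" "a \<in> carrier M" for h a
    using linear_map_minus[OF assms(1,2) that(1), of "\<zero>\<^bsub>M\<^esub>" a] that
      linear_map_zero[OF assms(1,2) that(1)]  linear_map_closed[OF that(1)]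
    by (simp add: M.M.minus_eq N.M.minus_eq)
  show ?thesis
    by (rule M.submoduleI)
      (auto simp: linear_map_zero[OF assms(1,2)] assms(3,4) linear_map_add[OF assms(3)]
        linear_map_add[OF assms(4)] linear_map_smult[OF assms(3)] linear_map_smult[OF assms(4)] inv
        linear_map_zero[OF assms(1,2,3)] linear_map_zero[OF assms(1,2,4)])
qed

lemma module_cong:
  assumes "module R M" "carrier M' = carrier M" "add M' = add M" "zero M' = zero M" "smult M' = smult M"
  shows "module R M'"
proof -
  interpret M: module R M by fact
  have "abelian_group M'"
    by (rule abelian_groupI)
      (use abelian_groupE[OF M.abelian_group_axioms] assms(2-5) in \<open>auto simp: M.a_assoc M.a_comm\<close>)
  then show ?thesis
    by (rule moduleI[OF M.R.cring_axioms])
      (simp_all add: assms M.smult_l_distr M.smult_r_distr M.smult_assoc1)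
qed

lemma submodule_submodule_gen:
  assumes "module R M" "S \<subseteq> carrier M"
  shows "submodule (submodule_gen R M S) R M"
proof -
  interpret M: module R M by fact
  have mem: "N \<subseteq> carrier M \<and> \<zero>\<^bsub>M\<^esub> \<in> N" if "submodule N R M" for N
    using M.submoduleE(1)[OF that] subgroup.one_closed[OF submodule.axioms(1)[OF that]] by auto
  show ?thesis
    unfolding submodule_gen_def
  proof (rule M.submoduleI)
    show "\<Inter> {N. submodule N R M \<and> S \<subseteq> N} \<subseteq> carrier M"
      using M.carrier_is_submodule assms(2) by blast
  qed (auto dest: mem M.submoduleE(3,4,5))
qed

lemma submodule_gen_superset: "S \<subseteq> submodule_gen R M S"
  by (auto simp: submodule_gen_def)

lemma submodule_gen_least: "\<lbrakk>submodule N R M; S \<subseteq> N\<rbrakk> \<Longrightarrow> submodule_gen R M S \<subseteq> N"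
  by (auto simp: submodule_gen_def)

text \<open>To show that a linear map vanishes on a submodule, or that two linear maps agree there, it
  suffices to look at generators.\<close>

lemma linear_map_eq_on_submodule_gen:
  assumes "module R M" "module R N" "linear_map R M N f" "linear_map R M N g"
    and "S \<subseteq> carrier M" "\<And>s. s \<in> S \<Longrightarrow> f s = g s" "x \<in> submodule_gen R M S"
  shows "f x = g x"
  using submodule_gen_least[OF linear_equalizer_submodule[OF assms(1-4)], of S] assms(5-7) by auto

lemma zero_linear:
  assumes "module R M" "module R N"
  shows "linear_map R M N (\<lambda>x. \<zero>\<^bsub>N\<^esub>)"
proof -
  interpret M: module R M by fact
  interpret N: module R N by fact
  show ?thesis by (rule linear_mapI) simp_all
qed

text \<open>The quotient of a module by a submodule.\<close>

locale quotient_setup = module R M for R :: "('k, 'r) ring_scheme" and M :: "('k, 'm, 'x) module_scheme" (structure) +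
  fixes N
  assumes sub: "submodule N R M"
begin

lemma absub: "abelian_subgroup N M"
  by (rule abelian_subgroupI3)
    (auto simp: additive_subgroup_def submodule.axioms(1)[OF sub] M.abelian_group_axioms)

sublocale AS: abelian_subgroup N M by (rule absub)

abbreviation "Q \<equiv> quotient_module M N"

lemma carrier_Q: "carrier Q = (\<lambda>x. N +> x) ` carrier M"
  by (auto simp: quotient_module_def A_RCOSETS_def')

text \<open>The scalar multiplication of a quotient module is a union over the elements of a coset; for
  a function that is constant on the coset, this union is its value.\<close>

lemma coset_union:
  assumes "x \<in> carrier M" "\<And>n. n \<in> N \<Longrightarrow> g (n \<oplus> x) = g x"
  shows "(\<Union>y\<in>N +> x. g y) = g x"
proof -
  have "g y = g x" if "y \<in> N +> x" for y
    using that assms(2) by (auto simp: a_r_coset_def')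
  then show ?thesis using AS.a_rcos_self[OF assms(1)] by blast
qed

lemma coset_absorb: "\<lbrakk>n \<in> N; x \<in> carrier M\<rbrakk> \<Longrightarrow> N +> (n \<oplus> x) = N +> x"
  by (metis AS.a_rcos_const AS.a_Hcarr M.a_coset_add_assoc AS.a_subset)

lemma coset_eqI:
  assumes "x \<in> carrier M" "y \<in> carrier M" "x \<ominus> y \<in> N"
  shows "N +> x = N +> y"
  using coset_absorb[OF assms(3,2)] assms(1,2) by (simp add: M.minus_eq M.a_assoc M.l_neg)

lemma Q_simps:
  "zero Q = N" "add Q = set_add M"
  by (simp_all add: quotient_module_def)

lemma Q_add: "\<lbrakk>x \<in> carrier M; y \<in> carrier M\<rbrakk> \<Longrightarrow> (N +> x) \<oplus>\<^bsub>Q\<^esub> (N +> y) = N +> (x \<oplus> y)"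
  by (simp add: Q_simps AS.a_rcos_sum)

lemma Q_smult:
  assumes "r \<in> carrier R" "x \<in> carrier M"
  shows "r \<odot>\<^bsub>Q\<^esub> (N +> x) = N +> (r \<odot> x)"
proof -
  have "(\<Union>y\<in>N +> x. N +> (r \<odot> y)) = N +> (r \<odot> x)"
    by (rule coset_union)
      (use assms submodule.smult_closed[OF sub] AS.a_subset
        in \<open>auto simp: smult_r_distr coset_absorb\<close>)
  then show ?thesis by (simp add: quotient_module_def)
qed

lemma N_coset: "N = N +> \<zero>"
  using AS.a_subset by (simp add: M.a_coset_add_zero)

lemma module_quotient: "module R Q"
proof (rule moduleI[OF R.cring_axioms])
  show "abelian_group Q"
  proof (rule abelian_groupI)
    fix q assume "q \<in> carrier Q"
    then obtain x where x: "x \<in> carrier M" "q = N +> x" by (auto simp: carrier_Q)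
    then show "\<exists>y\<in>carrier Q. y \<oplus>\<^bsub>Q\<^esub> q = \<zero>\<^bsub>Q\<^esub>"
      by (intro bexI[of _ "N +> (\<ominus> x)"]) (simp_all add: Q_add carrier_Q M.l_neg Q_simps(1) N_coset[symmetric])
    show "\<zero>\<^bsub>Q\<^esub> \<oplus>\<^bsub>Q\<^esub> q = q"
      using Q_add[of "\<zero>" x] x by (simp add: Q_simps(1) N_coset[symmetric])
    next
    show "\<zero>\<^bsub>Q\<^esub> \<in> carrier Q" unfolding carrier_Q Q_simps(1) by (subst N_coset) blast
  qed (auto simp: carrier_Q Q_add M.a_ac)
qed (auto simp: carrier_Q Q_add Q_smult smult_l_distr smult_r_distr smult_assoc1)

lemma coset_linear: "linear_map R M Q (\<lambda>x. N +> x)"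
  by (rule linear_mapI) (auto simp: carrier_Q Q_add Q_smult)

text \<open>A linear map that vanishes on the submodule may be evaluated at any representative of a coset.\<close>

lemma coset_some:
  assumes "module R P" "linear_map R M P f" "\<And>n. n \<in> N \<Longrightarrow> f n = \<zero>\<^bsub>P\<^esub>" "x \<in> carrier M"
  shows "f (SOME y. y \<in> N +> x) = f x"
proof -
  interpret P: module R P by fact
  have "(SOME y. y \<in> N +> x) \<in> N +> x"
    using AS.a_rcos_self[OF assms(4)] by (rule someI)
  then obtain n where n: "n \<in> N" "(SOME y. y \<in> N +> x) = n \<oplus> x"
    by (auto simp: a_r_coset_def')
  moreover have "n \<in> carrier M" using n AS.a_subset by blast
  ultimately show ?thesis
    using linear_map_add[OF assms(2) _ assms(4), of n] assms(3,4) linear_map_closed[OF assms(2,4)] by simp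
qed

lemma quotient_lift_linear:
  assumes "module R P" "linear_map R M P f" "\<And>n. n \<in> N \<Longrightarrow> f n = \<zero>\<^bsub>P\<^esub>"
  shows "linear_map R Q P (\<lambda>q. f (SOME y. y \<in> q))"
  by (rule linear_mapI)
    (auto simp: carrier_Q Q_add Q_smult coset_some[OF assms] linear_map_closed[OF assms(2)]
      linear_map_add[OF assms(2)] linear_map_smult[OF assms(2)])

lemma quotient_some_mem:
  assumes "q \<in> carrier Q"
  shows "(SOME y. y \<in> q) \<in> q" "q \<subseteq> carrier M"
proof -
  obtain x where x: "x \<in> carrier M" "q = N +> x" using assms by (auto simp: carrier_Q)
  show "(SOME y. y \<in> q) \<in> q" using AS.a_rcos_self[OF x(1)] unfolding x(2) by (rule someI)
  show "q \<subseteq> carrier M" using M.a_r_coset_subset_G[OF AS.a_subset x(1)] x(2) by simp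
qed

end

section \<open>Free modules\<close>

text \<open>The free module on a set of generators.\<close>

locale free_setup = cring R for R :: "('k, 'r) ring_scheme" (structure) +
  fixes I :: "'i set"
begin

abbreviation "Fr \<equiv> free_module R I"

lemma carrier_Fr: "u \<in> carrier Fr \<longleftrightarrow>
    (\<forall>i. u i \<in> carrier R) \<and> finite {i. u i \<noteq> \<zero>} \<and> (\<forall>i. i \<notin> I \<longrightarrow> u i = \<zero>)"
  by (simp add: free_module_def)

lemma Fr_simps:
  "zero Fr = (\<lambda>i. \<zero>)" "u \<oplus>\<^bsub>Fr\<^esub> v = (\<lambda>i. u i \<oplus> v i)" "r \<odot>\<^bsub>Fr\<^esub> u = (\<lambda>i. r \<otimes> u i)"
  by (simp_all add: free_module_def)

lemma Fr_add_closed: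
  assumes "u \<in> carrier Fr" "v \<in> carrier Fr"
  shows "(\<lambda>i. u i \<oplus> v i) \<in> carrier Fr"
proof -
  have "{i. u i \<oplus> v i \<noteq> \<zero>} \<subseteq> {i. u i \<noteq> \<zero>} \<union> {i. v i \<noteq> \<zero>}" by auto
  then show ?thesis using assms by (auto simp: carrier_Fr dest: finite_subset)
qed

lemma Fr_smult_closed:
  assumes "r \<in> carrier R" "v \<in> carrier Fr"
  shows "(\<lambda>i. r \<otimes> v i) \<in> carrier Fr"
proof -
  have "{i. r \<otimes> v i \<noteq> \<zero>} \<subseteq> {i. v i \<noteq> \<zero>}" using assms by auto
  then show ?thesis using assms by (auto simp: carrier_Fr dest: finite_subset)
qed

lemma module_Fr: "module R Fr"
proof (rule moduleI[OF cring_axioms])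
  show "abelian_group Fr"
  proof (rule abelian_groupI)
    fix u assume u: "u \<in> carrier Fr"
    have "(\<lambda>i. \<ominus> \<one> \<otimes> u i) \<in> carrier Fr" using u by (intro Fr_smult_closed) simp
    then show "\<exists>y\<in>carrier Fr. y \<oplus>\<^bsub>Fr\<^esub> u = \<zero>\<^bsub>Fr\<^esub>"
      by (rule bexI[rotated]) (use u in \<open>auto simp: Fr_simps carrier_Fr l_minus l_neg\<close>)
  qed (auto simp: Fr_simps Fr_add_closed, auto simp: carrier_Fr a_ac)
qed (auto simp: Fr_simps Fr_smult_closed, auto simp: carrier_Fr l_distr r_distr m_assoc)

lemma free_gen_closed: "i \<in> I \<Longrightarrow> free_gen R i \<in> carrier Fr"
  by (auto simp: free_gen_def carrier_Fr)

text \<open>The linear map on the free module extending a map \<open>f\<close> of the basis. The sum runs over the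
  support of its argument, hence over different index sets for different arguments; for linearity
  they are enlarged to a common one.\<close>

definition extend_basis :: "('k, 'p, 'z) module_scheme \<Rightarrow> ('i \<Rightarrow> 'p) \<Rightarrow> ('i \<Rightarrow> 'k) \<Rightarrow> 'p" where
  "extend_basis P f u = (\<Oplus>\<^bsub>P\<^esub>i\<in>{i. u i \<noteq> \<zero>}. u i \<odot>\<^bsub>P\<^esub> f i)"

lemma extend_basis_superset:
  assumes "module R P" "u \<in> carrier Fr" "f \<in> I \<rightarrow> carrier P" "{i. u i \<noteq> \<zero>} \<subseteq> S" "S \<subseteq> I" "finite S"
  shows "extend_basis P f u = (\<Oplus>\<^bsub>P\<^esub>i\<in>S. u i \<odot>\<^bsub>P\<^esub> f i)"
proof -
  interpret P: module R P by fact
  show ?thesis unfolding extend_basis_def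
    by (rule P.M.add.finprod_mono_neutral_cong_left)
      (use assms in \<open>auto simp: carrier_Fr Pi_iff intro!: P.smult_l_null P.smult_closed\<close>)
qed

lemma extend_basis_linear:
  assumes "module R P" "f \<in> I \<rightarrow> carrier P"
  shows "linear_map R Fr P (extend_basis P f)"
proof -
  interpret P: module R P by fact
  note sup = extend_basis_superset[OF assms(1) _ assms(2)]
  show ?thesis
  proof (rule linear_mapI)
    fix u assume u: "u \<in> carrier Fr"
    have "f i \<in> carrier P" if "u i \<noteq> \<zero>" for i using that u assms(2) by (auto simp: carrier_Fr)
    then show "extend_basis P f u \<in> carrier P"
      unfolding extend_basis_def using u by (intro P.finsum_closed) (auto simp: carrier_Fr)
    fix r assume r: "r \<in> carrier R"
    let ?S = "{i. u i \<noteq> \<zero>}"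
    have S: "?S \<subseteq> I" "finite ?S" and fS: "f i \<in> carrier P" "u i \<in> carrier R" if "i \<in> ?S" for i
      using u assms(2) that by (auto simp: carrier_Fr)
    have S: "?S \<subseteq> I" "finite ?S" using u by (auto simp: carrier_Fr)
    have "extend_basis P f (r \<odot>\<^bsub>Fr\<^esub> u) = (\<Oplus>\<^bsub>P\<^esub>i\<in>?S. (r \<otimes> u i) \<odot>\<^bsub>P\<^esub> f i)"
      unfolding Fr_simps by (rule sup[OF Fr_smult_closed[OF r u] _ S]) (use r in auto)
    also have "\<dots> = (\<Oplus>\<^bsub>P\<^esub>i\<in>?S. r \<odot>\<^bsub>P\<^esub> (u i \<odot>\<^bsub>P\<^esub> f i))"
      by (rule P.M.finsum_cong') (use r fS in \<open>auto simp: P.smult_assoc1\<close>)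
    also have "\<dots> = r \<odot>\<^bsub>P\<^esub> extend_basis P f u"
      unfolding extend_basis_def using r fS S by (subst P.finsum_smult_ldistr) auto
    finally show "extend_basis P f (r \<odot>\<^bsub>Fr\<^esub> u) = r \<odot>\<^bsub>P\<^esub> extend_basis P f u" .
  next
    fix u v assume u: "u \<in> carrier Fr" and v: "v \<in> carrier Fr"
    let ?S = "{i. u i \<noteq> \<zero>} \<union> {i. v i \<noteq> \<zero>}"
    have S: "?S \<subseteq> I" "finite ?S" using u v by (auto simp: carrier_Fr)
    have fS: "f i \<in> carrier P" "u i \<in> carrier R" "v i \<in> carrier R" if "i \<in> ?S" for i
      using u v assms(2) that by (auto simp: carrier_Fr)
    have "extend_basis P f (u \<oplus>\<^bsub>Fr\<^esub> v) = (\<Oplus>\<^bsub>P\<^esub>i\<in>?S. (u i \<oplus> v i) \<odot>\<^bsub>P\<^esub> f i)"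
      unfolding Fr_simps by (rule sup[OF Fr_add_closed[OF u v] _ S]) auto
    also have "\<dots> = (\<Oplus>\<^bsub>P\<^esub>i\<in>?S. u i \<odot>\<^bsub>P\<^esub> f i \<oplus>\<^bsub>P\<^esub> v i \<odot>\<^bsub>P\<^esub> f i)"
      by (rule P.M.finsum_cong') (use fS in \<open>auto simp: P.smult_l_distr\<close>)
    also have "\<dots> = extend_basis P f u \<oplus>\<^bsub>P\<^esub> extend_basis P f v"
      using sup[OF u _ S] sup[OF v _ S] fS by (subst P.finsum_addf) auto
    finally show "extend_basis P f (u \<oplus>\<^bsub>Fr\<^esub> v) = extend_basis P f u \<oplus>\<^bsub>P\<^esub> extend_basis P f v" .
  qed
qed

lemma extend_basis_gen:
  assumes "module R P" "f \<in> I \<rightarrow> carrier P" "i \<in> I"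
  shows "extend_basis P f (free_gen R i) = f i"
proof -
  interpret P: module R P by fact
  have "f i \<in> carrier P" using assms by auto
  then show ?thesis
    by (subst extend_basis_superset[OF assms(1) free_gen_closed[OF assms(3)] assms(2), of "{i}"])
      (use assms(3) in \<open>auto simp: free_gen_def\<close>)
qed

text \<open>The basis generates: induct on the support, splitting off one basis vector at a time.\<close>

lemma free_induct:
  assumes "submodule N R Fr" "\<And>i. i \<in> I \<Longrightarrow> free_gen R i \<in> N"
  shows "carrier Fr \<subseteq> N"
proof
  interpret Fr: module R Fr by (rule module_Fr)
  fix u assume "u \<in> carrier Fr"
  moreover have "finite S \<Longrightarrow> \<forall>u\<in>carrier Fr. {i. u i \<noteq> \<zero>} \<subseteq> S \<longrightarrow> u \<in> N" for S
  proof (induction S rule: finite_induct)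
    case empty
    have "u = \<zero>\<^bsub>Fr\<^esub>" if "{i. u i \<noteq> \<zero>} \<subseteq> {}" for u
      using that by (auto simp: Fr_simps)
    then show ?case
      using subgroup.one_closed[OF submodule.axioms(1)[OF assms(1)]] by auto
  next
    case (insert j S)
    show ?case
    proof (intro ballI impI)
      fix u assume u: "u \<in> carrier Fr" "{i. u i \<noteq> \<zero>} \<subseteq> insert j S"
      show "u \<in> N"
      proof (cases "u j = \<zero>")
        case True
        then show ?thesis using insert.IH u by (metis (mono_tags, lifting) insert_iff mem_Collect_eq subset_iff)
      next
        case False
        then have j: "j \<in> I" using u by (auto simp: carrier_Fr)
        define v where "v = u(j := \<zero>)"
        have "{i. v i \<noteq> \<zero>} \<subseteq> {i. u i \<noteq> \<zero>}" by (auto simp: v_def)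
        then have "v \<in> carrier Fr"
          using u by (auto simp: carrier_Fr v_def intro: finite_subset)
        moreover have "{i. v i \<noteq> \<zero>} \<subseteq> S" using u(2) by (auto simp: v_def)
        ultimately have "v \<in> N" using insert.IH by blast
        moreover have "u j \<odot>\<^bsub>Fr\<^esub> free_gen R j \<in> N"
          using u(1) submodule.smult_closed[OF assms(1)] assms(2)[OF j] by (auto simp: carrier_Fr)
        moreover have "u = v \<oplus>\<^bsub>Fr\<^esub> u j \<odot>\<^bsub>Fr\<^esub> free_gen R j"
          using u(1) by (auto simp: Fr_simps carrier_Fr v_def free_gen_def)
        ultimately show ?thesis using Fr.submoduleE(5)[OF assms(1)] by metis
      qed
    qed
  qed
  ultimately show "u \<in> N" by (auto simp: carrier_Fr)
qed

end

section \<open>Tensor products\<close>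

lemma bilinear_mapI:
  assumes "\<And>x. x \<in> carrier M \<Longrightarrow> linear_map R N P (\<lambda>y. f x y)"
    and "\<And>y. y \<in> carrier N \<Longrightarrow> linear_map R M P (\<lambda>x. f x y)"
  shows "bilinear_map R M N P f"
  using assms by (simp add: bilinear_map_def)

lemma bilinear_map_left: "\<lbrakk>bilinear_map R M N P f; y \<in> carrier N\<rbrakk> \<Longrightarrow> linear_map R M P (\<lambda>x. f x y)"
  and bilinear_map_right: "\<lbrakk>bilinear_map R M N P f; x \<in> carrier M\<rbrakk> \<Longrightarrow> linear_map R N P (\<lambda>y. f x y)"
  by (simp_all add: bilinear_map_def)

lemma bilinear_map_closed:
  "\<lbrakk>bilinear_map R M N P f; x \<in> carrier M; y \<in> carrier N\<rbrakk> \<Longrightarrow> f x y \<in> carrier P"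
  by (rule linear_map_closed[OF bilinear_map_left])

text \<open>The tensor product of two modules over a commutative ring, as a quotient of a free module.\<close>

locale tensor_setup = M: module R M + N: module R N
  for R :: "('k, 'r) ring_scheme" and M :: "('k, 'm, 'x) module_scheme"
    and N :: "('k, 'n, 'y) module_scheme"
begin

sublocale Fr: free_setup R "carrier M \<times> carrier N" ..

abbreviation "e x y \<equiv> free_gen R (x, y)"

lemma e_closed: "\<lbrakk>x \<in> carrier M; y \<in> carrier N\<rbrakk> \<Longrightarrow> e x y \<in> carrier Fr.Fr"
  by (rule Fr.free_gen_closed) simp

lemma tensor_relations_subset: "tensor_relations R M N \<subseteq> carrier Fr.Fr"
proof -
  interpret F: module R Fr.Fr by (rule Fr.module_Fr)
  note closed = e_closed F.M.minus_closed F.M.a_closed F.smult_closed M.M.a_closed N.M.a_closed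
    M.smult_closed N.smult_closed
  show ?thesis
    unfolding tensor_relations_def Let_def
    by (intro Un_least subsetI; clarify; intro closed; assumption)
qed

lemma tensor_kernel_submodule: "submodule (tensor_kernel R M N) R Fr.Fr"
  unfolding tensor_kernel_def by (rule submodule_submodule_gen[OF Fr.module_Fr tensor_relations_subset])

sublocale T: quotient_setup R Fr.Fr "tensor_kernel R M N"
  by (intro quotient_setup.intro quotient_setup_axioms.intro Fr.module_Fr tensor_kernel_submodule)

abbreviation "TM \<equiv> tensor_module R M N"

lemma TM_eq: "TM = T.Q" by (simp add: tensor_module_def)

lemma tens_eq: "tens R M N x y = tensor_kernel R M N +>\<^bsub>Fr.Fr\<^esub> e x y"
  by (simp add: tens_def)

lemma module_TM: "module R TM"
  unfolding TM_eq by (rule T.module_quotient)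

lemma bilinear_tens: "bilinear_map R M N TM (tens R M N)"
proof -
  let ?K = "tensor_kernel R M N"
  have *: "?K +>\<^bsub>Fr.Fr\<^esub> u = ?K +>\<^bsub>Fr.Fr\<^esub> v"
    if "u \<in> carrier Fr.Fr" "v \<in> carrier Fr.Fr" "u \<ominus>\<^bsub>Fr.Fr\<^esub> v \<in> tensor_relations R M N" for u v
    by (rule T.coset_eqI[OF that(1,2)])
      (use that(3) in \<open>simp add: tensor_kernel_def subsetD[OF submodule_gen_superset]\<close>)
  note rel = tensor_relations_def Let_def
  show ?thesis
  proof (rule bilinear_mapI)
    fix x assume x: "x \<in> carrier M"
    show "linear_map R N TM (tens R M N x)"
    proof (rule linear_mapI)
      fix y assume y: "y \<in> carrier N"
      show "tens R M N x y \<in> carrier TM"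
        using e_closed[OF x y] by (simp add: tens_eq TM_eq T.carrier_Q)
      fix r assume r: "r \<in> carrier R"
      have "?K +>\<^bsub>Fr.Fr\<^esub> e x (r \<odot>\<^bsub>N\<^esub> y) = ?K +>\<^bsub>Fr.Fr\<^esub> (r \<odot>\<^bsub>Fr.Fr\<^esub> e x y)"
        by (rule *) (use x y r in \<open>auto simp: rel intro!: e_closed T.smult_closed\<close>)
      then show "tens R M N x (r \<odot>\<^bsub>N\<^esub> y) = r \<odot>\<^bsub>TM\<^esub> tens R M N x y"
        by (simp add: tens_eq TM_eq T.Q_smult r e_closed[OF x y])
    next
      fix y y' assume y: "y \<in> carrier N" "y' \<in> carrier N"
      have "?K +>\<^bsub>Fr.Fr\<^esub> e x (y \<oplus>\<^bsub>N\<^esub> y') = ?K +>\<^bsub>Fr.Fr\<^esub> (e x y \<oplus>\<^bsub>Fr.Fr\<^esub> e x y')"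
        by (rule *) (use x y in \<open>auto simp: rel intro!: e_closed T.M.a_closed\<close>)
      then show "tens R M N x (y \<oplus>\<^bsub>N\<^esub> y') = tens R M N x y \<oplus>\<^bsub>TM\<^esub> tens R M N x y'"
        by (simp add: tens_eq TM_eq T.Q_add e_closed[OF x] y)
    qed
  next
    fix y assume y: "y \<in> carrier N"
    show "linear_map R M TM (\<lambda>x. tens R M N x y)"
    proof (rule linear_mapI)
      fix x assume x: "x \<in> carrier M"
      show "tens R M N x y \<in> carrier TM"
        using e_closed[OF x y] by (simp add: tens_eq TM_eq T.carrier_Q)
      fix r assume r: "r \<in> carrier R"
      have "?K +>\<^bsub>Fr.Fr\<^esub> e (r \<odot>\<^bsub>M\<^esub> x) y = ?K +>\<^bsub>Fr.Fr\<^esub> (r \<odot>\<^bsub>Fr.Fr\<^esub> e x y)"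
        by (rule *) (use x y r in \<open>auto simp: rel intro!: e_closed T.smult_closed\<close>)
      then show "tens R M N (r \<odot>\<^bsub>M\<^esub> x) y = r \<odot>\<^bsub>TM\<^esub> tens R M N x y"
        by (simp add: tens_eq TM_eq T.Q_smult r e_closed[OF x y])
    next
      fix x x' assume x: "x \<in> carrier M" "x' \<in> carrier M"
      have "?K +>\<^bsub>Fr.Fr\<^esub> e (x \<oplus>\<^bsub>M\<^esub> x') y = ?K +>\<^bsub>Fr.Fr\<^esub> (e x y \<oplus>\<^bsub>Fr.Fr\<^esub> e x' y)"
        by (rule *, simp_all add: e_closed T.M.a_closed x y, unfold rel, use x y in blast)
      then show "tens R M N (x \<oplus>\<^bsub>M\<^esub> x') y = tens R M N x y \<oplus>\<^bsub>TM\<^esub> tens R M N x' y"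
        by (simp add: tens_eq TM_eq T.Q_add e_closed x y)
    qed
  qed
qed

text \<open>Pure tensors generate.\<close>

lemma TM_eqI:
  assumes P: "module R P" and lin: "linear_map R TM P f" "linear_map R TM P g"
    and eq: "\<And>x y. \<lbrakk>x \<in> carrier M; y \<in> carrier N\<rbrakk> \<Longrightarrow> f (tens R M N x y) = g (tens R M N x y)"
    and t: "t \<in> carrier TM"
  shows "f t = g t"
proof -
  let ?c = "\<lambda>u. tensor_kernel R M N +>\<^bsub>Fr.Fr\<^esub> u"
  let ?S = "{u \<in> carrier Fr.Fr. f (?c u) = g (?c u)}"
  have l: "linear_map R Fr.Fr P (\<lambda>u. h (?c u))" if "linear_map R TM P h" for h
    using linear_map_comp[OF _ T.coset_linear] that by (simp add: TM_eq)
  have "submodule ?S R Fr.Fr"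
    by (rule linear_equalizer_submodule[OF Fr.module_Fr P l l]) (fact lin)+
  then have "carrier Fr.Fr \<subseteq> ?S"
    by (rule Fr.free_induct) (use eq in \<open>auto simp: tens_eq Fr.free_gen_closed\<close>)
  then show ?thesis using t by (auto simp: TM_eq T.carrier_Q)
qed

lemma tensor_lift_eq:
  "tensor_lift R P f t = Fr.extend_basis P (\<lambda>i. f (fst i) (snd i)) (SOME u. u \<in> t)"
  by (simp add: tensor_lift_def Fr.extend_basis_def Let_def)

lemma extend_bilinear:
  assumes "module R P" "bilinear_map R M N P f"
  defines "g \<equiv> Fr.extend_basis P (\<lambda>i. f (fst i) (snd i))"
  shows "linear_map R Fr.Fr P g"
    and "\<lbrakk>x \<in> carrier M; y \<in> carrier N\<rbrakk> \<Longrightarrow> g (e x y) = f x y"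
    and "u \<in> tensor_kernel R M N \<Longrightarrow> g u = \<zero>\<^bsub>P\<^esub>"
proof -
  interpret P: module R P by fact
  have f: "(\<lambda>i. f (fst i) (snd i)) \<in> carrier M \<times> carrier N \<rightarrow> carrier P"
    using bilinear_map_closed[OF assms(2)] by auto
  show lin: "linear_map R Fr.Fr P g"
    unfolding g_def by (rule Fr.extend_basis_linear[OF assms(1) f])
  show g: "g (e x y) = f x y" if "x \<in> carrier M" "y \<in> carrier N" for x y
    using Fr.extend_basis_gen[OF assms(1) f, of "(x, y)"] that by (simp add: g_def)
  note minus = linear_map_minus[OF Fr.module_Fr assms(1) lin]
  note closed = e_closed T.M.a_closed T.smult_closed M.M.a_closed N.M.a_closed M.smult_closed
    N.smult_closed bilinear_map_closed[OF assms(2)]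
  have rel: "g s = \<zero>\<^bsub>P\<^esub>" if "s \<in> tensor_relations R M N" for s
    using that
    by (auto simp: tensor_relations_def Let_def minus g linear_map_add[OF lin] closed
        linear_map_smult[OF lin] linear_map_add[OF bilinear_map_left[OF assms(2)]]
        linear_map_add[OF bilinear_map_right[OF assms(2)]]
        linear_map_smult[OF bilinear_map_left[OF assms(2)]]
        linear_map_smult[OF bilinear_map_right[OF assms(2)]] P.M.minus_eq P.M.r_neg)
  assume "u \<in> tensor_kernel R M N"
  then show "g u = \<zero>\<^bsub>P\<^esub>"
    using linear_map_eq_on_submodule_gen[OF Fr.module_Fr assms(1) lin zero_linear[OF Fr.module_Fr assms(1)]
        tensor_relations_subset] rel
    unfolding tensor_kernel_def by blast
qed

lemma TM_lift_linear:
  assumes "module R P" "bilinear_map R M N P f"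
  shows "linear_map R TM P (tensor_lift R P f)"
  unfolding tensor_lift_eq[abs_def] TM_eq
  by (rule T.quotient_lift_linear[OF assms(1)]) (fact extend_bilinear[OF assms])+

lemma TM_lift_tens:
  assumes "module R P" "bilinear_map R M N P f" "x \<in> carrier M" "y \<in> carrier N"
  shows "tensor_lift R P f (tens R M N x y) = f x y"
  unfolding tensor_lift_eq tens_eq
  using T.coset_some[OF assms(1) extend_bilinear(1,3)[OF assms(1,2)], OF _ e_closed[OF assms(3,4)]]
  by (simp add: extend_bilinear(2)[OF assms])

text \<open>The remaining rules for \<^const>\<open>tensor_lift\<close> do not require \<open>f\<close> to be bilinear, because both sides
  evaluate \<open>f\<close> at the terms of the same chosen representative.\<close>

lemma rep_props:
  assumes "t \<in> carrier TM"
  defines "u \<equiv> SOME u. u \<in> t"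
  shows "finite {i. u i \<noteq> \<zero>\<^bsub>R\<^esub>}" "u i \<in> carrier R"
    and "i \<in> {i. u i \<noteq> \<zero>\<^bsub>R\<^esub>} \<Longrightarrow> fst i \<in> carrier M"
    and "i \<in> {i. u i \<noteq> \<zero>\<^bsub>R\<^esub>} \<Longrightarrow> snd i \<in> carrier N"
proof -
  have "u \<in> carrier Fr.Fr"
    using T.quotient_some_mem[of t] assms by (auto simp: TM_eq)
  then show "finite {i. u i \<noteq> \<zero>\<^bsub>R\<^esub>}" "u i \<in> carrier R"
    unfolding Fr.carrier_Fr by blast+
  from \<open>u \<in> carrier Fr.Fr\<close> have "{i. u i \<noteq> \<zero>\<^bsub>R\<^esub>} \<subseteq> carrier M \<times> carrier N"
    unfolding Fr.carrier_Fr by blast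
  then show "i \<in> {i. u i \<noteq> \<zero>\<^bsub>R\<^esub>} \<Longrightarrow> fst i \<in> carrier M" "i \<in> {i. u i \<noteq> \<zero>\<^bsub>R\<^esub>} \<Longrightarrow> snd i \<in> carrier N"
    by auto
qed

lemma TM_lift_cong:
  assumes "module R P" "t \<in> carrier TM" "\<And>x y. \<lbrakk>x \<in> carrier M; y \<in> carrier N\<rbrakk> \<Longrightarrow> f x y = g x y"
    and "\<And>x y. \<lbrakk>x \<in> carrier M; y \<in> carrier N\<rbrakk> \<Longrightarrow> g x y \<in> carrier P"
  shows "tensor_lift R P f t = tensor_lift R P g t"
proof -
  interpret P: module R P by fact
  show ?thesis
    unfolding tensor_lift_def Let_def
    using rep_props[OF assms(2)] assms(3,4)
    by (intro P.M.finsum_cong') (auto simp: Pi_iff subset_iff)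
qed

lemma TM_lift_closed:
  assumes "module R P" "t \<in> carrier TM" "\<And>x y. \<lbrakk>x \<in> carrier M; y \<in> carrier N\<rbrakk> \<Longrightarrow> f x y \<in> carrier P"
  shows "tensor_lift R P f t \<in> carrier P"
proof -
  interpret P: module R P by fact
  show ?thesis
    unfolding tensor_lift_def Let_def
    using rep_props[OF assms(2)] assms(3)
    by (intro P.M.finsum_closed) (auto simp: Pi_iff subset_iff)
qed

lemma TM_lift_linear_comp:
  assumes "module R P" "module R P'" "linear_map R P P' h" "t \<in> carrier TM"
    and "\<And>x y. \<lbrakk>x \<in> carrier M; y \<in> carrier N\<rbrakk> \<Longrightarrow> f x y \<in> carrier P"
  shows "h (tensor_lift R P f t) = tensor_lift R P' (\<lambda>x y. h (f x y)) t"
proof -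
  interpret P: module R P by fact
  interpret P': module R P' by fact
  let ?u = "SOME u. u \<in> t"
  let ?S = "{i. ?u i \<noteq> \<zero>\<^bsub>R\<^esub>}"
  have c: "f (fst i) (snd i) \<in> carrier P" "?u i \<in> carrier R" if "i \<in> ?S" for i
    using rep_props[OF assms(4)] assms(5) that by (auto simp: subset_iff)
  have "h (tensor_lift R P f t) = (\<Oplus>\<^bsub>P'\<^esub>i\<in>?S. h (?u i \<odot>\<^bsub>P\<^esub> f (fst i) (snd i)))"
    unfolding tensor_lift_def Let_def
    by (rule linear_map_finsum[OF assms(1-3)]) (use c in auto)
  also have "\<dots> = (\<Oplus>\<^bsub>P'\<^esub>i\<in>?S. ?u i \<odot>\<^bsub>P'\<^esub> h (f (fst i) (snd i)))"
    by (rule P'.M.finsum_cong')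
      (use c in \<open>auto simp: linear_map_smult[OF assms(3)] linear_map_closed[OF assms(3)]\<close>)
  finally show ?thesis by (simp add: tensor_lift_def Let_def)
qed

lemma TM_lift_param_linear:
  assumes "module R Z" "module R P" "t \<in> carrier TM"
    and lin: "\<And>x y. \<lbrakk>x \<in> carrier M; y \<in> carrier N\<rbrakk> \<Longrightarrow> linear_map R Z P (\<lambda>z. f z x y)"
  shows "linear_map R Z P (\<lambda>z. tensor_lift R P (f z) t)"
proof -
  interpret P: module R P by fact
  interpret Z: module R Z by fact
  let ?u = "SOME u. u \<in> t"
  let ?S = "{i. ?u i \<noteq> \<zero>\<^bsub>R\<^esub>}"
  have c: "linear_map R Z P (\<lambda>z. f z (fst i) (snd i))" "?u i \<in> carrier R" if "i \<in> ?S" for i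
    using rep_props[OF assms(3)] lin that by (auto simp: subset_iff)
  note cl = linear_map_closed[OF c(1)]
  have fin: "finite ?S" by (rule rep_props[OF assms(3)])
  show ?thesis
    unfolding tensor_lift_def Let_def
  proof (rule linear_mapI)
    fix z assume z: "z \<in> carrier Z"
    show "(\<Oplus>\<^bsub>P\<^esub>i\<in>?S. ?u i \<odot>\<^bsub>P\<^esub> f z (fst i) (snd i)) \<in> carrier P"
      by (rule P.M.finsum_closed) (use cl[OF _ z] c(2) in auto)
    fix r assume r: "r \<in> carrier R"
    have "(\<Oplus>\<^bsub>P\<^esub>i\<in>?S. ?u i \<odot>\<^bsub>P\<^esub> f (r \<odot>\<^bsub>Z\<^esub> z) (fst i) (snd i))
        = (\<Oplus>\<^bsub>P\<^esub>i\<in>?S. r \<odot>\<^bsub>P\<^esub> (?u i \<odot>\<^bsub>P\<^esub> f z (fst i) (snd i)))"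
    proof (rule P.M.finsum_cong')
      fix i assume i: "i \<in> ?S"
      show "?u i \<odot>\<^bsub>P\<^esub> f (r \<odot>\<^bsub>Z\<^esub> z) (fst i) (snd i) = r \<odot>\<^bsub>P\<^esub> (?u i \<odot>\<^bsub>P\<^esub> f z (fst i) (snd i))"
        using linear_map_smult[OF c(1)[OF i] r z] c(2)[OF i] r cl[OF i z]
        by (simp add: P.smult_assoc1[symmetric] M.R.m_comm)
    qed (use cl[OF _ z] c(2) r in auto)
    then show "(\<Oplus>\<^bsub>P\<^esub>i\<in>?S. ?u i \<odot>\<^bsub>P\<^esub> f (r \<odot>\<^bsub>Z\<^esub> z) (fst i) (snd i))
        = r \<odot>\<^bsub>P\<^esub> (\<Oplus>\<^bsub>P\<^esub>i\<in>?S. ?u i \<odot>\<^bsub>P\<^esub> f z (fst i) (snd i))"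
      by (subst P.finsum_smult_ldistr) (use cl[OF _ z] c(2) r fin in auto)
  next
    fix z z' assume z: "z \<in> carrier Z" "z' \<in> carrier Z"
    have "(\<Oplus>\<^bsub>P\<^esub>i\<in>?S. ?u i \<odot>\<^bsub>P\<^esub> f (z \<oplus>\<^bsub>Z\<^esub> z') (fst i) (snd i))
        = (\<Oplus>\<^bsub>P\<^esub>i\<in>?S. ?u i \<odot>\<^bsub>P\<^esub> f z (fst i) (snd i) \<oplus>\<^bsub>P\<^esub> ?u i \<odot>\<^bsub>P\<^esub> f z' (fst i) (snd i))"
    proof (rule P.M.finsum_cong')
      fix i assume i: "i \<in> ?S"
      show "?u i \<odot>\<^bsub>P\<^esub> f (z \<oplus>\<^bsub>Z\<^esub> z') (fst i) (snd i) = ?u i \<odot>\<^bsub>P\<^esub> f z (fst i) (snd i) \<oplus>\<^bsub>P\<^esub> ?u i \<odot>\<^bsub>P\<^esub> f z' (fst i) (snd i)"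
        using linear_map_add[OF c(1)[OF i] z] c(2)[OF i] cl[OF i z(1)] cl[OF i z(2)]
        by (simp add: P.smult_r_distr)
    qed (use cl[OF _ z(1)] cl[OF _ z(2)] c(2) in auto)
    then show "(\<Oplus>\<^bsub>P\<^esub>i\<in>?S. ?u i \<odot>\<^bsub>P\<^esub> f (z \<oplus>\<^bsub>Z\<^esub> z') (fst i) (snd i))
        = (\<Oplus>\<^bsub>P\<^esub>i\<in>?S. ?u i \<odot>\<^bsub>P\<^esub> f z (fst i) (snd i)) \<oplus>\<^bsub>P\<^esub> (\<Oplus>\<^bsub>P\<^esub>i\<in>?S. ?u i \<odot>\<^bsub>P\<^esub> f z' (fst i) (snd i))"
      by (subst P.M.finsum_addf[symmetric]) (use cl[OF _ z(1)] cl[OF _ z(2)] c(2) in auto)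
  qed
qed

end

text \<open>Independent Sweedler sums may be interchanged.\<close>

lemma (in abelian_monoid) finsum_swap:
  assumes "finite A" "finite B" "\<And>i j. \<lbrakk>i \<in> A; j \<in> B\<rbrakk> \<Longrightarrow> f i j \<in> carrier G"
  shows "(\<Oplus>i\<in>A. \<Oplus>j\<in>B. f i j) = (\<Oplus>j\<in>B. \<Oplus>i\<in>A. f i j)"
  using assms(1,3)
proof (induction A rule: finite_induct)
  case empty
  then show ?case by simp
next
  case (insert a A)
  have c: "(\<Oplus>i\<in>A. f i j) \<in> carrier G" "f a j \<in> carrier G" if "j \<in> B" for j
    using insert.prems that by (auto intro!: finsum_closed)
  have "(\<Oplus>i\<in>insert a A. \<Oplus>j\<in>B. f i j) = (\<Oplus>j\<in>B. f a j) \<oplus> (\<Oplus>i\<in>A. \<Oplus>j\<in>B. f i j)"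
    using insert.hyps insert.prems by (intro finsum_insert) (auto intro!: finsum_closed)
  also have "(\<Oplus>i\<in>A. \<Oplus>j\<in>B. f i j) = (\<Oplus>j\<in>B. \<Oplus>i\<in>A. f i j)"
    using insert.prems by (intro insert.IH) auto
  also have "(\<Oplus>j\<in>B. f a j) \<oplus> (\<Oplus>j\<in>B. \<Oplus>i\<in>A. f i j) = (\<Oplus>j\<in>B. f a j \<oplus> (\<Oplus>i\<in>A. f i j))"
    using c by (intro finsum_addf[symmetric]) auto
  also have "\<dots> = (\<Oplus>j\<in>B. \<Oplus>i\<in>insert a A. f i j)"
    using c insert.hyps insert.prems
    by (intro finsum_cong') (auto intro!: finsum_insert[symmetric] finsum_closed)
  finally show ?case .
qed

lemma tensor_module_lift_swap:
  assumes "tensor_setup R M N" "tensor_setup R M' N'" and P: "module R P"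
    and s: "s \<in> carrier (tensor_module R M N)" and t: "t \<in> carrier (tensor_module R M' N')"
    and f: "\<And>x y u v. \<lbrakk>x \<in> carrier M; y \<in> carrier N; u \<in> carrier M'; v \<in> carrier N'\<rbrakk> \<Longrightarrow> f x y u v \<in> carrier P"
  shows "tensor_lift R P (\<lambda>x y. tensor_lift R P (\<lambda>u v. f x y u v) t) s =
    tensor_lift R P (\<lambda>u v. tensor_lift R P (\<lambda>x y. f x y u v) s) t"
proof -
  interpret A: tensor_setup R M N by fact
  interpret B: tensor_setup R M' N' by fact
  interpret P: module R P by fact
  define u where "u = (SOME u. u \<in> s)"
  define v where "v = (SOME v. v \<in> t)"
  define S where "S = {i. u i \<noteq> \<zero>\<^bsub>R\<^esub>}"
  define T where "T = {i. v i \<noteq> \<zero>\<^bsub>R\<^esub>}"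
  note u = A.rep_props[OF s, folded u_def, folded S_def]
  note v = B.rep_props[OF t, folded v_def, folded T_def]
  let ?f = "\<lambda>i j. f (fst i) (snd i) (fst j) (snd j)"
  have f': "?f i j \<in> carrier P" if "i \<in> S" "j \<in> T" for i j
    using f u(3,4) v(3,4) that by blast
  have "tensor_lift R P (\<lambda>x y. tensor_lift R P (\<lambda>u v. f x y u v) t) s =
      (\<Oplus>\<^bsub>P\<^esub>i\<in>S. u i \<odot>\<^bsub>P\<^esub> (\<Oplus>\<^bsub>P\<^esub>j\<in>T. v j \<odot>\<^bsub>P\<^esub> ?f i j))"
    by (simp add: tensor_lift_def u_def v_def S_def T_def Let_def)
  also have "\<dots> = (\<Oplus>\<^bsub>P\<^esub>i\<in>S. \<Oplus>\<^bsub>P\<^esub>j\<in>T. u i \<odot>\<^bsub>P\<^esub> (v j \<odot>\<^bsub>P\<^esub> ?f i j))"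
    by (intro P.M.finsum_cong')
      (use u v f' in \<open>auto intro!: P.finsum_smult_ldistr P.M.finsum_closed\<close>)
  also have "\<dots> = (\<Oplus>\<^bsub>P\<^esub>j\<in>T. \<Oplus>\<^bsub>P\<^esub>i\<in>S. u i \<odot>\<^bsub>P\<^esub> (v j \<odot>\<^bsub>P\<^esub> ?f i j))"
    by (intro P.M.finsum_swap) (use u v f' in auto)
  also have "\<dots> = (\<Oplus>\<^bsub>P\<^esub>j\<in>T. \<Oplus>\<^bsub>P\<^esub>i\<in>S. v j \<odot>\<^bsub>P\<^esub> (u i \<odot>\<^bsub>P\<^esub> ?f i j))"
    by (intro P.M.finsum_cong')
      (use u v f' in \<open>auto intro!: P.M.finsum_closed simp: P.smult_assoc1[symmetric] A.M.R.m_comm\<close>)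
  also have "\<dots> = (\<Oplus>\<^bsub>P\<^esub>j\<in>T. v j \<odot>\<^bsub>P\<^esub> (\<Oplus>\<^bsub>P\<^esub>i\<in>S. u i \<odot>\<^bsub>P\<^esub> ?f i j))"
    by (intro P.M.finsum_cong')
      (use u v f' in \<open>auto intro!: P.finsum_smult_ldistr[symmetric] P.M.finsum_closed\<close>)
  also have "\<dots> = tensor_lift R P (\<lambda>u v. tensor_lift R P (\<lambda>x y. f x y u v) s) t"
    by (simp add: tensor_lift_def u_def v_def S_def T_def Let_def)
  finally show ?thesis .
qed

section \<open>Tensor products as objects with an automorphism\<close>

text \<open>The object \<^const>\<open>tensor\<close> extends \<^const>\<open>tensor_module\<close> by an automorphism, so the rules
  above carry over.\<close>

lemma tensor_simps:
  "carrier (tensor R M N) = carrier (tensor_module R M N)"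
  "add (tensor R M N) = add (tensor_module R M N)"
  "zero (tensor R M N) = zero (tensor_module R M N)"
  "smult (tensor R M N) = smult (tensor_module R M N)"
  by (simp_all add: tensor_def module.defs)

lemma linear_map_tensor:
  "linear_map R (tensor R M N) P f \<longleftrightarrow> linear_map R (tensor_module R M N) P f"
  "linear_map R P (tensor R M N) g \<longleftrightarrow> linear_map R P (tensor_module R M N) g"
  by (simp_all add: linear_map_def tensor_simps)

lemma tensor_setupI: "\<lbrakk>module R M; module R N\<rbrakk> \<Longrightarrow> tensor_setup R M N"
  by (simp add: tensor_setup_def)

lemma module_tensor:
  assumes "module R M" "module R N"
  shows "module R (tensor R M N)"
  by (rule module_cong[OF tensor_setup.module_TM[OF tensor_setupI[OF assms]] tensor_simps])

lemma tensor_lift_target_cong: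
  assumes "carrier P = carrier P'" "add P = add P'" "zero P = zero P'" "smult P = smult P'"
  shows "tensor_lift R P = tensor_lift R P'"
  by (simp add: tensor_lift_def fun_eq_iff Let_def finsum_def finprod_def assms)

lemma bilinear_tens:
  assumes "module R M" "module R N"
  shows "bilinear_map R M N (tensor R M N) (tens R M N)"
  using tensor_setup.bilinear_tens[OF tensor_setupI[OF assms]]
  by (simp add: bilinear_map_def linear_map_tensor)

lemma tens_closed:
  assumes "module R M" "module R N" "x \<in> carrier M" "y \<in> carrier N"
  shows "tens R M N x y \<in> carrier (tensor R M N)"
  by (rule bilinear_map_closed[OF bilinear_tens[OF assms(1,2)] assms(3,4)])

lemma tens_linear_left:
  assumes "module R M" "module R N" "y \<in> carrier N" "linear_map R Z M g"
  shows "linear_map R Z (tensor R M N) (\<lambda>z. tens R M N (g z) y)"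
  by (rule linear_map_comp[OF bilinear_map_left[OF bilinear_tens[OF assms(1,2)] assms(3)] assms(4)])

lemma tens_linear_right:
  assumes "module R M" "module R N" "x \<in> carrier M" "linear_map R Z N g"
  shows "linear_map R Z (tensor R M N) (\<lambda>z. tens R M N x (g z))"
  by (rule linear_map_comp[OF bilinear_map_right[OF bilinear_tens[OF assms(1,2)] assms(3)] assms(4)])

lemma tensor_eqI:
  assumes "module R M" "module R N" "module R P"
    and "linear_map R (tensor R M N) P f" "linear_map R (tensor R M N) P g"
    and "\<And>x y. \<lbrakk>x \<in> carrier M; y \<in> carrier N\<rbrakk> \<Longrightarrow> f (tens R M N x y) = g (tens R M N x y)"
    and "t \<in> carrier (tensor R M N)"
  shows "f t = g t"
  using tensor_setup.TM_eqI[OF tensor_setupI[OF assms(1,2)] assms(3)] assms(4-7)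
  by (simp add: linear_map_tensor tensor_simps)

lemma tensor_lift_tens:
  assumes "module R M" "module R N" "module R P" "bilinear_map R M N P f" "x \<in> carrier M" "y \<in> carrier N"
  shows "tensor_lift R P f (tens R M N x y) = f x y"
  by (rule tensor_setup.TM_lift_tens[OF tensor_setupI[OF assms(1,2)] assms(3-)])

lemma tensor_lift_linear:
  assumes "module R M" "module R N" "module R P" "bilinear_map R M N P f" "linear_map R Z (tensor R M N) g"
  shows "linear_map R Z P (\<lambda>z. tensor_lift R P f (g z))"
  by (rule linear_map_comp[OF _ assms(5)])
    (simp add: linear_map_tensor tensor_setup.TM_lift_linear[OF tensor_setupI[OF assms(1,2)] assms(3,4)])

lemma tensor_lift_param_linear:
  assumes "t \<in> carrier (tensor R M N)" "module R M" "module R N" "module R Z" "module R P"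
    and "\<And>x y. \<lbrakk>x \<in> carrier M; y \<in> carrier N\<rbrakk> \<Longrightarrow> linear_map R Z P (\<lambda>z. f z x y)"
  shows "linear_map R Z P (\<lambda>z. tensor_lift R P (\<lambda>x y. f z x y) t)"
  by (rule tensor_setup.TM_lift_param_linear[OF tensor_setupI[OF assms(2,3)] assms(4,5) _ assms(6)])
    (use assms(1) in \<open>simp_all add: tensor_simps\<close>)

lemma tensor_lift_cong:
  assumes "t \<in> carrier (tensor R M N)" "module R M" "module R N" "module R P"
    and "\<And>x y. \<lbrakk>x \<in> carrier M; y \<in> carrier N\<rbrakk> \<Longrightarrow> g x y \<in> carrier P"
    and "\<And>x y. \<lbrakk>x \<in> carrier M; y \<in> carrier N\<rbrakk> \<Longrightarrow> f x y = g x y"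
  shows "tensor_lift R P f t = tensor_lift R P g t"
  by (rule tensor_setup.TM_lift_cong[OF tensor_setupI[OF assms(2,3)] assms(4) _ assms(6,5)])
    (use assms(1) in \<open>simp_all add: tensor_simps\<close>)

lemma tensor_lift_closed:
  assumes "t \<in> carrier (tensor R M N)" "module R M" "module R N" "module R P"
    and "\<And>x y. \<lbrakk>x \<in> carrier M; y \<in> carrier N\<rbrakk> \<Longrightarrow> f x y \<in> carrier P"
  shows "tensor_lift R P f t \<in> carrier P"
  by (rule tensor_setup.TM_lift_closed[OF tensor_setupI[OF assms(2,3)] assms(4) _ assms(5)])
    (use assms(1) in \<open>simp_all add: tensor_simps\<close>)

lemma linear_map_tensor_lift:
  assumes "t \<in> carrier (tensor R M N)" "module R M" "module R N" "module R P" "module R P'"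
    and "linear_map R P P' h"
    and "\<And>x y. \<lbrakk>x \<in> carrier M; y \<in> carrier N\<rbrakk> \<Longrightarrow> f x y \<in> carrier P"
  shows "h (tensor_lift R P f t) = tensor_lift R P' (\<lambda>x y. h (f x y)) t"
  by (rule tensor_setup.TM_lift_linear_comp[OF tensor_setupI[OF assms(2,3)] assms(4-6) _ assms(7)])
    (use assms(1) in \<open>simp_all add: tensor_simps\<close>)

lemma tensor_lift_swap:
  assumes "s \<in> carrier (tensor R M N)" "t \<in> carrier (tensor R M' N')"
    and "module R M" "module R N" "module R M'" "module R N'" "module R P"
    and "\<And>x y u v. \<lbrakk>x \<in> carrier M; y \<in> carrier N; u \<in> carrier M'; v \<in> carrier N'\<rbrakk> \<Longrightarrow> f x y u v \<in> carrier P"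
  shows "tensor_lift R P (\<lambda>x y. tensor_lift R P (\<lambda>u v. f x y u v) t) s =
    tensor_lift R P (\<lambda>u v. tensor_lift R P (\<lambda>x y. f x y u v) s) t"
  by (rule tensor_module_lift_swap[OF tensor_setupI[OF assms(3,4)] tensor_setupI[OF assms(5,6)] assms(7) _ _ assms(8)])
    (use assms(1,2) in \<open>simp_all add: tensor_simps\<close>)

lemma tensor_lift_eta:
  assumes "module R M" "module R N" "t \<in> carrier (tensor R M N)"
  shows "tensor_lift R (tensor R M N) (\<lambda>x y. tens R M N x y) t = t"
proof -
  note m = module_tensor[OF assms(1,2)] and b = bilinear_tens[OF assms(1,2)]
  show ?thesis
    by (rule tensor_eqI[OF assms(1,2) m tensor_lift_linear[OF assms(1,2) m b linear_map_id] linear_map_id _ assms(3)])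
      (rule tensor_lift_tens[OF assms(1,2) m b])
qed

section \<open>Automorphisms and their inverses\<close>

lemma hom_object_module: "hom_object R M \<Longrightarrow> module R M"
  by (simp add: hom_object_def)

lemma aut_closed: "\<lbrakk>hom_object R M; x \<in> carrier M\<rbrakk> \<Longrightarrow> aut M x \<in> carrier M"
  by (rule linear_map_closed[OF hom_object.aut_linear])

lemma inv_aut_closed: "\<lbrakk>hom_object R M; x \<in> carrier M\<rbrakk> \<Longrightarrow> inv_aut M x \<in> carrier M"
  using hom_object.aut_bij[of R M] unfolding inv_aut_def by (simp add: bij_betw_def inv_into_into)

lemma aut_inv_aut: "\<lbrakk>hom_object R M; x \<in> carrier M\<rbrakk> \<Longrightarrow> aut M (inv_aut M x) = x"
  using hom_object.aut_bij[of R M] unfolding inv_aut_def by (simp add: bij_betw_def f_inv_into_f)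

lemma inv_aut_aut: "\<lbrakk>hom_object R M; x \<in> carrier M\<rbrakk> \<Longrightarrow> inv_aut M (aut M x) = x"
  using hom_object.aut_bij[of R M] unfolding inv_aut_def by (simp add: bij_betw_def)

lemma inv_aut_eqI: "\<lbrakk>hom_object R M; x \<in> carrier M; aut M x = y\<rbrakk> \<Longrightarrow> inv_aut M y = x"
  using inv_aut_aut[of R M x] by auto

lemma aut_linear: "\<lbrakk>hom_object R M; linear_map R Z M g\<rbrakk> \<Longrightarrow> linear_map R Z M (\<lambda>z. aut M (g z))"
  by (rule linear_map_comp[OF hom_object.aut_linear])

lemma inv_aut_linear:
  assumes "hom_object R M" "linear_map R Z M g"
  shows "linear_map R Z M (\<lambda>z. inv_aut M (g z))"
proof -
  interpret hom_object R M by fact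
  note c = inv_aut_closed[OF assms(1)] and a = aut_inv_aut[OF assms(1)]
  have "linear_map R M M (inv_aut M)"
  proof (rule linear_mapI)
    fix x y assume "x \<in> carrier M" "y \<in> carrier M"
    then show "inv_aut M (x \<oplus>\<^bsub>M\<^esub> y) = inv_aut M x \<oplus>\<^bsub>M\<^esub> inv_aut M y"
      by (intro inv_aut_eqI[OF assms(1)]) (simp_all add: c a linear_map_add[OF hom_object.aut_linear[OF assms(1)]])
  next
    fix r x assume "r \<in> carrier R" "x \<in> carrier M"
    then show "inv_aut M (r \<odot>\<^bsub>M\<^esub> x) = r \<odot>\<^bsub>M\<^esub> inv_aut M x"
      by (intro inv_aut_eqI[OF assms(1)]) (simp_all add: c a linear_map_smult[OF hom_object.aut_linear[OF assms(1)]])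
  qed (rule c)
  then show ?thesis using assms(2) by (rule linear_map_comp)
qed

lemma hom_objectI:
  assumes "module R M" "linear_map R M M (aut M)" "\<And>x. x \<in> carrier M \<Longrightarrow> g x \<in> carrier M"
    and "\<And>x. x \<in> carrier M \<Longrightarrow> aut M (g x) = x" "\<And>x. x \<in> carrier M \<Longrightarrow> g (aut M x) = x"
  shows "hom_object R M"
proof (intro hom_object.intro hom_object_axioms.intro assms(1,2))
  show "bij_betw (aut M) (carrier M) (carrier M)"
    by (rule bij_betwI[where g = g]) (use assms(3-5) linear_map_closed[OF assms(2)] in auto)
qed

lemma hom_map_linear: "hom_map R M N f \<Longrightarrow> linear_map R M N f"
  by (simp add: hom_map_def)

lemma hom_map_aut: "\<lbrakk>hom_map R M N f; x \<in> carrier M\<rbrakk> \<Longrightarrow> f (aut M x) = aut N (f x)"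
  by (simp add: hom_map_def)

lemma hom_map_inv_aut:
  assumes "hom_map R M N f" "hom_object R M" "hom_object R N" "x \<in> carrier M"
  shows "f (inv_aut M x) = inv_aut N (f x)"
  using hom_map_aut[OF assms(1) inv_aut_closed[OF assms(2,4)]]
    linear_map_closed[OF hom_map_linear[OF assms(1)] inv_aut_closed[OF assms(2,4)]] assms
  by (auto simp: aut_inv_aut intro!: inv_aut_eqI[OF assms(3), symmetric])

lemma hom_bimap_bilinear: "hom_bimap R M N P f \<Longrightarrow> bilinear_map R M N P f"
  by (simp add: hom_bimap_def)

lemma hom_bimap_aut:
  "\<lbrakk>hom_bimap R M N P f; x \<in> carrier M; y \<in> carrier N\<rbrakk> \<Longrightarrow> aut P (f x y) = f (aut M x) (aut N y)"
  by (simp add: hom_bimap_def)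

lemma hom_bimap_inv_aut:
  assumes "hom_bimap R M N P f" "hom_object R M" "hom_object R N" "hom_object R P"
    and "x \<in> carrier M" "y \<in> carrier N"
  shows "inv_aut P (f x y) = f (inv_aut M x) (inv_aut N y)"
  by (rule inv_aut_eqI[OF assms(4)])
    (use assms in \<open>simp_all add: hom_bimap_aut aut_inv_aut inv_aut_closed
      bilinear_map_closed[OF hom_bimap_bilinear[OF assms(1)]]\<close>)

lemma aut_tensor:
  "aut (tensor R M N) = tensor_lift R (tensor R M N) (\<lambda>x y. tens R M N (aut M x) (aut N y))"
  unfolding tensor_lift_target_cong[OF tensor_simps]
  by (simp add: tensor_def module.defs hom_obj.defs)

lemma bilinear_tens_map:
  assumes "module R M" "module R N" "module R M'" "module R N'" "linear_map R M' M f" "linear_map R N' N g"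
  shows "bilinear_map R M' N' (tensor R M N) (\<lambda>x y. tens R M N (f x) (g y))"
  by (rule bilinear_mapI)
    (auto intro: tens_linear_left tens_linear_right assms linear_map_closed[OF assms(5)] linear_map_closed[OF assms(6)])

lemma aut_tens:
  assumes "hom_object R M" "hom_object R N" "x \<in> carrier M" "y \<in> carrier N"
  shows "aut (tensor R M N) (tens R M N x y) = tens R M N (aut M x) (aut N y)"
  unfolding aut_tensor
  by (rule tensor_lift_tens)
    (intro hom_object_module[OF assms(1)] hom_object_module[OF assms(2)] module_tensor bilinear_tens_map
      hom_object.aut_linear assms)+

lemma hom_object_tensor:
  assumes "hom_object R M" "hom_object R N"
  shows "hom_object R (tensor R M N)"
proof -
  let ?T = "tensor R M N"
  note m = hom_object_module[OF assms(1)] hom_object_module[OF assms(2)]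
  note mT = module_tensor[OF m]
  let ?g = "tensor_lift R ?T (\<lambda>x y. tens R M N (inv_aut M x) (inv_aut N y))"
  note il = inv_aut_linear[OF assms(1) linear_map_id] inv_aut_linear[OF assms(2) linear_map_id]
  have b: "bilinear_map R M N ?T (\<lambda>x y. tens R M N (inv_aut M x) (inv_aut N y))"
    by (rule bilinear_tens_map[OF m m il])
  have b': "bilinear_map R M N ?T (\<lambda>x y. tens R M N (aut M x) (aut N y))"
    by (rule bilinear_tens_map[OF m m hom_object.aut_linear[OF assms(1)] hom_object.aut_linear[OF assms(2)]])
  have g: "linear_map R ?T ?T (\<lambda>t. ?g t)"
    by (rule tensor_lift_linear[OF m mT b linear_map_id])
  have a: "linear_map R ?T ?T (\<lambda>t. aut ?T t)"
    unfolding aut_tensor by (rule tensor_lift_linear[OF m mT b' linear_map_id])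
  have gt: "?g (tens R M N x y) = tens R M N (inv_aut M x) (inv_aut N y)"
    if "x \<in> carrier M" "y \<in> carrier N" for x y
    by (rule tensor_lift_tens[OF m mT b that])
  note at = aut_tens[OF assms]
  note cl = inv_aut_closed[OF assms(1)] inv_aut_closed[OF assms(2)] aut_closed[OF assms(1)] aut_closed[OF assms(2)]
  show ?thesis
  proof (rule hom_objectI[OF mT, where g = ?g])
    show "aut ?T (?g t) = t" if "t \<in> carrier ?T" for t
      by (rule tensor_eqI[OF m mT linear_map_comp[OF a g] linear_map_id _ that])
        (simp add: gt at cl aut_inv_aut[OF assms(1)] aut_inv_aut[OF assms(2)])
    show "?g (aut ?T t) = t" if "t \<in> carrier ?T" for t
      by (rule tensor_eqI[OF m mT linear_map_comp[OF g a] linear_map_id _ that])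
        (simp add: gt at cl inv_aut_aut[OF assms(1)] inv_aut_aut[OF assms(2)])
    show "linear_map R ?T ?T (aut ?T)" using a by simp
    show "?g t \<in> carrier ?T" if "t \<in> carrier ?T" for t
      by (rule linear_map_closed[OF g that])
  qed
qed

section \<open>Tensor products over a Hom-algebra\<close>

text \<open>The map induced on a quotient of \<open>X \<otimes> M\<close> by a bilinear map \<open>f\<close> that respects the quotient:
  \<open>f\<close> is evaluated at an arbitrary representative.\<close>

definition quotient_lift ::
  "('k, 'r) ring_scheme \<Rightarrow> ('k, 'p, 'z) module_scheme \<Rightarrow> ('b \<Rightarrow> 'm \<Rightarrow> 'p) \<Rightarrow>
    ('k, 'b, 'm) tensor_elt set \<Rightarrow> 'p" where
  "quotient_lift R P f q = tensor_lift R P f (SOME t. t \<in> q)"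

text \<open>A right \<open>A\<close>-action on \<open>X\<close>, a left \<open>A\<close>-action on \<open>M\<close> and the object \<open>X \<otimes>\<^sub>A M\<close>. Only the
  bilinearity of the actions and their compatibility with the automorphisms are needed. The record
  \<open>Q\<close> may carry further structure on top of the object \<open>X \<otimes>\<^sub>A M\<close>.\<close>

locale balanced_setup = A: hom_object R A + X: hom_object R X + M: hom_object R M
  for R :: "('k, 'r) ring_scheme" and A :: "('k, 'a, 'w) hom_obj_scheme"
    and X :: "('k, 'b, 'x) hom_obj_scheme" and M :: "('k, 'm, 'y) hom_obj_scheme" +
  fixes ra :: "'b \<Rightarrow> 'a \<Rightarrow> 'b" and la :: "'a \<Rightarrow> 'm \<Rightarrow> 'm"
    and Q :: "('k, ('k, 'b, 'm) tensor_elt set, 'z) hom_obj_scheme"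
  assumes ra: "hom_bimap R X A X ra" and la: "hom_bimap R A M M la"
    and Q: "hom_obj.truncate Q = balanced_tensor R A X ra M la"
begin

abbreviation "K \<equiv> balanced_kernel R A X ra M la"
abbreviation "bt \<equiv> balanced_tens R A X ra M la"
abbreviation "XM \<equiv> tensor R X M"

lemma objects: "hom_object R A" "hom_object R X" "hom_object R M"
  by unfold_locales

lemmas modules = objects[THEN hom_object_module]

lemma XM: "hom_object R XM" "module R XM"
  using objects modules by (simp_all add: hom_object_tensor module_tensor)

lemmas ra_closed = bilinear_map_closed[OF hom_bimap_bilinear[OF ra]]
  and la_closed = bilinear_map_closed[OF hom_bimap_bilinear[OF la]]

lemma rel_subset:
  "{tens R X M (ra x a) m \<ominus>\<^bsub>XM\<^esub> tens R X M (aut X x) (la a (inv_aut M m)) | x a m.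
        x \<in> carrier X \<and> a \<in> carrier A \<and> m \<in> carrier M} \<subseteq> carrier XM"
proof -
  interpret T: module R XM by (rule XM)
  show ?thesis
    by (auto intro!: T.M.minus_closed tens_closed modules ra_closed la_closed inv_aut_closed objects aut_closed)
qed

lemma K_submodule: "submodule K R XM"
  unfolding balanced_kernel_def by (rule submodule_submodule_gen[OF XM(2) rel_subset])

sublocale QS: quotient_setup R XM K
  by (intro quotient_setup.intro quotient_setup_axioms.intro XM K_submodule)

lemma bt_eq: "bt x m = K +>\<^bsub>XM\<^esub> tens R X M x m"
  by (simp add: balanced_tens_def)

lemma Q_simps:
  "carrier Q = carrier QS.Q" "add Q = add QS.Q" "zero Q = zero QS.Q" "smult Q = smult QS.Q"
  "aut Q = (\<lambda>T. \<Union>t\<in>T. K +>\<^bsub>XM\<^esub> aut XM t)"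
proof -
  have "carrier (hom_obj.truncate Q) = carrier QS.Q" "add (hom_obj.truncate Q) = add QS.Q"
    "zero (hom_obj.truncate Q) = zero QS.Q" "smult (hom_obj.truncate Q) = smult QS.Q"
    "aut (hom_obj.truncate Q) = (\<lambda>T. \<Union>t\<in>T. K +>\<^bsub>XM\<^esub> aut XM t)"
    unfolding Q by (simp_all add: balanced_tensor_def Let_def module.defs hom_obj.defs)
  then show "carrier Q = carrier QS.Q" "add Q = add QS.Q" "zero Q = zero QS.Q" "smult Q = smult QS.Q"
    "aut Q = (\<lambda>T. \<Union>t\<in>T. K +>\<^bsub>XM\<^esub> aut XM t)"
    by (simp_all add: hom_obj.defs)
qed

lemma linear_Q:
  "linear_map R Q P f \<longleftrightarrow> linear_map R QS.Q P f" "linear_map R P Q g \<longleftrightarrow> linear_map R P QS.Q g"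
  by (simp_all add: linear_map_def Q_simps)

lemma module_Q: "module R Q"
  by (rule module_cong[OF QS.module_quotient Q_simps(1-4)])

lemma coset_linear_Q: "linear_map R XM Q (\<lambda>t. K +>\<^bsub>XM\<^esub> t)"
  unfolding linear_Q by (rule QS.coset_linear)

lemma bilinear_bt: "bilinear_map R X M Q bt"
  unfolding bt_eq[abs_def]
  by (intro bilinear_mapI linear_map_comp[OF coset_linear_Q] tens_linear_left tens_linear_right
      modules linear_map_id) assumption+

lemmas bt_closed = bilinear_map_closed[OF bilinear_bt]

lemma bt_linear_left: "\<lbrakk>m \<in> carrier M; linear_map R Z X g\<rbrakk> \<Longrightarrow> linear_map R Z Q (\<lambda>z. bt (g z) m)"
  by (rule linear_map_comp[OF bilinear_map_left[OF bilinear_bt]])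

lemma bt_linear_right: "\<lbrakk>x \<in> carrier X; linear_map R Z M g\<rbrakk> \<Longrightarrow> linear_map R Z Q (\<lambda>z. bt x (g z))"
  by (rule linear_map_comp[OF bilinear_map_right[OF bilinear_bt]])

lemma bt_balanced:
  assumes "x \<in> carrier X" "a \<in> carrier A" "m \<in> carrier M"
  shows "bt (ra x a) m = bt (aut X x) (la a (inv_aut M m))"
  unfolding bt_eq
proof (rule QS.coset_eqI)
  show "tens R X M (ra x a) m \<ominus>\<^bsub>XM\<^esub> tens R X M (aut X x) (la a (inv_aut M m)) \<in> K"
    unfolding balanced_kernel_def by (rule subsetD[OF submodule_gen_superset]) (use assms in blast)
qed (use assms in \<open>auto intro!: tens_closed modules ra_closed la_closed inv_aut_closed objects aut_closed\<close>)

lemma Q_eqI: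
  assumes P: "module R P" and lin: "linear_map R Q P f" "linear_map R Q P g"
    and eq: "\<And>x m. \<lbrakk>x \<in> carrier X; m \<in> carrier M\<rbrakk> \<Longrightarrow> f (bt x m) = g (bt x m)"
    and q: "q \<in> carrier Q"
  shows "f q = g q"
proof -
  obtain t where t: "t \<in> carrier XM" "q = K +>\<^bsub>XM\<^esub> t"
    using q by (auto simp: Q_simps QS.carrier_Q)
  show ?thesis
    unfolding t(2)
    by (rule tensor_eqI[OF modules(2,3) P linear_map_comp[OF lin(1) coset_linear_Q]
          linear_map_comp[OF lin(2) coset_linear_Q] _ t(1)])
      (use eq in \<open>simp add: bt_eq\<close>)
qed

text \<open>The linear map on \<open>X \<otimes> M\<close> induced by a balanced bilinear map vanishes on the relations.\<close>

lemma lift_coset: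
  assumes "module R P" "bilinear_map R X M P f"
    and "\<forall>x\<in>carrier X. \<forall>a\<in>carrier A. \<forall>m\<in>carrier M.
      f (ra x a) m = f (aut X x) (la a (inv_aut M m))"
  shows "linear_map R XM P (tensor_lift R P f)" "n \<in> K \<Longrightarrow> tensor_lift R P f n = \<zero>\<^bsub>P\<^esub>"
proof -
  interpret P: module R P by fact
  show lin: "linear_map R XM P (tensor_lift R P f)"
    using tensor_lift_linear[OF modules(2,3) assms(1,2) linear_map_id] by simp
  assume n: "n \<in> K"
  show "tensor_lift R P f n = \<zero>\<^bsub>P\<^esub>"
  proof (rule linear_map_eq_on_submodule_gen[OF XM(2) assms(1) lin zero_linear[OF XM(2) assms(1)] rel_subset _
        n[unfolded balanced_kernel_def]])
    fix s assume "s \<in> {tens R X M (ra x a) m \<ominus>\<^bsub>XM\<^esub> tens R X M (aut X x) (la a (inv_aut M m)) | x a m.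
        x \<in> carrier X \<and> a \<in> carrier A \<and> m \<in> carrier M}"
    then obtain x a m where s: "s = tens R X M (ra x a) m \<ominus>\<^bsub>XM\<^esub> tens R X M (aut X x) (la a (inv_aut M m))"
      and xam: "x \<in> carrier X" "a \<in> carrier A" "m \<in> carrier M" by blast
    have c: "ra x a \<in> carrier X" "aut X x \<in> carrier X" "la a (inv_aut M m) \<in> carrier M"
      using xam objects by (simp_all add: ra_closed la_closed inv_aut_closed aut_closed)
    show "tensor_lift R P f s = \<zero>\<^bsub>P\<^esub>"
      unfolding s using xam c assms(3)
      by (simp add: linear_map_minus[OF XM(2) assms(1) lin] tens_closed modules
          tensor_lift_tens[OF modules(2,3) assms(1,2)] P.M.minus_eq P.M.r_neg
          bilinear_map_closed[OF assms(2)])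
  qed
qed

text \<open>The universal property of \<open>X \<otimes>\<^sub>A M\<close>.\<close>

lemma quotient_lift_bt:
  assumes "module R P" "bilinear_map R X M P f"
    and "\<forall>x\<in>carrier X. \<forall>a\<in>carrier A. \<forall>m\<in>carrier M.
      f (ra x a) m = f (aut X x) (la a (inv_aut M m))"
  shows "linear_map R Q P (quotient_lift R P f)"
    and "\<lbrakk>x \<in> carrier X; m \<in> carrier M\<rbrakk> \<Longrightarrow> quotient_lift R P f (bt x m) = f x m"
proof -
  note l = lift_coset[OF assms]
  show "linear_map R Q P (quotient_lift R P f)"
    unfolding linear_Q quotient_lift_def[abs_def] by (rule QS.quotient_lift_linear[OF assms(1) l])
  show "quotient_lift R P f (bt x m) = f x m" if "x \<in> carrier X" "m \<in> carrier M"
    using QS.coset_some[OF assms(1) l tens_closed[OF modules(2,3) that]]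
    by (simp add: quotient_lift_def bt_eq tensor_lift_tens[OF modules(2,3) assms(1,2) that])
qed

text \<open>The automorphism of \<open>X \<otimes> M\<close> and its inverse respect the relations, hence descend to mutually
  inverse maps of \<open>X \<otimes>\<^sub>A M\<close>.\<close>

lemma bt_aut_balanced:
  "\<forall>x\<in>carrier X. \<forall>a\<in>carrier A. \<forall>m\<in>carrier M.
      bt (aut X (ra x a)) (aut M m) =
      bt (aut X (aut X x)) (aut M (la a (inv_aut M m)))"
proof (intro ballI)
  fix x a m assume *: "x \<in> carrier X" "a \<in> carrier A" "m \<in> carrier M"
  show "bt (aut X (ra x a)) (aut M m) = bt (aut X (aut X x)) (aut M (la a (inv_aut M m)))"
    using bt_balanced[of "aut X x" "aut A a" "aut M m"] * objects
    by (simp add: hom_bimap_aut[OF ra] hom_bimap_aut[OF la] aut_closed inv_aut_closed inv_aut_aut aut_inv_aut)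
qed

lemma bt_inv_aut_balanced:
  "\<forall>x\<in>carrier X. \<forall>a\<in>carrier A. \<forall>m\<in>carrier M.
      bt (inv_aut X (ra x a)) (inv_aut M m) =
      bt (inv_aut X (aut X x)) (inv_aut M (la a (inv_aut M m)))"
proof (intro ballI)
  fix x a m assume *: "x \<in> carrier X" "a \<in> carrier A" "m \<in> carrier M"
  show "bt (inv_aut X (ra x a)) (inv_aut M m) = bt (inv_aut X (aut X x)) (inv_aut M (la a (inv_aut M m)))"
    using bt_balanced[of "inv_aut X x" "inv_aut A a" "inv_aut M m"] * objects
    by (simp add: hom_bimap_inv_aut[OF ra] hom_bimap_inv_aut[OF la] aut_closed inv_aut_closed inv_aut_aut aut_inv_aut)
qed

lemma bilinear_bt_map:
  assumes "linear_map R X X f" "linear_map R M M g"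
  shows "bilinear_map R X M Q (\<lambda>x m. bt (f x) (g m))"
  by (rule bilinear_mapI)
    (auto intro: bt_linear_left bt_linear_right assms linear_map_closed[OF assms(1)] linear_map_closed[OF assms(2)])

lemmas bilinear_bt_aut = bilinear_bt_map[OF X.aut_linear M.aut_linear]
  and bilinear_bt_inv_aut = bilinear_bt_map[OF inv_aut_linear[OF objects(2) linear_map_id] inv_aut_linear[OF objects(3) linear_map_id]]

lemma aut_coset:
  assumes "t \<in> carrier XM"
  shows "aut Q (K +>\<^bsub>XM\<^esub> t) = K +>\<^bsub>XM\<^esub> aut XM t"
proof -
  let ?h = "tensor_lift R Q (\<lambda>x m. bt (aut X x) (aut M m))"
  interpret Q: module R Q by (rule module_Q)
  note l = lift_coset[OF module_Q bilinear_bt_aut bt_aut_balanced]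
  have h: "K +>\<^bsub>XM\<^esub> aut XM t = ?h t" if "t \<in> carrier XM" for t
  proof (rule tensor_eqI[OF modules(2,3) module_Q _ l(1) _ that])
    show "linear_map R XM Q (\<lambda>t. K +>\<^bsub>XM\<^esub> aut XM t)"
      by (rule linear_map_comp[OF coset_linear_Q hom_object.aut_linear[OF XM(1)]])
    fix x m assume "x \<in> carrier X" "m \<in> carrier M"
    then show "K +>\<^bsub>XM\<^esub> aut XM (tens R X M x m) = ?h (tens R X M x m)"
      by (subst tensor_lift_tens[OF modules(2,3) module_Q bilinear_bt_aut]) (simp_all add: aut_tens objects bt_eq)
  qed
  have "(\<Union>s\<in>K +>\<^bsub>XM\<^esub> t. K +>\<^bsub>XM\<^esub> aut XM s) = K +>\<^bsub>XM\<^esub> aut XM t"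
  proof (rule QS.coset_union[OF assms])
    fix n assume n: "n \<in> K"
    then have nX: "n \<in> carrier XM" using QS.AS.a_subset by blast
    have "?h (n \<oplus>\<^bsub>XM\<^esub> t) = ?h t"
      using linear_map_add[OF l(1) nX assms] l(2)[OF n] linear_map_closed[OF l(1) assms] by simp
    then show "K +>\<^bsub>XM\<^esub> aut XM (n \<oplus>\<^bsub>XM\<^esub> t) = K +>\<^bsub>XM\<^esub> aut XM t"
      using h assms nX by simp
  qed
  then show ?thesis by (simp add: Q_simps)
qed

lemma aut_bt:
  assumes "x \<in> carrier X" "m \<in> carrier M"
  shows "aut Q (bt x m) = bt (aut X x) (aut M m)"
  using assms by (simp add: bt_eq aut_coset tens_closed modules aut_tens objects)

lemma hom_object_Q: "hom_object R Q"
proof -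
  let ?g = "quotient_lift R Q (\<lambda>x m. bt (inv_aut X x) (inv_aut M m))"
  note g = quotient_lift_bt[OF module_Q bilinear_bt_inv_aut bt_inv_aut_balanced]
  have a: "linear_map R Q Q (aut Q)"
  proof (rule linear_mapI)
    note ax = aut_closed[OF XM(1)] and al = hom_object.aut_linear[OF XM(1)]
    interpret Q: module R Q by (rule module_Q)
    have cl: "K +>\<^bsub>XM\<^esub> t \<in> carrier Q" if "t \<in> carrier XM" for t
      using that by (simp add: Q_simps QS.carrier_Q)
    have rep: "\<exists>t\<in>carrier XM. q = K +>\<^bsub>XM\<^esub> t" if "q \<in> carrier Q" for q
      using that by (auto simp: Q_simps QS.carrier_Q)
    show "aut Q q \<in> carrier Q" if "q \<in> carrier Q" for q
      using rep[OF that] by (auto simp: aut_coset intro!: cl ax)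
    show "aut Q (q \<oplus>\<^bsub>Q\<^esub> q') = aut Q q \<oplus>\<^bsub>Q\<^esub> aut Q q'" if "q \<in> carrier Q" "q' \<in> carrier Q" for q q'
      using rep[OF that(1)] rep[OF that(2)]
      by (auto simp: aut_coset ax linear_map_add[OF coset_linear_Q, symmetric] linear_map_add[OF al])
    show "aut Q (r \<odot>\<^bsub>Q\<^esub> q) = r \<odot>\<^bsub>Q\<^esub> aut Q q" if "r \<in> carrier R" "q \<in> carrier Q" for r q
      using rep[OF that(2)] that(1)
      by (auto simp: aut_coset ax linear_map_smult[OF coset_linear_Q, symmetric] linear_map_smult[OF al])
  qed
  show ?thesis
  proof (rule hom_objectI[OF module_Q a, where g = ?g])
    show "aut Q (?g q) = q" if "q \<in> carrier Q" for q
      by (rule Q_eqI[OF module_Q linear_map_comp[OF a g(1)] linear_map_id _ that])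
        (simp add: g(2) aut_bt inv_aut_closed[OF objects(2)] inv_aut_closed[OF objects(3)] aut_inv_aut[OF objects(2)] aut_inv_aut[OF objects(3)])
    show "?g (aut Q q) = q" if "q \<in> carrier Q" for q
      by (rule Q_eqI[OF module_Q linear_map_comp[OF g(1) a] linear_map_id _ that])
        (simp add: g(2) aut_bt aut_closed[OF objects(2)] aut_closed[OF objects(3)] inv_aut_aut[OF objects(2)] inv_aut_aut[OF objects(3)])
    show "?g q \<in> carrier Q" if "q \<in> carrier Q" for q
      by (rule linear_map_closed[OF g(1) that])
  qed
qed

end

section \<open>Sweedler calculus\<close>

lemma linear_map_bilinear_left:
  "\<lbrakk>bilinear_map R M N P f; linear_map R Z M g; y \<in> carrier N\<rbrakk> \<Longrightarrow> linear_map R Z P (\<lambda>z. f (g z) y)"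
  by (rule linear_map_comp[OF bilinear_map_left])

lemma linear_map_bilinear_right:
  "\<lbrakk>bilinear_map R M N P f; linear_map R Z N g; x \<in> carrier M\<rbrakk> \<Longrightarrow> linear_map R Z P (\<lambda>z. f x (g z))"
  by (rule linear_map_comp[OF bilinear_map_right])

lemma tensor_lift_linear':
  assumes "linear_map R Z (tensor R M N) g" "bilinear_map R M N P f" "module R M" "module R N" "module R P"
  shows "linear_map R Z P (\<lambda>z. tensor_lift R P f (g z))"
  by (rule tensor_lift_linear[OF assms(3-5,2,1)])

lemma tensor_lift_linear_map:
  assumes "bilinear_map R M N P f" "module R M" "module R N" "module R P"
  shows "linear_map R (tensor R M N) P (tensor_lift R P f)"
  using tensor_lift_linear[OF assms(2-4,1) linear_map_id] by simp

text \<open>Syntax-directed rules for three kinds of goals: an expression is linear in a variable, it lies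
  in a carrier, or a structure is a module or an object. Applying them together with facts on the
  functions involved, as in \<open>(assumption | rule linearity ...)+\<close>, settles the side conditions of a
  Sweedler calculation. At each step at most one rule matches. Rules for \<^const>\<open>tensor_lift\<close> have the
  premise that determines the two tensor factors in first place, as these do not occur in the goal.\<close>

lemmas linearity = bilinear_mapI linear_map_id tens_linear_left tens_linear_right
  tensor_lift_param_linear tensor_lift_linear' aut_linear inv_aut_linear
  tens_closed tensor_lift_closed aut_closed inv_aut_closed module_tensor hom_object_tensor

text \<open>A Sweedler sum whose argument is itself a Sweedler sum of pure tensors, or a double such sum.\<close>

lemma tensor_lift_bind:
  assumes t: "t \<in> carrier (tensor R M' N')"
    and m: "module R M'" "module R N'" "module R M" "module R N" "module R P"
    and f: "bilinear_map R M N P f"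
    and p: "\<And>x y. \<lbrakk>x \<in> carrier M'; y \<in> carrier N'\<rbrakk> \<Longrightarrow> p x y \<in> carrier M"
    and q: "\<And>x y. \<lbrakk>x \<in> carrier M'; y \<in> carrier N'\<rbrakk> \<Longrightarrow> q x y \<in> carrier N"
  shows "tensor_lift R P f (tensor_lift R (tensor R M N) (\<lambda>x y. tens R M N (p x y) (q x y)) t) =
    tensor_lift R P (\<lambda>x y. f (p x y) (q x y)) t"
proof -
  have "tensor_lift R P f (tensor_lift R (tensor R M N) (\<lambda>x y. tens R M N (p x y) (q x y)) t) =
      tensor_lift R P (\<lambda>x y. tensor_lift R P f (tens R M N (p x y) (q x y))) t"
    by (rule linear_map_tensor_lift[OF t m(1,2) module_tensor[OF m(3,4)] m(5) tensor_lift_linear_map[OF f m(3-5)]])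
      (intro tens_closed m p q)
  also have "\<dots> = tensor_lift R P (\<lambda>x y. f (p x y) (q x y)) t"
    by (rule tensor_lift_cong[OF t m(1,2,5)])
      (intro bilinear_map_closed[OF f] tensor_lift_tens m f p q; assumption)+
  finally show ?thesis .
qed

lemma tensor_lift_bind2:
  assumes t: "t \<in> carrier (tensor R M1 N1)" and s: "s \<in> carrier (tensor R M2 N2)"
    and m: "module R M1" "module R N1" "module R M2" "module R N2" "module R M" "module R N" "module R P"
    and f: "bilinear_map R M N P f"
    and p: "\<And>x y u v. \<lbrakk>x \<in> carrier M1; y \<in> carrier N1; u \<in> carrier M2; v \<in> carrier N2\<rbrakk> \<Longrightarrow> p x y u v \<in> carrier M"
    and q: "\<And>x y u v. \<lbrakk>x \<in> carrier M1; y \<in> carrier N1; u \<in> carrier M2; v \<in> carrier N2\<rbrakk> \<Longrightarrow> q x y u v \<in> carrier N"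
  shows "tensor_lift R P f (tensor_lift R (tensor R M N) (\<lambda>x y.
      tensor_lift R (tensor R M N) (\<lambda>u v. tens R M N (p x y u v) (q x y u v)) s) t) =
    tensor_lift R P (\<lambda>x y. tensor_lift R P (\<lambda>u v. f (p x y u v) (q x y u v)) s) t"
proof -
  have "tensor_lift R P f (tensor_lift R (tensor R M N) (\<lambda>x y.
      tensor_lift R (tensor R M N) (\<lambda>u v. tens R M N (p x y u v) (q x y u v)) s) t) =
    tensor_lift R P (\<lambda>x y. tensor_lift R P f
      (tensor_lift R (tensor R M N) (\<lambda>u v. tens R M N (p x y u v) (q x y u v)) s)) t"
    by (rule linear_map_tensor_lift[OF t m(1,2) module_tensor[OF m(5,6)] m(7) tensor_lift_linear_map[OF f m(5-7)]])
      (intro tensor_lift_closed[OF s m(3,4)] module_tensor tens_closed m p q)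
  also have "\<dots> = tensor_lift R P (\<lambda>x y. tensor_lift R P (\<lambda>u v. f (p x y u v) (q x y u v)) s) t"
    by (rule tensor_lift_cong[OF t m(1,2,7)])
      (intro tensor_lift_closed[OF s m(3,4)] bilinear_map_closed[OF f] tensor_lift_bind[OF s m(3-7) f] m p q; assumption)+
  finally show ?thesis .
qed

lemma hom_coalgebra_hom_object: "hom_coalgebra R C \<Longrightarrow> hom_object R C"
  by (simp add: hom_coalgebra_def)

context right_hom_comodule
begin

lemmas comodule_objects = C.hom_object_axioms M.hom_object_axioms
lemmas comodule_modules = comodule_objects[THEN hom_object_module]

lemma coact_linear: "linear_map R Z M g \<Longrightarrow> linear_map R Z (tensor R M C) (\<lambda>z. coact (g z))"
  by (rule linear_map_comp[OF hom_map_linear[OF coact_map]])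

lemma comult_linear: "linear_map R Z C g \<Longrightarrow> linear_map R Z (tensor R C C) (\<lambda>z. comult C (g z))"
  by (rule linear_map_comp[OF hom_map_linear[OF C.comult_map]])

lemma coact_closed: "m \<in> carrier M \<Longrightarrow> coact m \<in> carrier (tensor R M C)"
  by (rule linear_map_closed[OF hom_map_linear[OF coact_map]])

lemma comult_closed: "c \<in> carrier C \<Longrightarrow> comult C c \<in> carrier (tensor R C C)"
  by (rule linear_map_closed[OF hom_map_linear[OF C.comult_map]])

text \<open>The comodule axioms in the form in which Sweedler notation applies them: inside an arbitrary
  multilinear expression.\<close>

lemma coassoc_lift:
  assumes P: "module R P" and m: "m \<in> carrier M"
    and G: "\<And>d e. \<lbrakk>d \<in> carrier C; e \<in> carrier C\<rbrakk> \<Longrightarrow> linear_map R M P (\<lambda>y. G y d e)"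
      "\<And>y e. \<lbrakk>y \<in> carrier M; e \<in> carrier C\<rbrakk> \<Longrightarrow> linear_map R C P (\<lambda>d. G y d e)"
      "\<And>y d. \<lbrakk>y \<in> carrier M; d \<in> carrier C\<rbrakk> \<Longrightarrow> linear_map R C P (\<lambda>e. G y d e)"
  shows "tensor_lift R P (\<lambda>x c. tensor_lift R P (\<lambda>y d. G y d (inv_aut C c)) (coact x)) (coact m) =
    tensor_lift R P (\<lambda>x c. tensor_lift R P (\<lambda>d e. G (inv_aut M x) d e) (comult C c)) (coact m)"
proof -
  let ?CC = "tensor R C C"
  let ?T = "tensor R M ?CC"
  let ?h = "tensor_lift R P (\<lambda>y t. tensor_lift R P (\<lambda>d e. G y d e) t)"
  have Gc: "G y d e \<in> carrier P" if "y \<in> carrier M" "d \<in> carrier C" "e \<in> carrier C" for y d e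
    using linear_map_closed[OF G(1)] that by blast
  note rules = comodule_modules comodule_objects P G Gc linearity coact_linear comult_linear coact_closed comult_closed
  \<comment> \<open>The linear map on \<open>M \<otimes> (C \<otimes> C)\<close> given by \<open>G\<close> is applied to both sides of the coassociativity axiom.\<close>
  have b: "bilinear_map R M ?CC P (\<lambda>y t. tensor_lift R P (\<lambda>d e. G y d e) t)"
    by ((assumption | rule rules)+)
  have h: "linear_map R ?T P ?h"
    by (rule tensor_lift_linear_map[OF b]) (assumption | rule rules)+
  have ht: "?h (tens R M ?CC y t) = tensor_lift R P (\<lambda>d e. G y d e) t"
    if "y \<in> carrier M" "t \<in> carrier ?CC" for y t
    by (rule tensor_lift_tens[OF _ _ _ b]) ((assumption | rule rules that)+)
  have hg: "?h (tens R M ?CC y (tens R C C d e)) = G y d e"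
    if "y \<in> carrier M" "d \<in> carrier C" "e \<in> carrier C" for y d e
  proof -
    have "tensor_lift R P (\<lambda>d e. G y d e) (tens R C C d e) = G y d e"
      by (rule tensor_lift_tens) ((assumption | rule rules that)+)
    then show ?thesis using ht[OF that(1) tens_closed[OF comodule_modules(1,1) that(2,3)]] by simp
  qed
  have mT: "module R ?T" by (assumption | rule rules)+
  have "tensor_lift R P (\<lambda>x c. tensor_lift R P (\<lambda>y d. G y d (inv_aut C c)) (coact x)) (coact m) =
      tensor_lift R P (\<lambda>x c. ?h (tensor_lift R ?T
        (\<lambda>y d. tens R M ?CC y (tens R C C d (inv_aut C c))) (coact x))) (coact m)"
  proof (rule tensor_lift_cong[OF coact_closed[OF m] comodule_modules(2,1) P])
    fix x c assume xc: "x \<in> carrier M" "c \<in> carrier C"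
    have "?h (tensor_lift R ?T (\<lambda>y d. tens R M ?CC y (tens R C C d (inv_aut C c))) (coact x)) =
        tensor_lift R P (\<lambda>y d. ?h (tens R M ?CC y (tens R C C d (inv_aut C c)))) (coact x)"
      by (rule linear_map_tensor_lift[OF coact_closed[OF xc(1)] comodule_modules(2,1) mT P h])
        ((assumption | rule rules xc)+)
    also have "\<dots> = tensor_lift R P (\<lambda>y d. G y d (inv_aut C c)) (coact x)"
      by (rule tensor_lift_cong[OF coact_closed[OF xc(1)] comodule_modules(2,1) P])
        ((assumption | rule rules hg xc)+)
    finally show "tensor_lift R P (\<lambda>y d. G y d (inv_aut C c)) (coact x) =
      ?h (tensor_lift R ?T (\<lambda>y d. tens R M ?CC y (tens R C C d (inv_aut C c))) (coact x))" by simp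
    show "?h (tensor_lift R ?T (\<lambda>y d. tens R M ?CC y (tens R C C d (inv_aut C c))) (coact x)) \<in> carrier P"
      by (rule linear_map_closed[OF h]) ((assumption | rule rules xc)+)
  qed
  also have "\<dots> = ?h (tensor_lift R ?T (\<lambda>x c. tensor_lift R ?T
        (\<lambda>y d. tens R M ?CC y (tens R C C d (inv_aut C c))) (coact x)) (coact m))"
    by (rule linear_map_tensor_lift[OF coact_closed[OF m] comodule_modules(2,1) mT P h, symmetric])
      ((assumption | rule rules)+)
  also have "\<dots> = ?h (tensor_lift R ?T (\<lambda>x c. tens R M ?CC (inv_aut M x) (comult C c)) (coact m))"
    by (simp only: coact_coassoc[OF m])
  also have "\<dots> = tensor_lift R P (\<lambda>x c. ?h (tens R M ?CC (inv_aut M x) (comult C c))) (coact m)"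
    by (rule linear_map_tensor_lift[OF coact_closed[OF m] comodule_modules(2,1) mT P h])
      ((assumption | rule rules)+)
  also have "\<dots> = tensor_lift R P (\<lambda>x c. tensor_lift R P (\<lambda>d e. G (inv_aut M x) d e) (comult C c)) (coact m)"
    by (rule tensor_lift_cong[OF coact_closed[OF m] comodule_modules(2,1) P]) ((assumption | rule rules ht)+)
  finally show ?thesis .
qed

lemma counit_closed: "c \<in> carrier C \<Longrightarrow> counit C c \<in> carrier R"
  using linear_map_closed[OF C.counit_linear] by (simp add: self_module_def)

lemma counit_lift:
  assumes P: "module R P" and m: "m \<in> carrier M" and G: "linear_map R M P G"
  shows "tensor_lift R P (\<lambda>x c. counit C c \<odot>\<^bsub>P\<^esub> G x) (coact m) = G (inv_aut M m)"
proof -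
  have "G (inv_aut M m) = G (tensor_lift R M (\<lambda>x c. counit C c \<odot>\<^bsub>M\<^esub> x) (coact m))"
    by (simp only: coact_counit[OF m])
  also have "\<dots> = tensor_lift R P (\<lambda>x c. G (counit C c \<odot>\<^bsub>M\<^esub> x)) (coact m)"
    by (rule linear_map_tensor_lift[OF coact_closed[OF m] comodule_modules(2,1) comodule_modules(2) P G])
      (simp add: counit_closed)
  also have "\<dots> = tensor_lift R P (\<lambda>x c. counit C c \<odot>\<^bsub>P\<^esub> G x) (coact m)"
    by (rule tensor_lift_cong[OF coact_closed[OF m] comodule_modules(2,1) P])
      (simp_all add: counit_closed linear_map_smult[OF G] linear_map_closed[OF G] module.smult_closed[OF P])
  finally show ?thesis ..
qed

lemma coact_aut_lift:
  assumes P: "module R P" and m: "m \<in> carrier M" and f: "bilinear_map R M C P f"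
  shows "tensor_lift R P f (coact (aut M m)) = tensor_lift R P (\<lambda>x c. f (aut M x) (aut C c)) (coact m)"
  unfolding hom_map_aut[OF coact_map m] aut_tensor
  by (rule tensor_lift_bind[OF coact_closed[OF m] comodule_modules(2,1,2,1) P f]) ((assumption | rule comodule_objects aut_closed)+)

end

lemma (in right_hom_comodule_algebra) coact_mult_lift:
  assumes P: "module R P" and ab: "a \<in> carrier A" "b \<in> carrier A" and f: "bilinear_map R A H P f"
  shows "tensor_lift R P f (coact (a \<otimes>\<^bsub>A\<^esub> b)) =
    tensor_lift R P (\<lambda>a0 a1. tensor_lift R P (\<lambda>b0 b1. f (a0 \<otimes>\<^bsub>A\<^esub> b0) (a1 \<otimes>\<^bsub>H\<^esub> b1)) (coact b)) (coact a)"
  unfolding coact_mult[OF ab]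
  by (rule tensor_lift_bind2[OF coact_closed[OF ab(1)] coact_closed[OF ab(2)] _ _ _ _ _ _ P f])
    ((assumption | rule comodule_modules bilinear_map_closed[OF hom_bimap_bilinear[OF A.mult_bimap]]
        bilinear_map_closed[OF hom_bimap_bilinear[OF H.mult_bimap]])+)

lemma (in left_hom_module_coalgebra) comult_act_lift:
  assumes P: "module R P" and hc: "h \<in> carrier H" "c \<in> carrier C" and f: "bilinear_map R C C P f"
  shows "tensor_lift R P f (comult C (act h c)) =
    tensor_lift R P (\<lambda>h1 h2. tensor_lift R P (\<lambda>c1 c2. f (act h1 c1) (act h2 c2)) (comult C c)) (comult H h)"
  unfolding comult_act[OF hc]
  by (rule tensor_lift_bind2[OF linear_map_closed[OF hom_map_linear[OF H.comult_map]]
        linear_map_closed[OF hom_map_linear[OF C.comult_map]] _ _ _ _ _ _ P f])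
    ((assumption | rule hc hom_object_module A.hom_object_axioms C.hom_object_axioms
        bilinear_map_closed[OF hom_bimap_bilinear[OF act_bimap]])+)

section \<open>Maps of Doi Hom-Hopf data\<close>

lemma smult_linear:
  assumes "module R N" "r \<in> carrier R" "linear_map R Z N g"
  shows "linear_map R Z N (\<lambda>z. r \<odot>\<^bsub>N\<^esub> g z)"
proof -
  interpret N: module R N by fact
  have "linear_map R N N (\<lambda>n. r \<odot>\<^bsub>N\<^esub> n)"
    by (rule linear_mapI)
      (use assms(2) in \<open>simp_all add: N.smult_r_distr N.smult_assoc1[symmetric] N.R.m_comm\<close>)
  then show ?thesis using assms(3) by (rule linear_map_comp)
qed

lemma scalar_linear:
  assumes "module R N" "linear_map R C (self_module R) e" "q \<in> carrier N" "linear_map R Z C g"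
  shows "linear_map R Z N (\<lambda>z. e (g z) \<odot>\<^bsub>N\<^esub> q)"
proof -
  interpret N: module R N by fact
  have "linear_map R (self_module R) N (\<lambda>r. r \<odot>\<^bsub>N\<^esub> q)"
    by (rule linear_mapI) (use assms(3) in \<open>simp_all add: self_module_def N.smult_l_distr N.smult_assoc1\<close>)
  then show ?thesis using linear_map_comp[OF assms(2,4)] by (rule linear_map_comp)
qed

text \<open>Two Doi Hom-Hopf data over \<open>R\<close> and a map between them.\<close>

locale doi_map =
  fixes R :: "('k, 'r) ring_scheme"
    and D :: "('k, 'h, 'a, 'c) doi_datum"
    and D' :: "('k, 'h1, 'a1, 'c1) doi_datum"
    and \<phi> :: "'h \<Rightarrow> 'h1" and \<psi> :: "'a \<Rightarrow> 'a1" and \<chi> :: "'c \<Rightarrow> 'c1"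
  assumes D: "doi_hom_hopf_datum R D" and D': "doi_hom_hopf_datum R D'"
    and datum_map: "doi_datum_map R D D' \<phi> \<psi> \<chi>"
begin

abbreviation "H \<equiv> hopf D"
abbreviation "H' \<equiv> hopf D'"
abbreviation "A \<equiv> alg D"
abbreviation "A' \<equiv> alg D'"
abbreviation "C \<equiv> coalg D"
abbreviation "C' \<equiv> coalg D'"

lemma comodule_algebra: "right_hom_comodule_algebra R H A (alg_coact D)"
  and comodule_algebra': "right_hom_comodule_algebra R H' A' (alg_coact D')"
  and module_coalgebra: "left_hom_module_coalgebra R H C (coalg_act D)"
  and module_coalgebra': "left_hom_module_coalgebra R H' C' (coalg_act D')"
  using D D' by (simp_all add: doi_hom_hopf_datum_def)

lemmas comodule' = right_hom_comodule_algebra.axioms(2)[OF comodule_algebra']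
  and comodule = right_hom_comodule_algebra.axioms(2)[OF comodule_algebra]
  and hom_module' = left_hom_module_coalgebra.axioms(2)[OF module_coalgebra']
  and hom_module = left_hom_module_coalgebra.axioms(2)[OF module_coalgebra]
  and coalgebra = left_hom_module_coalgebra.axioms(1)[OF module_coalgebra]
  and coalgebra' = left_hom_module_coalgebra.axioms(1)[OF module_coalgebra']
  and algebra = right_hom_comodule_algebra.axioms(1)[OF comodule_algebra]
  and algebra' = right_hom_comodule_algebra.axioms(1)[OF comodule_algebra']

lemmas Hcoalg = right_hom_comodule.axioms(1)[OF comodule]
  and Hcoalg' = right_hom_comodule.axioms(1)[OF comodule']
  and Halg' = left_hom_module.axioms(1)[OF hom_module']

lemmas H_object = hom_coalgebra_hom_object[OF Hcoalg]
  and H'_object = hom_coalgebra_hom_object[OF Hcoalg']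
  and A_object = hom_algebra.axioms(1)[OF algebra]
  and A'_object = hom_algebra.axioms(1)[OF algebra']
  and C_object = hom_coalgebra_hom_object[OF coalgebra]
  and C'_object = hom_coalgebra_hom_object[OF coalgebra']

lemmas objects = H_object H'_object A_object A'_object C_object C'_object
lemmas modules = objects[THEN hom_object_module]

lemma psi: "hom_map R A A' \<psi>" "\<lbrakk>a \<in> carrier A; b \<in> carrier A\<rbrakk> \<Longrightarrow> \<psi> (a \<otimes>\<^bsub>A\<^esub> b) = \<psi> a \<otimes>\<^bsub>A'\<^esub> \<psi> b" "\<psi> \<one>\<^bsub>A\<^esub> = \<one>\<^bsub>A'\<^esub>"
  and phi: "hom_map R H H' \<phi>"
  and chi: "hom_map R C C' \<chi>"
    "c \<in> carrier C \<Longrightarrow> comult C' (\<chi> c) = tensor_lift R (tensor R C' C') (\<lambda>x y. tens R C' C' (\<chi> x) (\<chi> y)) (comult C c)"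
    "c \<in> carrier C \<Longrightarrow> counit C' (\<chi> c) = counit C c"
  and chi_act: "\<lbrakk>h \<in> carrier H; c \<in> carrier C\<rbrakk> \<Longrightarrow> \<chi> (coalg_act D h c) = coalg_act D' (\<phi> h) (\<chi> c)"
  and coact_psi: "a \<in> carrier A \<Longrightarrow> alg_coact D' (\<psi> a) =
      tensor_lift R (tensor R A' H') (\<lambda>a0 a1. tens R A' H' (\<psi> a0) (\<phi> a1)) (alg_coact D a)"
  using datum_map
  by (auto simp: doi_datum_map_def hom_hopf_map_def hom_algebra_map_def hom_coalgebra_map_def)

lemmas hom_linear = linear_map_comp[OF hom_map_linear[OF psi(1)]] linear_map_comp[OF hom_map_linear[OF phi]]
  linear_map_comp[OF hom_map_linear[OF chi(1)]]
lemmas hom_closed = linear_map_closed[OF hom_map_linear[OF psi(1)]] linear_map_closed[OF hom_map_linear[OF phi]]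
  linear_map_closed[OF hom_map_linear[OF chi(1)]]

lemmas bilinear =
  hom_bimap_bilinear[OF hom_algebra.mult_bimap[OF algebra']]
  hom_bimap_bilinear[OF hom_algebra.mult_bimap[OF Halg']]
  hom_bimap_bilinear[OF left_hom_module.act_bimap[OF hom_module']]
  hom_bimap_bilinear[OF left_hom_module.act_bimap[OF hom_module]]

lemmas bilinear_linear = bilinear[THEN linear_map_bilinear_left] bilinear[THEN linear_map_bilinear_right]
  and bilinear_closed = bilinear[THEN bilinear_map_closed]

lemmas co_linear = right_hom_comodule.coact_linear[OF comodule] right_hom_comodule.coact_linear[OF comodule']
  right_hom_comodule.comult_linear[OF comodule']
  linear_map_comp[OF hom_map_linear[OF hom_coalgebra.comult_map[OF coalgebra]]]
  linear_map_comp[OF hom_map_linear[OF hom_coalgebra.comult_map[OF coalgebra']]]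
lemmas co_closed = right_hom_comodule.coact_closed[OF comodule] right_hom_comodule.coact_closed[OF comodule']
  right_hom_comodule.comult_closed[OF comodule']
  linear_map_closed[OF hom_map_linear[OF hom_coalgebra.comult_map[OF coalgebra]]]
  linear_map_closed[OF hom_map_linear[OF hom_coalgebra.comult_map[OF coalgebra']]]

text \<open>The rules \<open>linearity\<close> together with those for the structure maps of the two data. The lists
  \<open>induction_rules\<close> and \<open>coaction_rules\<close> below extend them further.\<close>

lemmas datum_rules = modules objects linearity hom_linear hom_closed bilinear_linear bilinear_closed co_linear co_closed

lemma restricted_bimap: "hom_bimap R A' A A' (restricted_act D' \<psi>)"
proof -
  have "bilinear_map R A' A A' (\<lambda>x a. x \<otimes>\<^bsub>A'\<^esub> \<psi> a)"
    by (assumption | rule datum_rules)+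
  then show ?thesis
    by (simp add: hom_bimap_def restricted_act_def[abs_def] hom_bimap_aut[OF hom_algebra.mult_bimap[OF algebra']]
        hom_closed hom_map_aut[OF psi(1)])
qed

lemma restricted_module: "right_hom_module R A A' (\<lambda>a' a. a' \<otimes>\<^bsub>A'\<^esub> \<psi> a)"
proof (intro right_hom_module.intro right_hom_module_axioms.intro algebra A'_object)
  show "hom_bimap R A' A A' (\<lambda>a' a. a' \<otimes>\<^bsub>A'\<^esub> \<psi> a)"
    using restricted_bimap by (simp add: restricted_act_def[abs_def])
  show "m \<otimes>\<^bsub>A'\<^esub> \<psi> a \<otimes>\<^bsub>A'\<^esub> \<psi> (aut A b) = aut A' m \<otimes>\<^bsub>A'\<^esub> \<psi> (a \<otimes>\<^bsub>A\<^esub> b)"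
    if "m \<in> carrier A'" "a \<in> carrier A" "b \<in> carrier A" for m a b
    using that hom_algebra.hom_assoc[OF algebra', of m "\<psi> a" "\<psi> b"]
    by (simp add: hom_map_aut[OF psi(1)] psi(2) hom_closed)
  show "m \<otimes>\<^bsub>A'\<^esub> \<psi> \<one>\<^bsub>A\<^esub> = aut A' m" if "m \<in> carrier A'" for m
    using that by (simp add: psi(3) hom_algebra.hom_r_one[OF algebra'])
qed

end

section \<open>The induced Doi Hom-Hopf module\<close>

text \<open>The action and the coaction on \<open>A' \<otimes>\<^sub>A M\<close>. The parameter \<open>Q\<close> stands for any record whose
  underlying object is \<open>A' \<otimes>\<^sub>A M\<close>.\<close>

definition induced_act ::
  "('k, 'r) ring_scheme \<Rightarrow> ('k, 'h, 'a, 'c) doi_datum \<Rightarrow> ('k, 'h1, 'a1, 'c1) doi_datum \<Rightarrow>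
    ('a \<Rightarrow> 'a1) \<Rightarrow> ('k, 'a, 'c, 'm) doi_obj \<Rightarrow>
    ('k, ('k, 'a1, 'm) tensor_elt set, 'z) hom_obj_scheme \<Rightarrow> 'a1 \<Rightarrow>
    ('k, 'a1, 'm) tensor_elt set \<Rightarrow> ('k, 'a1, 'm) tensor_elt set" where
  "induced_act R D D' \<psi> M Q b =
    quotient_lift R Q
      (\<lambda>a m. induced_tens R D D' \<psi> M (inv_aut (alg D') b \<otimes>\<^bsub>alg D'\<^esub> a) (aut M m))"

text \<open>The balanced bilinear map \<open>A' \<times> M \<rightarrow> Q \<otimes> C'\<close> that induces the coaction.\<close>

definition induced_coact_bimap ::
  "('k, 'r) ring_scheme \<Rightarrow> ('k, 'h, 'a, 'c) doi_datum \<Rightarrow> ('k, 'h1, 'a1, 'c1) doi_datum \<Rightarrow>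
    ('a \<Rightarrow> 'a1) \<Rightarrow> ('c \<Rightarrow> 'c1) \<Rightarrow> ('k, 'a, 'c, 'm) doi_obj \<Rightarrow>
    ('k, ('k, 'a1, 'm) tensor_elt set, 'z) hom_obj_scheme \<Rightarrow> 'a1 \<Rightarrow> 'm \<Rightarrow>
    ('k, ('k, 'a1, 'm) tensor_elt set, 'c1) tensor_elt" where
  "induced_coact_bimap R D D' \<psi> \<chi> M Q a m =
    tensor_lift R (tensor R Q (coalg D')) (\<lambda>a0 a1.
      tensor_lift R (tensor R Q (coalg D')) (\<lambda>m0 m1.
        tens R Q (coalg D') (induced_tens R D D' \<psi> M a0 m0) (coalg_act D' a1 (\<chi> m1)))
        (coact M m))
      (alg_coact D' a)"

definition induced_coact ::
  "('k, 'r) ring_scheme \<Rightarrow> ('k, 'h, 'a, 'c) doi_datum \<Rightarrow> ('k, 'h1, 'a1, 'c1) doi_datum \<Rightarrow>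
    ('a \<Rightarrow> 'a1) \<Rightarrow> ('c \<Rightarrow> 'c1) \<Rightarrow> ('k, 'a, 'c, 'm) doi_obj \<Rightarrow>
    ('k, ('k, 'a1, 'm) tensor_elt set, 'z) hom_obj_scheme \<Rightarrow> ('k, 'a1, 'm) tensor_elt set \<Rightarrow>
    ('k, ('k, 'a1, 'm) tensor_elt set, 'c1) tensor_elt" where
  "induced_coact R D D' \<psi> \<chi> M Q =
    quotient_lift R (tensor R Q (coalg D')) (induced_coact_bimap R D D' \<psi> \<chi> M Q)"

text \<open>A map of data, a Doi Hom-Hopf module \<open>M\<close>, and a record \<open>Q\<close> whose underlying object is
  \<open>A' \<otimes>\<^sub>A M\<close>.\<close>

locale doi_induction = doi_map R D D' \<phi> \<psi> \<chi>
  for R :: "('k, 'r) ring_scheme"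
    and D :: "('k, 'h, 'a, 'c) doi_datum"
    and D' :: "('k, 'h1, 'a1, 'c1) doi_datum"
    and \<phi> :: "'h \<Rightarrow> 'h1" and \<psi> :: "'a \<Rightarrow> 'a1" and \<chi> :: "'c \<Rightarrow> 'c1" +
  fixes M :: "('k, 'a, 'c, 'm) doi_obj"
    and Q :: "('k, ('k, 'a1, 'm) tensor_elt set, 'z) hom_obj_scheme"
  assumes doi_module: "doi_hom_hopf_module R D M"
    and trunc: "hom_obj.truncate Q = induced_obj R D D' \<psi> M"
begin

lemma M_smoduledule: "left_hom_module R A M (act M)"
  and M_comodule: "right_hom_comodule R C M (coact M)"
  and coact_act: "\<lbrakk>a \<in> carrier A; m \<in> carrier M\<rbrakk> \<Longrightarrow> coact M (act M a m) =
      tensor_lift R (tensor R M C) (\<lambda>a0 a1. tensor_lift R (tensor R M C)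
          (\<lambda>m0 m1. tens R M C (act M a0 m0) (coalg_act D a1 m1)) (coact M m)) (alg_coact D a)"
  using doi_module by (simp_all add: doi_hom_hopf_module_def)

lemmas M_object = left_hom_module.axioms(2)[OF M_smoduledule]
lemmas M_smodule = hom_object_module[OF M_object]
lemmas M_bilinear = hom_bimap_bilinear[OF left_hom_module.act_bimap[OF M_smoduledule]]

sublocale B: balanced_setup R A A' M "restricted_act D' \<psi>" "act M" Q
  by (intro balanced_setup.intro balanced_setup_axioms.intro A_object A'_object M_object restricted_bimap
      left_hom_module.act_bimap[OF M_smoduledule])
    (use trunc in \<open>simp add: induced_obj_def\<close>)

abbreviation "bt \<equiv> induced_tens R D D' \<psi> M"
abbreviation "actQ \<equiv> induced_act R D D' \<psi> M Q"
abbreviation "comap \<equiv> induced_coact_bimap R D D' \<psi> \<chi> M Q"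
abbreviation "coQ \<equiv> induced_coact R D D' \<psi> \<chi> M Q"

lemma bt_eq: "bt = B.bt"
  by (simp add: fun_eq_iff induced_tens_def)

lemmas Q_object = B.hom_object_Q
lemmas module_Q = B.module_Q
lemmas bt_closed = B.bt_closed[folded bt_eq]
lemmas bt_linear = B.bt_linear_left[folded bt_eq] B.bt_linear_right[folded bt_eq]
lemmas aut_bt = B.aut_bt[folded bt_eq]
lemmas Q_eqI = B.Q_eqI[folded bt_eq]
lemmas lift_linear = B.quotient_lift_bt(1)[folded bt_eq]
lemmas lift_bt = B.quotient_lift_bt(2)[folded bt_eq]

text \<open>The defining relation at \<open>\<mu>(m)\<close> in place of \<open>m\<close>, which removes \<open>\<mu>\<inverse>\<close>.\<close>

lemma bt_balanced:
  assumes "x \<in> carrier A'" "a \<in> carrier A" "m \<in> carrier M"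
  shows "bt (x \<otimes>\<^bsub>A'\<^esub> \<psi> a) (aut M m) = bt (aut A' x) (act M a m)"
  using B.bt_balanced[OF assms(1,2), of "aut M m"] assms(3)
  by (simp add: bt_eq restricted_act_def aut_closed[OF M_object] inv_aut_aut[OF M_object])

lemmas induction_rules = datum_rules M_object M_smodule Q_object module_Q bt_closed bt_linear
  linear_map_bilinear_left[OF M_bilinear] linear_map_bilinear_right[OF M_bilinear] bilinear_map_closed[OF M_bilinear]
  right_hom_comodule.coact_linear[OF M_comodule] right_hom_comodule.coact_closed[OF M_comodule]

lemma coact_act_lift:
  assumes P: "module R P" and am: "a \<in> carrier A" "m \<in> carrier M" and f: "bilinear_map R M C P f"
  shows "tensor_lift R P f (coact M (act M a m)) = tensor_lift R P (\<lambda>a0 a1. tensor_lift R P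
    (\<lambda>m0 m1. f (act M a0 m0) (coalg_act D a1 m1)) (coact M m)) (alg_coact D a)"
  unfolding coact_act[OF am]
  by (rule tensor_lift_bind2[OF _ _ _ _ _ _ _ _ P f]) ((assumption | rule induction_rules am)+)

lemma coact_psi_lift:
  assumes P: "module R P" and a: "a \<in> carrier A" and f: "bilinear_map R A' H' P f"
  shows "tensor_lift R P f (alg_coact D' (\<psi> a)) = tensor_lift R P (\<lambda>a0 a1. f (\<psi> a0) (\<phi> a1)) (alg_coact D a)"
  unfolding coact_psi[OF a]
  by (rule tensor_lift_bind[OF _ _ _ _ _ P f]) ((assumption | rule induction_rules a)+)

lemma comult_chi_lift:
  assumes P: "module R P" and c: "c \<in> carrier C" and f: "bilinear_map R C' C' P f"
  shows "tensor_lift R P f (comult C' (\<chi> c)) = tensor_lift R P (\<lambda>x y. f (\<chi> x) (\<chi> y)) (comult C c)"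
  unfolding chi(2)[OF c]
  by (rule tensor_lift_bind[OF _ _ _ _ _ P f]) ((assumption | rule induction_rules c)+)

lemmas mult_lift' = right_hom_comodule_algebra.coact_mult_lift[OF comodule_algebra']
  and comult_act_lift' = left_hom_module_coalgebra.comult_act_lift[OF module_coalgebra']
  and aut_lift' = right_hom_comodule.coact_aut_lift[OF comodule']
  and aut_liftM = right_hom_comodule.coact_aut_lift[OF M_comodule]
  and coassoc_lift' = right_hom_comodule.coassoc_lift[OF comodule']
  and coassoc_liftM = right_hom_comodule.coassoc_lift[OF M_comodule]
  and counit_lift' = right_hom_comodule.counit_lift[OF comodule']
  and counit_liftM = right_hom_comodule.counit_lift[OF M_comodule]
  and act_assoc' = left_hom_module.act_assoc[OF hom_module']

subsection \<open>The induced action\<close>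

lemma act_balanced:
  assumes b: "b \<in> carrier A'"
  shows "\<forall>x\<in>carrier A'. \<forall>a\<in>carrier A. \<forall>m\<in>carrier M.
    bt (b \<otimes>\<^bsub>A'\<^esub> restricted_act D' \<psi> x a) (aut M m) =
    bt (b \<otimes>\<^bsub>A'\<^esub> aut A' x) (aut M (act M a (inv_aut M m)))"
proof (intro ballI)
  fix x a m assume x: "x \<in> carrier A'" and a: "a \<in> carrier A" and m: "m \<in> carrier M"
  let ?c = "inv_aut A' b"
  have c: "?c \<in> carrier A'" "aut A' ?c = b"
    by (simp_all add: inv_aut_closed[OF A'_object b] aut_inv_aut[OF A'_object b])
  have "b \<otimes>\<^bsub>A'\<^esub> (x \<otimes>\<^bsub>A'\<^esub> \<psi> a) = (?c \<otimes>\<^bsub>A'\<^esub> x) \<otimes>\<^bsub>A'\<^esub> \<psi> (aut A a)"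
    using hom_algebra.hom_assoc[OF algebra' c(1) x, of "\<psi> a"] a c(2)
    by (simp add: hom_closed hom_map_aut[OF psi(1)])
  then have "bt (b \<otimes>\<^bsub>A'\<^esub> restricted_act D' \<psi> x a) (aut M m) =
      bt (aut A' (?c \<otimes>\<^bsub>A'\<^esub> x)) (act M (aut A a) m)"
    using bt_balanced[of "?c \<otimes>\<^bsub>A'\<^esub> x" "aut A a" m] c x a m
    by (simp add: restricted_act_def bilinear_closed aut_closed[OF A_object])
  also have "aut A' (?c \<otimes>\<^bsub>A'\<^esub> x) = b \<otimes>\<^bsub>A'\<^esub> aut A' x"
    using c x by (simp add: hom_bimap_aut[OF hom_algebra.mult_bimap[OF algebra']])
  also have "act M (aut A a) m = aut M (act M a (inv_aut M m))"
    using a m by (simp add: hom_bimap_aut[OF left_hom_module.act_bimap[OF M_smoduledule]]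
        inv_aut_closed[OF M_object] aut_inv_aut[OF M_object])
  finally show "bt (b \<otimes>\<^bsub>A'\<^esub> restricted_act D' \<psi> x a) (aut M m) =
    bt (b \<otimes>\<^bsub>A'\<^esub> aut A' x) (aut M (act M a (inv_aut M m)))" .
qed

lemma act_bilinear:
  "b \<in> carrier A' \<Longrightarrow> bilinear_map R A' M Q (\<lambda>a m. bt (b \<otimes>\<^bsub>A'\<^esub> a) (aut M m))"
  by (assumption | rule induction_rules)+

lemma actQ_bt:
  assumes "b \<in> carrier A'" "x \<in> carrier A'" "m \<in> carrier M"
  shows "actQ b (bt x m) = bt (inv_aut A' b \<otimes>\<^bsub>A'\<^esub> x) (aut M m)"
  unfolding induced_act_def
  by (rule lift_bt[OF module_Q act_bilinear act_balanced assms(2,3)]) (rule inv_aut_closed[OF A'_object assms(1)])+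

lemma actQ_linear_right:
  assumes "b \<in> carrier A'" "linear_map R Z Q g"
  shows "linear_map R Z Q (\<lambda>z. actQ b (g z))"
  unfolding induced_act_def
  by (rule linear_map_comp[OF lift_linear[OF module_Q act_bilinear act_balanced] assms(2)])
    (rule inv_aut_closed[OF A'_object assms(1)])+

text \<open>Linearity in the acting element is read off the definition: for fixed \<open>q\<close>, \<^const>\<open>quotient_lift\<close>
  evaluates all the bilinear maps concerned at the same representative of \<open>q\<close>.\<close>

lemma actQ_linear_left:
  assumes q: "q \<in> carrier Q" and g: "linear_map R Z A' g" and Z: "module R Z"
  shows "linear_map R Z Q (\<lambda>z. actQ (g z) q)"
proof -
  have "(SOME t. t \<in> q) \<in> carrier (tensor R A' M)"
    using B.QS.quotient_some_mem[of q] q by (auto simp: B.Q_simps)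
  then show ?thesis
    unfolding induced_act_def quotient_lift_def by (rule tensor_lift_param_linear) ((assumption | rule induction_rules Z g)+)
qed

lemma actQ_closed: "\<lbrakk>b \<in> carrier A'; q \<in> carrier Q\<rbrakk> \<Longrightarrow> actQ b q \<in> carrier Q"
  by (rule linear_map_closed[OF actQ_linear_right[OF _ linear_map_id]])

lemma Q_left_module: "left_hom_module R A' Q actQ"
proof (intro left_hom_module.intro left_hom_module_axioms.intro algebra' Q_object)
  note sws = induction_rules actQ_linear_right actQ_closed
  note mult = hom_algebra.mult_bimap[OF algebra'] and assoc = hom_algebra.hom_assoc[OF algebra']
  note A'_simps = bilinear_closed inv_aut_closed[OF A'_object] aut_closed[OF A'_object] aut_closed[OF M_object]
    aut_inv_aut[OF A'_object] inv_aut_aut[OF A'_object] hom_bimap_aut[OF mult]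
    hom_bimap_inv_aut[OF mult A'_object A'_object A'_object]
  have "bilinear_map R A' Q Q actQ"
    by (rule bilinear_mapI) ((assumption | rule actQ_linear_left actQ_linear_right linear_map_id modules)+)
  moreover have "aut Q (actQ b q) = actQ (aut A' b) (aut Q q)" if b: "b \<in> carrier A'" and q: "q \<in> carrier Q" for b q
  proof (rule Q_eqI[OF module_Q _ _ _ q])
    show "linear_map R Q Q (\<lambda>q. aut Q (actQ b q))" "linear_map R Q Q (\<lambda>q. actQ (aut A' b) (aut Q q))"
      by ((assumption | rule sws b)+)
    show "aut Q (actQ b (bt x m)) = actQ (aut A' b) (aut Q (bt x m))" if "x \<in> carrier A'" "m \<in> carrier M" for x m
      using b that by (simp add: actQ_bt aut_bt A'_simps)
  qed
  ultimately show "hom_bimap R A' Q Q actQ" by (simp add: hom_bimap_def)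
  show "actQ (aut A' a) (actQ b q) = actQ (a \<otimes>\<^bsub>A'\<^esub> b) (aut Q q)"
    if a: "a \<in> carrier A'" and b: "b \<in> carrier A'" and q: "q \<in> carrier Q" for a b q
  proof (rule Q_eqI[OF module_Q _ _ _ q])
    show "linear_map R Q Q (\<lambda>q. actQ (aut A' a) (actQ b q))" "linear_map R Q Q (\<lambda>q. actQ (a \<otimes>\<^bsub>A'\<^esub> b) (aut Q q))"
      by ((assumption | rule sws a b)+)
    show "actQ (aut A' a) (actQ b (bt x m)) = actQ (a \<otimes>\<^bsub>A'\<^esub> b) (aut Q (bt x m))"
      if "x \<in> carrier A'" "m \<in> carrier M" for x m
      using a b that assoc[of "inv_aut A' a" "inv_aut A' b" x] by (simp add: actQ_bt aut_bt A'_simps)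
  qed
  show "actQ \<one>\<^bsub>A'\<^esub> q = aut Q q" if q: "q \<in> carrier Q" for q
  proof (rule Q_eqI[OF module_Q _ _ _ q])
    note one = hom_algebra.one_in_carrier[OF algebra']
    show "linear_map R Q Q (\<lambda>q. actQ \<one>\<^bsub>A'\<^esub> q)" "linear_map R Q Q (\<lambda>q. aut Q q)"
      by ((assumption | rule sws one)+)
    have "inv_aut A' \<one>\<^bsub>A'\<^esub> = \<one>\<^bsub>A'\<^esub>"
      by (rule inv_aut_eqI[OF A'_object one hom_algebra.aut_one[OF algebra']])
    then show "actQ \<one>\<^bsub>A'\<^esub> (bt x m) = aut Q (bt x m)" if "x \<in> carrier A'" "m \<in> carrier M" for x m
      using one that by (simp add: actQ_bt aut_bt hom_algebra.hom_l_one[OF algebra'])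
  qed
qed

subsection \<open>The induced coaction\<close>

abbreviation "QC \<equiv> tensor R Q C'"
abbreviation "tQC \<equiv> tens R Q C'"
abbreviation "liftQC \<equiv> tensor_lift R QC"
abbreviation "\<rho>' \<equiv> alg_coact D'"

lemma module_QC: "module R QC" by (assumption | rule induction_rules)+

lemma comap_bilinear: "bilinear_map R A' M QC comap"
  unfolding induced_coact_bimap_def[abs_def] by (assumption | rule induction_rules)+

text \<open>Both sides are triple Sweedler sums over \<open>x\<close>, \<open>a\<close> and \<open>n = \<mu>\<inverse>(m)\<close>, which agree termwise:
  \<open>x\<^sub>0 \<psi>(a\<^sub>0) \<otimes>\<^sub>A \<mu>(n\<^sub>0) = \<beta>'(x\<^sub>0) \<otimes>\<^sub>A a\<^sub>0 \<cdot> n\<^sub>0\<close> since the tensor product is balanced, and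
  \<open>(x\<^sub>1 \<phi>(a\<^sub>1)) \<cdot> \<chi>(\<gamma>(n\<^sub>1)) = \<alpha>'(x\<^sub>1) \<cdot> \<chi>(a\<^sub>1 \<cdot> n\<^sub>1)\<close> since \<open>C'\<close> is a Hom-module.\<close>

lemma comap_balanced:
  "\<forall>x\<in>carrier A'. \<forall>a\<in>carrier A. \<forall>m\<in>carrier M.
    comap (restricted_act D' \<psi> x a) m = comap (aut A' x) (act M a (inv_aut M m))"
proof (intro ballI)
  fix x a m assume x: "x \<in> carrier A'" and a: "a \<in> carrier A" and m: "m \<in> carrier M"
  define n where "n = inv_aut M m"
  have n: "n \<in> carrier M" "m = aut M n"
    by (simp_all add: n_def inv_aut_closed[OF M_object m] aut_inv_aut[OF M_object m])
  let ?act = "coalg_act D'"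
  note s = induction_rules x a n(1)
  have "comap (x \<otimes>\<^bsub>A'\<^esub> \<psi> a) m =
      liftQC (\<lambda>x0 x1. liftQC (\<lambda>p0 p1. liftQC (\<lambda>m0 m1. tQC (bt (x0 \<otimes>\<^bsub>A'\<^esub> p0) m0) (?act (x1 \<otimes>\<^bsub>H'\<^esub> p1) (\<chi> m1)))
        (coact M m)) (\<rho>' (\<psi> a))) (\<rho>' x)"
    unfolding induced_coact_bimap_def n(2) by (rule mult_lift') ((assumption | rule s)+)
  also have "\<dots> = liftQC (\<lambda>x0 x1. liftQC (\<lambda>a0 a1. liftQC (\<lambda>n0 n1.
      tQC (bt (aut A' x0) (act M a0 n0)) (?act (aut H' x1) (\<chi> (coalg_act D a1 n1))))
        (coact M n)) (alg_coact D a)) (\<rho>' x)" (is "liftQC ?f _ = liftQC ?g _")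
  proof (rule tensor_lift_cong)
    fix x0 x1 assume x01: "x0 \<in> carrier A'" "x1 \<in> carrier H'"
    have "?f x0 x1 = liftQC (\<lambda>a0 a1. liftQC (\<lambda>m0 m1.
        tQC (bt (x0 \<otimes>\<^bsub>A'\<^esub> \<psi> a0) m0) (?act (x1 \<otimes>\<^bsub>H'\<^esub> \<phi> a1) (\<chi> m1))) (coact M m)) (alg_coact D a)"
      unfolding n(2) by (rule coact_psi_lift) ((assumption | rule s x01)+)
    also have "\<dots> = ?g x0 x1"
    proof (rule tensor_lift_cong)
      fix a0 a1 assume a01: "a0 \<in> carrier A" "a1 \<in> carrier H"
      have "liftQC (\<lambda>m0 m1. tQC (bt (x0 \<otimes>\<^bsub>A'\<^esub> \<psi> a0) m0) (?act (x1 \<otimes>\<^bsub>H'\<^esub> \<phi> a1) (\<chi> m1))) (coact M m)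
        = liftQC (\<lambda>n0 n1. tQC (bt (x0 \<otimes>\<^bsub>A'\<^esub> \<psi> a0) (aut M n0)) (?act (x1 \<otimes>\<^bsub>H'\<^esub> \<phi> a1) (\<chi> (aut C n1)))) (coact M n)"
        unfolding n(2) by (rule aut_liftM) ((assumption | rule s x01 a01)+)
      also have "\<dots> = liftQC (\<lambda>n0 n1. tQC (bt (aut A' x0) (act M a0 n0)) (?act (aut H' x1) (\<chi> (coalg_act D a1 n1))))
        (coact M n)"
      proof (rule tensor_lift_cong)
        fix n0 n1 assume n01: "n0 \<in> carrier M" "n1 \<in> carrier C"
        have "?act (x1 \<otimes>\<^bsub>H'\<^esub> \<phi> a1) (\<chi> (aut C n1)) = ?act (aut H' x1) (\<chi> (coalg_act D a1 n1))"
          using act_assoc'[of x1 "\<phi> a1" "\<chi> n1"] x01 a01 n01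
          by (simp add: hom_map_aut[OF chi(1)] chi_act hom_closed)
        then show "tQC (bt (x0 \<otimes>\<^bsub>A'\<^esub> \<psi> a0) (aut M n0)) (?act (x1 \<otimes>\<^bsub>H'\<^esub> \<phi> a1) (\<chi> (aut C n1))) =
          tQC (bt (aut A' x0) (act M a0 n0)) (?act (aut H' x1) (\<chi> (coalg_act D a1 n1)))"
          by (simp add: bt_balanced x01 a01 n01)
      qed ((assumption | rule s x01 a01)+)
      finally show "liftQC (\<lambda>m0 m1. tQC (bt (x0 \<otimes>\<^bsub>A'\<^esub> \<psi> a0) m0) (?act (x1 \<otimes>\<^bsub>H'\<^esub> \<phi> a1) (\<chi> m1))) (coact M m) =
        liftQC (\<lambda>n0 n1. tQC (bt (aut A' x0) (act M a0 n0)) (?act (aut H' x1) (\<chi> (coalg_act D a1 n1)))) (coact M n)" .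
    qed ((assumption | rule s x01)+)
    finally show "?f x0 x1 = ?g x0 x1" .
  qed ((assumption | rule s)+)
  also have "\<dots> = liftQC (\<lambda>x0 x1. liftQC (\<lambda>m0 m1. tQC (bt (aut A' x0) m0) (?act (aut H' x1) (\<chi> m1)))
      (coact M (act M a n))) (\<rho>' x)"
    by (rule tensor_lift_cong; (rule coact_act_lift[symmetric])?) ((assumption | rule s)+)
  also have "\<dots> = comap (aut A' x) (act M a n)"
    unfolding induced_coact_bimap_def by (rule aut_lift'[symmetric]) ((assumption | rule s)+)
  finally show "comap (restricted_act D' \<psi> x a) m = comap (aut A' x) (act M a (inv_aut M m))"
    by (simp add: restricted_act_def n_def)
qed

lemma coQ_bt: "\<lbrakk>a \<in> carrier A'; m \<in> carrier M\<rbrakk> \<Longrightarrow> coQ (bt a m) = comap a m"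
  unfolding induced_coact_def by (rule lift_bt[OF module_QC comap_bilinear comap_balanced])

lemma coQ_linear: "linear_map R Z Q g \<Longrightarrow> linear_map R Z QC (\<lambda>z. coQ (g z))"
  unfolding induced_coact_def by (rule linear_map_comp[OF lift_linear[OF module_QC comap_bilinear comap_balanced]])

lemma coQ_closed: "q \<in> carrier Q \<Longrightarrow> coQ q \<in> carrier QC"
  by (rule linear_map_closed[OF coQ_linear[OF linear_map_id]])

text \<open>The coaction of a generator, substituted into a bilinear expression.\<close>

lemma coQ_lift:
  assumes P: "module R P" and f: "bilinear_map R Q C' P f" and a: "a \<in> carrier A'" and m: "m \<in> carrier M"
  shows "tensor_lift R P f (coQ (bt a m)) = tensor_lift R P (\<lambda>a0 a1. tensor_lift R P (\<lambda>m0 m1.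
    f (bt a0 m0) (coalg_act D' a1 (\<chi> m1))) (coact M m)) (\<rho>' a)"
  unfolding coQ_bt[OF a m] induced_coact_bimap_def
  by (rule tensor_lift_bind2[OF _ _ _ _ _ _ _ _ P f]) ((assumption | rule induction_rules a m)+)

lemma bt_bimap: "hom_bimap R A' M Q bt"
  by (simp add: hom_bimap_def aut_bt) ((assumption | rule induction_rules)+)

lemma inv_aut_bt: "\<lbrakk>a \<in> carrier A'; m \<in> carrier M\<rbrakk> \<Longrightarrow> inv_aut Q (bt a m) = bt (inv_aut A' a) (inv_aut M m)"
  by (rule hom_bimap_inv_aut[OF bt_bimap A'_object M_object Q_object])

lemmas coaction_rules = induction_rules coQ_linear coQ_closed

lemma coQ_objectm_map: "hom_map R Q QC coQ"
  unfolding hom_map_def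
proof (intro conjI ballI)
  show "linear_map R Q QC coQ" using coQ_linear[OF linear_map_id] by simp
  fix q assume q: "q \<in> carrier Q"
  show "coQ (aut Q q) = aut QC (coQ q)"
  proof (rule Q_eqI[OF module_QC _ _ _ q])
    show "linear_map R Q QC (\<lambda>q. coQ (aut Q q))" "linear_map R Q QC (\<lambda>q. aut QC (coQ q))"
      by ((assumption | rule coaction_rules)+)
    fix a m assume a: "a \<in> carrier A'" and m: "m \<in> carrier M"
    note s = coaction_rules a m
    have am: "aut A' a \<in> carrier A'" "aut M m \<in> carrier M" by ((assumption | rule s)+)
    have "coQ (aut Q (bt a m)) = comap (aut A' a) (aut M m)"
      by (simp add: aut_bt a m coQ_bt am)
    also have "\<dots> = liftQC (\<lambda>a0 a1. liftQC (\<lambda>m0 m1.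
        tQC (bt (aut A' a0) m0) (coalg_act D' (aut H' a1) (\<chi> m1))) (coact M (aut M m))) (\<rho>' a)"
      unfolding induced_coact_bimap_def by (rule aut_lift') ((assumption | rule s)+)
    also have "\<dots> = liftQC (\<lambda>a0 a1. liftQC (\<lambda>m0 m1.
        tQC (aut Q (bt a0 m0)) (aut C' (coalg_act D' a1 (\<chi> m1)))) (coact M m)) (\<rho>' a)"
    proof (rule tensor_lift_cong)
      fix a0 a1 assume a01: "a0 \<in> carrier A'" "a1 \<in> carrier H'"
      have "liftQC (\<lambda>m0 m1. tQC (bt (aut A' a0) m0) (coalg_act D' (aut H' a1) (\<chi> m1))) (coact M (aut M m))
        = liftQC (\<lambda>m0 m1. tQC (bt (aut A' a0) (aut M m0)) (coalg_act D' (aut H' a1) (\<chi> (aut C m1)))) (coact M m)"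
        by (rule aut_liftM) ((assumption | rule s a01)+)
      also have "\<dots> = liftQC (\<lambda>m0 m1. tQC (aut Q (bt a0 m0)) (aut C' (coalg_act D' a1 (\<chi> m1)))) (coact M m)"
      proof (rule tensor_lift_cong)
        fix m0 m1 assume m01: "m0 \<in> carrier M" "m1 \<in> carrier C"
        then show "tQC (bt (aut A' a0) (aut M m0)) (coalg_act D' (aut H' a1) (\<chi> (aut C m1))) =
          tQC (aut Q (bt a0 m0)) (aut C' (coalg_act D' a1 (\<chi> m1)))"
          using a01 by (simp add: aut_bt hom_map_aut[OF chi(1)] hom_closed
              hom_bimap_aut[OF left_hom_module.act_bimap[OF hom_module']])
      qed ((assumption | rule s a01)+)
      finally show "liftQC (\<lambda>m0 m1. tQC (bt (aut A' a0) m0) (coalg_act D' (aut H' a1) (\<chi> m1))) (coact M (aut M m)) =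
        liftQC (\<lambda>m0 m1. tQC (aut Q (bt a0 m0)) (aut C' (coalg_act D' a1 (\<chi> m1)))) (coact M m)" .
    qed ((assumption | rule s)+)
    also have "\<dots> = aut QC (coQ (bt a m))"
      unfolding aut_tensor by (rule coQ_lift[symmetric]) ((assumption | rule s)+)
    finally show "coQ (aut Q (bt a m)) = aut QC (coQ (bt a m))" .
  qed
qed

abbreviation "CC \<equiv> tensor R C' C'"
abbreviation "QCC \<equiv> tensor R Q CC"
abbreviation "liftQCC \<equiv> tensor_lift R QCC"
abbreviation "tQCC q c d \<equiv> tens R Q CC q (tens R C' C' c d)"

lemma module_QCC: "module R QCC" by (assumption | rule induction_rules)+

lemma tens_lift_right:
  assumes q: "q \<in> carrier Q" and t: "t \<in> carrier CC"
  shows "tens R Q CC q t = liftQCC (\<lambda>c d. tQCC q c d) t"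
proof -
  have "tens R Q CC q (tensor_lift R CC (\<lambda>c d. tens R C' C' c d) t) = liftQCC (\<lambda>c d. tQCC q c d) t"
    by (rule linear_map_tensor_lift) ((assumption | rule coaction_rules q t)+)
  then show ?thesis by (simp add: tensor_lift_eta[OF C'_object[THEN hom_object_module] C'_object[THEN hom_object_module] t])
qed

text \<open>Both sides, evaluated at \<open>a \<otimes>\<^sub>A m\<close>, are brought to the normal form \<open>?N\<close>, in which \<open>\<Delta>\<close> is applied
  to \<open>a\<^sub>1\<close> and \<open>m\<^sub>1\<close>, and \<open>\<beta>'\<inverse>\<close> and \<open>\<mu>\<inverse>\<close> to \<open>a\<^sub>0\<close> and \<open>m\<^sub>0\<close>. On the left this takes an interchange of the
  sums over \<open>m\<close> and \<open>a\<^sub>0\<close>, then coassociativity of \<open>M\<close> in the inner sums, then coassociativity of \<open>A'\<close>.\<close>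

lemma coQ_coassoc:
  assumes q: "q \<in> carrier Q"
  shows "liftQCC (\<lambda>x c. liftQCC (\<lambda>y d. tQCC y d (inv_aut C' c)) (coQ x)) (coQ q) =
    liftQCC (\<lambda>x c. tens R Q CC (inv_aut Q x) (comult C' c)) (coQ q)"
proof (rule Q_eqI[OF module_QCC _ _ _ q])
  show "linear_map R Q QCC (\<lambda>q. liftQCC (\<lambda>x c. liftQCC (\<lambda>y d. tQCC y d (inv_aut C' c)) (coQ x)) (coQ q))"
    "linear_map R Q QCC (\<lambda>q. liftQCC (\<lambda>x c. tens R Q CC (inv_aut Q x) (comult C' c)) (coQ q))"
    by ((assumption | rule coaction_rules)+)
  fix a m assume a: "a \<in> carrier A'" and m: "m \<in> carrier M"
  let ?act = "coalg_act D'"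
  let ?G = "\<lambda>b0 b1 h n0 n1 e. tQCC (bt b0 n0) (?act b1 (\<chi> n1)) (?act h (\<chi> e))"
  let ?N = "liftQCC (\<lambda>a0 a1. liftQCC (\<lambda>h1 h2. liftQCC (\<lambda>m0 m1. liftQCC (\<lambda>d e.
      ?G (inv_aut A' a0) h1 h2 (inv_aut M m0) d e) (comult C m1)) (coact M m)) (comult H' a1)) (\<rho>' a)"
  note s = coaction_rules a m
  have inv_act: "inv_aut C' (?act h (\<chi> e)) = ?act (inv_aut H' h) (\<chi> (inv_aut C e))"
    if "h \<in> carrier H'" "e \<in> carrier C" for h e
    using that by (simp add: hom_bimap_inv_aut[OF left_hom_module.act_bimap[OF hom_module'] H'_object C'_object C'_object]
        hom_closed hom_map_inv_aut[OF chi(1) C_object C'_object])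
  have "liftQCC (\<lambda>x c. liftQCC (\<lambda>y d. tQCC y d (inv_aut C' c)) (coQ x)) (coQ (bt a m)) =
      liftQCC (\<lambda>a0 a1. liftQCC (\<lambda>m0 m1. liftQCC (\<lambda>y d. tQCC y d (inv_aut C' (?act a1 (\<chi> m1))))
        (coQ (bt a0 m0))) (coact M m)) (\<rho>' a)"
    by (rule coQ_lift) ((assumption | rule s)+)
  also have "\<dots> = liftQCC (\<lambda>a0 a1. liftQCC (\<lambda>b0 b1. liftQCC (\<lambda>m0 m1. liftQCC (\<lambda>d e.
      ?G b0 b1 (inv_aut H' a1) (inv_aut M m0) d e) (comult C m1)) (coact M m)) (\<rho>' a0)) (\<rho>' a)"
    (is "liftQCC ?f _ = liftQCC ?g _")
  proof (rule tensor_lift_cong)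
    fix a0 a1 assume a01: "a0 \<in> carrier A'" "a1 \<in> carrier H'"
    have "?f a0 a1 = liftQCC (\<lambda>m0 m1. liftQCC (\<lambda>b0 b1. liftQCC (\<lambda>n0 n1.
        ?G b0 b1 (inv_aut H' a1) n0 n1 (inv_aut C m1)) (coact M m0)) (\<rho>' a0)) (coact M m)"
    proof (rule tensor_lift_cong)
      fix m0 m1 assume m01: "m0 \<in> carrier M" "m1 \<in> carrier C"
      show "liftQCC (\<lambda>y d. tQCC y d (inv_aut C' (?act a1 (\<chi> m1)))) (coQ (bt a0 m0)) =
        liftQCC (\<lambda>b0 b1. liftQCC (\<lambda>n0 n1. ?G b0 b1 (inv_aut H' a1) n0 n1 (inv_aut C m1))
          (coact M m0)) (\<rho>' a0)"
        unfolding inv_act[OF a01(2) m01(2)] by (rule coQ_lift) ((assumption | rule s a01 m01)+)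
    qed ((assumption | rule s a01)+)
    also have "\<dots> = liftQCC (\<lambda>b0 b1. liftQCC (\<lambda>m0 m1. liftQCC (\<lambda>n0 n1.
        ?G b0 b1 (inv_aut H' a1) n0 n1 (inv_aut C m1)) (coact M m0)) (coact M m)) (\<rho>' a0)"
      by (rule tensor_lift_swap) ((assumption | rule s a01)+)
    also have "\<dots> = ?g a0 a1"
    proof (rule tensor_lift_cong)
      fix b0 b1 assume b01: "b0 \<in> carrier A'" "b1 \<in> carrier H'"
      show "liftQCC (\<lambda>m0 m1. liftQCC (\<lambda>n0 n1. ?G b0 b1 (inv_aut H' a1) n0 n1 (inv_aut C m1))
          (coact M m0)) (coact M m) =
        liftQCC (\<lambda>m0 m1. liftQCC (\<lambda>d e. ?G b0 b1 (inv_aut H' a1) (inv_aut M m0) d e)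
          (comult C m1)) (coact M m)"
        by (rule coassoc_liftM[where G = "?G b0 b1 (inv_aut H' a1)"]) ((assumption | rule s a01 b01)+)
    qed ((assumption | rule s a01)+)
    finally show "?f a0 a1 = ?g a0 a1" .
  qed ((assumption | rule s)+)
  also have "\<dots> = ?N"
    by (rule coassoc_lift'[where G = "\<lambda>b0 b1 h. liftQCC (\<lambda>m0 m1. liftQCC (\<lambda>d e.
        ?G b0 b1 h (inv_aut M m0) d e) (comult C m1)) (coact M m)"]) ((assumption | rule s)+)
  finally have left: "liftQCC (\<lambda>x c. liftQCC (\<lambda>y d. tQCC y d (inv_aut C' c)) (coQ x)) (coQ (bt a m)) = ?N" .
  have "liftQCC (\<lambda>x c. tens R Q CC (inv_aut Q x) (comult C' c)) (coQ (bt a m)) =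
      liftQCC (\<lambda>a0 a1. liftQCC (\<lambda>m0 m1. tens R Q CC (inv_aut Q (bt a0 m0))
        (comult C' (?act a1 (\<chi> m1)))) (coact M m)) (\<rho>' a)"
    by (rule coQ_lift) ((assumption | rule s)+)
  also have "\<dots> = ?N" (is "liftQCC ?f _ = liftQCC ?g _")
  proof (rule tensor_lift_cong)
    fix a0 a1 assume a01: "a0 \<in> carrier A'" "a1 \<in> carrier H'"
    have "?f a0 a1 = liftQCC (\<lambda>m0 m1. liftQCC (\<lambda>h1 h2. liftQCC (\<lambda>d e.
        ?G (inv_aut A' a0) h1 h2 (inv_aut M m0) d e) (comult C m1)) (comult H' a1)) (coact M m)"
    proof (rule tensor_lift_cong)
      fix m0 m1 assume m01: "m0 \<in> carrier M" "m1 \<in> carrier C"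
      let ?q = "bt (inv_aut A' a0) (inv_aut M m0)"
      have "tens R Q CC (inv_aut Q (bt a0 m0)) (comult C' (?act a1 (\<chi> m1))) =
          liftQCC (\<lambda>c d. tQCC ?q c d) (comult C' (?act a1 (\<chi> m1)))"
        unfolding inv_aut_bt[OF a01(1) m01(1)]
        by (rule tens_lift_right) ((assumption | rule s a01 m01)+)
      also have "\<dots> = liftQCC (\<lambda>h1 h2. liftQCC (\<lambda>c d. tQCC ?q (?act h1 c) (?act h2 d)) (comult C' (\<chi> m1)))
          (comult H' a1)"
        by (rule comult_act_lift') ((assumption | rule s a01 m01)+)
      also have "\<dots> = liftQCC (\<lambda>h1 h2. liftQCC (\<lambda>d e.
        ?G (inv_aut A' a0) h1 h2 (inv_aut M m0) d e) (comult C m1)) (comult H' a1)"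
        by (rule tensor_lift_cong; (rule comult_chi_lift)?) ((assumption | rule s a01 m01)+)
      finally show "tens R Q CC (inv_aut Q (bt a0 m0)) (comult C' (?act a1 (\<chi> m1))) =
        liftQCC (\<lambda>h1 h2. liftQCC (\<lambda>d e.
        ?G (inv_aut A' a0) h1 h2 (inv_aut M m0) d e) (comult C m1)) (comult H' a1)" .
    qed ((assumption | rule s a01)+)
    also have "\<dots> = ?g a0 a1"
      by (rule tensor_lift_swap) ((assumption | rule s a01)+)
    finally show "?f a0 a1 = ?g a0 a1" .
  qed ((assumption | rule s)+)
  finally show "liftQCC (\<lambda>x c. liftQCC (\<lambda>y d. tQCC y d (inv_aut C' c)) (coQ x)) (coQ (bt a m)) =
    liftQCC (\<lambda>x c. tens R Q CC (inv_aut Q x) (comult C' c)) (coQ (bt a m))"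
    using left by simp
qed

lemma coQ_counit:
  assumes q: "q \<in> carrier Q"
  shows "tensor_lift R Q (\<lambda>x c. counit C' c \<odot>\<^bsub>Q\<^esub> x) (coQ q) = inv_aut Q q"
proof (rule Q_eqI[OF module_Q _ _ _ q])
  interpret Q: module R Q by (rule module_Q)
  note counit = hom_coalgebra.counit_linear[OF coalgebra'] hom_coalgebra.counit_linear[OF Hcoalg']
    hom_coalgebra.counit_linear[OF coalgebra]
  have closed: "h \<in> carrier H' \<Longrightarrow> counit H' h \<in> carrier R" "c \<in> carrier C' \<Longrightarrow> counit C' c \<in> carrier R"
    "c' \<in> carrier C \<Longrightarrow> counit C c' \<in> carrier R" for h c c'
    using counit[THEN linear_map_closed] by (simp_all add: self_module_def)
  note s0 = coaction_rules scalar_linear[OF _ counit(1)] scalar_linear[OF _ counit(2)] smult_linear closed Q.smult_closed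
  show "linear_map R Q Q (\<lambda>q. tensor_lift R Q (\<lambda>x c. counit C' c \<odot>\<^bsub>Q\<^esub> x) (coQ q))"
    "linear_map R Q Q (\<lambda>q. inv_aut Q q)"
    by ((assumption | rule s0)+)
  fix a m assume a: "a \<in> carrier A'" and m: "m \<in> carrier M"
  let ?act = "coalg_act D'"
  note s = s0 a m
  have "tensor_lift R Q (\<lambda>x c. counit C' c \<odot>\<^bsub>Q\<^esub> x) (coQ (bt a m)) =
      tensor_lift R Q (\<lambda>a0 a1. tensor_lift R Q (\<lambda>m0 m1. counit C' (?act a1 (\<chi> m1)) \<odot>\<^bsub>Q\<^esub> bt a0 m0)
        (coact M m)) (\<rho>' a)"
    by (rule coQ_lift) ((assumption | rule s)+)
  also have "\<dots> = tensor_lift R Q (\<lambda>a0 a1. counit H' a1 \<odot>\<^bsub>Q\<^esub> bt a0 (inv_aut M m)) (\<rho>' a)"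
  proof (rule tensor_lift_cong)
    fix a0 a1 assume a01: "a0 \<in> carrier A'" "a1 \<in> carrier H'"
    have "tensor_lift R Q (\<lambda>m0 m1. counit C' (?act a1 (\<chi> m1)) \<odot>\<^bsub>Q\<^esub> bt a0 m0) (coact M m) =
      tensor_lift R Q (\<lambda>m0 m1. counit C m1 \<odot>\<^bsub>Q\<^esub> (counit H' a1 \<odot>\<^bsub>Q\<^esub> bt a0 m0)) (coact M m)"
    proof (rule tensor_lift_cong)
      fix m0 m1 assume m01: "m0 \<in> carrier M" "m1 \<in> carrier C"
      then show "counit C' (?act a1 (\<chi> m1)) \<odot>\<^bsub>Q\<^esub> bt a0 m0 = counit C m1 \<odot>\<^bsub>Q\<^esub> (counit H' a1 \<odot>\<^bsub>Q\<^esub> bt a0 m0)"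
        using a01 by (simp add: left_hom_module_coalgebra.counit_act[OF module_coalgebra'] chi(3) hom_closed
            closed Q.smult_assoc1[symmetric] bt_closed B.A.R.m_comm)
    qed ((assumption | rule s a01)+)
    also have "\<dots> = counit H' a1 \<odot>\<^bsub>Q\<^esub> bt a0 (inv_aut M m)"
      by (rule counit_liftM) ((assumption | rule s a01)+)
    finally show "tensor_lift R Q (\<lambda>m0 m1. counit C' (?act a1 (\<chi> m1)) \<odot>\<^bsub>Q\<^esub> bt a0 m0) (coact M m) =
      counit H' a1 \<odot>\<^bsub>Q\<^esub> bt a0 (inv_aut M m)" .
  qed ((assumption | rule s)+)
  also have "\<dots> = bt (inv_aut A' a) (inv_aut M m)"
    by (rule counit_lift') ((assumption | rule s)+)
  also have "\<dots> = inv_aut Q (bt a m)" by (simp add: inv_aut_bt a m)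
  finally show "tensor_lift R Q (\<lambda>x c. counit C' c \<odot>\<^bsub>Q\<^esub> x) (coQ (bt a m)) = inv_aut Q (bt a m)" .
qed

lemma Q_right_comodule: "right_hom_comodule R C' Q coQ"
  by (intro right_hom_comodule.intro right_hom_comodule_axioms.intro coalgebra' Q_object coQ_objectm_map
      coQ_coassoc coQ_counit)

lemma coQ_actQ:
  assumes b: "b \<in> carrier A'" and q: "q \<in> carrier Q"
  shows "coQ (actQ b q) = liftQC (\<lambda>b0 b1. liftQC (\<lambda>q0 q1. tQC (actQ b0 q0) (coalg_act D' b1 q1)) (coQ q)) (\<rho>' b)"
proof (rule Q_eqI[OF module_QC _ _ _ q])
  note s0 = coaction_rules actQ_linear_left actQ_linear_right actQ_closed
  show "linear_map R Q QC (\<lambda>q. coQ (actQ b q))"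
    "linear_map R Q QC (\<lambda>q. liftQC (\<lambda>b0 b1. liftQC (\<lambda>q0 q1. tQC (actQ b0 q0) (coalg_act D' b1 q1)) (coQ q)) (\<rho>' b))"
    by ((assumption | rule s0 b)+)
  fix a m assume a: "a \<in> carrier A'" and m: "m \<in> carrier M"
  \<comment> \<open>Writing \<open>b = \<beta>'(n)\<close> removes the inverse from the formula for the action.\<close>
  define n where "n = inv_aut A' b"
  have n: "n \<in> carrier A'" "b = aut A' n"
    by (simp_all add: n_def inv_aut_closed[OF A'_object b] aut_inv_aut[OF A'_object b])
  let ?act = "coalg_act D'"
  note s = s0 a m n(1)
  have cl: "n \<otimes>\<^bsub>A'\<^esub> a \<in> carrier A'" "aut M m \<in> carrier M" by ((assumption | rule s)+)
  have "coQ (actQ b (bt a m)) = comap (n \<otimes>\<^bsub>A'\<^esub> a) (aut M m)"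
    by (simp add: actQ_bt a b m n_def[symmetric] coQ_bt cl)
  also have "\<dots> = liftQC (\<lambda>n0 n1. liftQC (\<lambda>a0 a1. liftQC (\<lambda>m0 m1.
      tQC (bt (n0 \<otimes>\<^bsub>A'\<^esub> a0) m0) (?act (n1 \<otimes>\<^bsub>H'\<^esub> a1) (\<chi> m1))) (coact M (aut M m))) (\<rho>' a)) (\<rho>' n)"
    unfolding induced_coact_bimap_def by (rule mult_lift') ((assumption | rule s)+)
  also have "\<dots> = liftQC (\<lambda>n0 n1. liftQC (\<lambda>q0 q1. tQC (actQ (aut A' n0) q0) (?act (aut H' n1) q1)) (coQ (bt a m))) (\<rho>' n)"
    (is "liftQC ?f _ = liftQC ?g _")
  proof (rule tensor_lift_cong)
    fix n0 n1 assume n01: "n0 \<in> carrier A'" "n1 \<in> carrier H'"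
    have "?f n0 n1 = liftQC (\<lambda>a0 a1. liftQC (\<lambda>m0 m1.
        tQC (actQ (aut A' n0) (bt a0 m0)) (?act (aut H' n1) (?act a1 (\<chi> m1)))) (coact M m)) (\<rho>' a)"
    proof (rule tensor_lift_cong)
      fix a0 a1 assume a01: "a0 \<in> carrier A'" "a1 \<in> carrier H'"
      have "liftQC (\<lambda>m0 m1. tQC (bt (n0 \<otimes>\<^bsub>A'\<^esub> a0) m0) (?act (n1 \<otimes>\<^bsub>H'\<^esub> a1) (\<chi> m1))) (coact M (aut M m)) =
        liftQC (\<lambda>m0 m1. tQC (bt (n0 \<otimes>\<^bsub>A'\<^esub> a0) (aut M m0)) (?act (n1 \<otimes>\<^bsub>H'\<^esub> a1) (\<chi> (aut C m1)))) (coact M m)"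
        by (rule aut_liftM) ((assumption | rule s n01 a01)+)
      also have "\<dots> = liftQC (\<lambda>m0 m1.
        tQC (actQ (aut A' n0) (bt a0 m0)) (?act (aut H' n1) (?act a1 (\<chi> m1)))) (coact M m)"
      proof (rule tensor_lift_cong)
        fix m0 m1 assume m01: "m0 \<in> carrier M" "m1 \<in> carrier C"
        then show "tQC (bt (n0 \<otimes>\<^bsub>A'\<^esub> a0) (aut M m0)) (?act (n1 \<otimes>\<^bsub>H'\<^esub> a1) (\<chi> (aut C m1))) =
          tQC (actQ (aut A' n0) (bt a0 m0)) (?act (aut H' n1) (?act a1 (\<chi> m1)))"
          using a01 n01 by (simp add: actQ_bt aut_closed[OF A'_object] inv_aut_aut[OF A'_object] act_assoc'
              hom_map_aut[OF chi(1)] hom_closed)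
      qed ((assumption | rule s n01 a01)+)
      finally show "liftQC (\<lambda>m0 m1. tQC (bt (n0 \<otimes>\<^bsub>A'\<^esub> a0) m0) (?act (n1 \<otimes>\<^bsub>H'\<^esub> a1) (\<chi> m1))) (coact M (aut M m)) =
        liftQC (\<lambda>m0 m1. tQC (actQ (aut A' n0) (bt a0 m0)) (?act (aut H' n1) (?act a1 (\<chi> m1)))) (coact M m)" .
    qed ((assumption | rule s n01)+)
    also have "\<dots> = ?g n0 n1"
      by (rule coQ_lift[symmetric]) ((assumption | rule s n01)+)
    finally show "?f n0 n1 = ?g n0 n1" .
  qed ((assumption | rule s)+)
  also have "\<dots> = liftQC (\<lambda>b0 b1. liftQC (\<lambda>q0 q1. tQC (actQ b0 q0) (?act b1 q1)) (coQ (bt a m))) (\<rho>' b)"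
    unfolding n(2) by (rule aut_lift'[symmetric]) ((assumption | rule s)+)
  finally show "coQ (actQ b (bt a m)) =
    liftQC (\<lambda>b0 b1. liftQC (\<lambda>q0 q1. tQC (actQ b0 q0) (?act b1 q1)) (coQ (bt a m))) (\<rho>' b)" .
qed

end

section \<open>The category of Doi Hom-Hopf modules\<close>

lemma doi_module_objects:
  assumes "doi_hom_hopf_module R D M"
  shows "hom_object R M" "hom_object R (coalg D)" "hom_object R (alg D)"
    "left_hom_module R (alg D) M (act M)" "right_hom_comodule R (coalg D) M (coact M)"
proof -
  have *: "left_hom_module R (alg D) M (act M)" "right_hom_comodule R (coalg D) M (coact M)"
    using assms by (simp_all add: doi_hom_hopf_module_def)
  then show "left_hom_module R (alg D) M (act M)" "right_hom_comodule R (coalg D) M (coact M)" by simp_all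
  show "hom_object R M" "hom_object R (alg D)"
    using left_hom_module.axioms(2)[OF *(1)] hom_algebra.axioms(1)[OF left_hom_module.axioms(1)[OF *(1)]]
    by simp_all
  show "hom_object R (coalg D)"
    by (rule hom_coalgebra_hom_object[OF right_hom_comodule.axioms(1)[OF *(2)]])
qed

lemma doi_module_act_closed:
  "\<lbrakk>doi_hom_hopf_module R D M; a \<in> carrier (alg D); m \<in> carrier M\<rbrakk> \<Longrightarrow> act M a m \<in> carrier M"
  by (rule bilinear_map_closed[OF hom_bimap_bilinear[OF left_hom_module.act_bimap[OF doi_module_objects(4)]]])

lemma doi_module_coact_closed:
  "\<lbrakk>doi_hom_hopf_module R D M; m \<in> carrier M\<rbrakk> \<Longrightarrow> coact M m \<in> carrier (tensor R M (coalg D))"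
  by (rule right_hom_comodule.coact_closed[OF doi_module_objects(5)])

text \<open>Being a morphism depends only on the values on the carrier. This accounts for the restriction to
  the carrier in \<^const>\<open>doi_category\<close>.\<close>

lemma doi_morphism_cong:
  assumes M: "doi_hom_hopf_module R D M" and N: "doi_hom_hopf_module R D N"
    and f: "doi_hom_hopf_morphism R D M N f" and eq: "\<And>x. x \<in> carrier M \<Longrightarrow> f x = g x"
  shows "doi_hom_hopf_morphism R D M N g"
proof -
  note oM = doi_module_objects[OF M] and oN = doi_module_objects[OF N]
  note mo = oM(1-3)[THEN hom_object_module] oN(1)[THEN hom_object_module]
  have lin: "linear_map R M N f" and f_aut: "\<And>x. x \<in> carrier M \<Longrightarrow> f (aut M x) = aut N (f x)"
    using f by (simp_all add: doi_hom_hopf_morphism_def hom_map_def)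
  have "linear_map R M N g"
    by (rule linear_map_cong[OF mo(1) eq lin])
  moreover have "tensor_lift R (tensor R N (coalg D)) (\<lambda>m0 m1. tens R N (coalg D) (f m0) m1) (coact M m) =
      tensor_lift R (tensor R N (coalg D)) (\<lambda>m0 m1. tens R N (coalg D) (g m0) m1) (coact M m)"
    if "m \<in> carrier M" for m
  proof (rule tensor_lift_cong[OF doi_module_coact_closed[OF M that] mo(1,2) module_tensor[OF mo(4,2)]])
    fix x y assume "x \<in> carrier M" "y \<in> carrier (coalg D)"
    then show "tens R N (coalg D) (g x) y \<in> carrier (tensor R N (coalg D))"
      "tens R N (coalg D) (f x) y = tens R N (coalg D) (g x) y"
      using linear_map_closed[OF lin] by (auto simp: eq intro!: tens_closed mo)
  qed
  ultimately show ?thesis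
    using f unfolding doi_hom_hopf_morphism_def hom_map_def
    by (simp add: eq[symmetric] aut_closed[OF oM(1)] doi_module_act_closed[OF M])
qed

lemma doi_morphism_id:
  assumes M: "doi_hom_hopf_module R D M"
  shows "doi_hom_hopf_morphism R D M M (\<lambda>x. x)"
  using doi_module_objects(1,2)[OF M, THEN hom_object_module]
  by (simp add: doi_hom_hopf_morphism_def hom_map_def linear_map_id tensor_lift_eta doi_module_coact_closed[OF M])

lemma doi_morphism_comp:
  assumes M: "doi_hom_hopf_module R D M" and N: "doi_hom_hopf_module R D N" and P: "doi_hom_hopf_module R D P"
    and f: "doi_hom_hopf_morphism R D M N f" and g: "doi_hom_hopf_morphism R D N P g"
  shows "doi_hom_hopf_morphism R D M P (\<lambda>x. g (f x))"
proof -
  note mo = doi_module_objects(1,2)[OF M, THEN hom_object_module]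
    doi_module_objects(1)[OF N, THEN hom_object_module] doi_module_objects(1)[OF P, THEN hom_object_module]
  have lin: "linear_map R M N f" "linear_map R N P g"
    using f g by (simp_all add: doi_hom_hopf_morphism_def hom_map_def)
  note cl = linear_map_closed[OF lin(1)] linear_map_closed[OF lin(2)]
  have "coact P (g (f m)) = tensor_lift R (tensor R P (coalg D)) (\<lambda>m0 m1. tens R P (coalg D) (g (f m0)) m1) (coact M m)"
    if m: "m \<in> carrier M" for m
  proof -
    have "coact P (g (f m)) = tensor_lift R (tensor R P (coalg D)) (\<lambda>n0 n1. tens R P (coalg D) (g n0) n1)
        (tensor_lift R (tensor R N (coalg D)) (\<lambda>m0 m1. tens R N (coalg D) (f m0) m1) (coact M m))"
      using f g m cl by (simp add: doi_hom_hopf_morphism_def)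
    also have "\<dots> = tensor_lift R (tensor R P (coalg D)) (\<lambda>m0 m1. tens R P (coalg D) (g (f m0)) m1) (coact M m)"
      by (rule tensor_lift_bind[OF doi_module_coact_closed[OF M m]])
        ((assumption | rule mo cl linearity linear_map_comp[OF lin(2)])+)
    finally show ?thesis .
  qed
  then show ?thesis
    using f g cl linear_map_comp[OF lin(2,1)] by (simp add: doi_hom_hopf_morphism_def hom_map_def)
qed

lemma doi_morphism_linear: "doi_hom_hopf_morphism R D M N f \<Longrightarrow> linear_map R M N f"
  by (simp add: doi_hom_hopf_morphism_def hom_map_def)

lemma category_doi:
  fixes R :: "('k, 'r) ring_scheme" and D :: "('k, 'h, 'a, 'c) doi_datum"
  shows "category (doi_category R D :: (('k, 'a, 'c, 'm) doi_obj, 'm \<Rightarrow> 'm) category_data)"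
proof
  fix X :: "('k, 'a, 'c, 'm) doi_obj"
  assume "X \<in> Ob (doi_category R D)"
  then have X: "doi_hom_hopf_module R D X" by (simp add: doi_category_def)
  show "Ident (doi_category R D) X \<in> Hom (doi_category R D) X X"
    using doi_morphism_cong[OF X X doi_morphism_id[OF X]] by (simp add: doi_category_def)
next
  fix X Y Z :: "('k, 'a, 'c, 'm) doi_obj" and f g
  assume "X \<in> Ob (doi_category R D)" "Y \<in> Ob (doi_category R D)" "Z \<in> Ob (doi_category R D)"
    and "f \<in> Hom (doi_category R D) X Y" "g \<in> Hom (doi_category R D) Y Z"
  then have X: "doi_hom_hopf_module R D X" and Y: "doi_hom_hopf_module R D Y" and Z: "doi_hom_hopf_module R D Z"
    and f: "doi_hom_hopf_morphism R D X Y f" and g: "doi_hom_hopf_morphism R D Y Z g"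
    by (simp_all add: doi_category_def)
  show "Comp (doi_category R D) X Y Z g f \<in> Hom (doi_category R D) X Z"
    using doi_morphism_cong[OF X Z doi_morphism_comp[OF X Y Z f g]]
    by (simp add: doi_category_def compose_eq)
next
  fix X Y :: "('k, 'a, 'c, 'm) doi_obj" and f
  assume "f \<in> Hom (doi_category R D) X Y"
  then have f: "f \<in> carrier X \<rightarrow> carrier Y" "f \<in> extensional (carrier X)"
    using linear_map_closed[OF doi_morphism_linear[of R D X Y f]] by (auto simp: doi_category_def)
  then show "Comp (doi_category R D) X X Y f (Ident (doi_category R D) X) = f"
    "Comp (doi_category R D) X Y Y (Ident (doi_category R D) Y) f = f"
    by (simp_all add: doi_category_def Id_compose compose_Id)
next
  fix W X Y Z :: "('k, 'a, 'c, 'm) doi_obj" and f g h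
  assume "f \<in> Hom (doi_category R D) W X"
  then have "f \<in> carrier W \<rightarrow> carrier X"
    using linear_map_closed[OF doi_morphism_linear[of R D W X f]] by (auto simp: doi_category_def)
  then show "Comp (doi_category R D) W Y Z h (Comp (doi_category R D) W X Y g f) =
      Comp (doi_category R D) W X Z (Comp (doi_category R D) X Y Z h g) f"
    by (simp add: doi_category_def compose_assoc)
qed

section \<open>The induction functor\<close>

text \<open>Tensor products do not see the fields that a record adds to an object.\<close>

lemma tensor_left_cong:
  assumes "carrier Q = carrier Q'" "add Q = add Q'" "zero Q = zero Q'" "smult Q = smult Q'" "aut Q = aut Q'"
  shows "tensor R Q N = tensor R Q' N" "tens R Q N = tens R Q' N"
proof -
  have k: "tensor_kernel R Q N = tensor_kernel R Q' N"
    by (simp add: tensor_kernel_def tensor_relations_def assms)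
  then have t: "tensor_module R Q N = tensor_module R Q' N"
    by (simp add: tensor_module_def assms)
  show tt: "tens R Q N = tens R Q' N"
    by (simp add: fun_eq_iff tens_def k assms)
  show "tensor R Q N = tensor R Q' N"
    by (simp add: tensor_def t tt assms)
qed

text \<open>The value of the functor at \<open>M\<close>. Its action and coaction are defined over the bare object
  \<open>A' \<otimes>\<^sub>A M\<close>; by \<open>induced_module_simps\<close> below, the object with this structure may take its place.\<close>

definition induced_module ::
  "('k, 'r) ring_scheme \<Rightarrow> ('k, 'h, 'a, 'c) doi_datum \<Rightarrow> ('k, 'h1, 'a1, 'c1) doi_datum \<Rightarrow>
    ('a \<Rightarrow> 'a1) \<Rightarrow> ('c \<Rightarrow> 'c1) \<Rightarrow> ('k, 'a, 'c, 'm) doi_obj \<Rightarrow>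
    ('k, 'a1, 'c1, ('k, 'a1, 'm) tensor_elt set) doi_obj" where
  "induced_module R D D' \<psi> \<chi> M =
    hom_obj.extend (induced_obj R D D' \<psi> M)
      (doi_obj.fields (induced_act R D D' \<psi> M (induced_obj R D D' \<psi> M))
        (induced_coact R D D' \<psi> \<chi> M (induced_obj R D D' \<psi> M)))"

text \<open>The map \<open>id \<otimes>\<^sub>A f\<close>, without restriction to the carrier.\<close>

definition induced_mor ::
  "('k, 'r) ring_scheme \<Rightarrow> ('k, 'h, 'a, 'c) doi_datum \<Rightarrow> ('k, 'h1, 'a1, 'c1) doi_datum \<Rightarrow>
    ('a \<Rightarrow> 'a1) \<Rightarrow> ('c \<Rightarrow> 'c1) \<Rightarrow> ('k, 'a, 'c, 'm) doi_obj \<Rightarrow> ('k, 'a, 'c, 'n) doi_obj \<Rightarrow> ('m \<Rightarrow> 'n) \<Rightarrow>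
    ('k, 'a1, 'm) tensor_elt set \<Rightarrow> ('k, 'a1, 'n) tensor_elt set" where
  "induced_mor R D D' \<psi> \<chi> M N f =
    quotient_lift R (induced_module R D D' \<psi> \<chi> N) (\<lambda>a m. induced_tens R D D' \<psi> N a (f m))"

lemma truncate_induced_module: "hom_obj.truncate (induced_module R D D' \<psi> \<chi> M) = induced_obj R D D' \<psi> M"
  by (simp add: induced_module_def hom_obj.defs doi_obj.defs)

lemma induced_module_simps:
  "act (induced_module R D D' \<psi> \<chi> M) = induced_act R D D' \<psi> M (induced_module R D D' \<psi> \<chi> M)"
  "coact (induced_module R D D' \<psi> \<chi> M) = induced_coact R D D' \<psi> \<chi> M (induced_module R D D' \<psi> \<chi> M)"
proof -
  let ?F = "induced_module R D D' \<psi> \<chi> M" and ?Q = "induced_obj R D D' \<psi> M"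
  have *: "carrier ?Q = carrier ?F" "add ?Q = add ?F" "zero ?Q = zero ?F" "smult ?Q = smult ?F" "aut ?Q = aut ?F"
    by (simp_all add: induced_module_def hom_obj.defs)
  have "act ?F = induced_act R D D' \<psi> M ?Q" "coact ?F = induced_coact R D D' \<psi> \<chi> M ?Q"
    by (simp_all add: induced_module_def hom_obj.defs doi_obj.defs)
  then show "act ?F = induced_act R D D' \<psi> M ?F" "coact ?F = induced_coact R D D' \<psi> \<chi> M ?F"
    by (simp_all add: fun_eq_iff induced_act_def induced_coact_def induced_coact_bimap_def[abs_def] quotient_lift_def
        tensor_lift_target_cong[OF *(1-4)] tensor_left_cong[OF *])
qed

context doi_map
begin

abbreviation "F \<equiv> induced_module R D D' \<psi> \<chi>"

lemma doi_inductionI: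
  "doi_hom_hopf_module R D M \<Longrightarrow> doi_induction R D D' \<phi> \<psi> \<chi> M (F M)"
  by (intro doi_induction.intro doi_induction_axioms.intro doi_map_axioms truncate_induced_module)

lemma doi_module_F:
  assumes M: "doi_hom_hopf_module R D M"
  shows "doi_hom_hopf_module R D' (F M)"
proof -
  interpret M: doi_induction R D D' \<phi> \<psi> \<chi> M "F M" by (rule doi_inductionI[OF M])
  show ?thesis
    unfolding doi_hom_hopf_module_def induced_module_simps
    using M.Q_left_module M.Q_right_comodule M.coQ_actQ by blast
qed

lemma induced_mor:
  assumes M: "doi_hom_hopf_module R D M" and N: "doi_hom_hopf_module R D N"
    and f: "doi_hom_hopf_morphism R D M N f"
  defines "h \<equiv> induced_mor R D D' \<psi> \<chi> M N f"
  shows "\<lbrakk>a \<in> carrier A'; m \<in> carrier M\<rbrakk> \<Longrightarrow>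
      h (induced_tens R D D' \<psi> M a m) = induced_tens R D D' \<psi> N a (f m)"
    and "doi_hom_hopf_morphism R D' (F M) (F N) h"
proof -
  interpret M: doi_induction R D D' \<phi> \<psi> \<chi> M "F M" by (rule doi_inductionI[OF M])
  interpret N: doi_induction R D D' \<phi> \<psi> \<chi> N "F N" by (rule doi_inductionI[OF N])
  have f_map: "hom_map R M N f" and lin: "linear_map R M N f"
    and f_act: "\<And>a m. \<lbrakk>a \<in> carrier A; m \<in> carrier M\<rbrakk> \<Longrightarrow> f (act M a m) = act N a (f m)"
    and f_coact: "\<And>m. m \<in> carrier M \<Longrightarrow> coact N (f m) =
      tensor_lift R (tensor R N C) (\<lambda>m0 m1. tens R N C (f m0) m1) (coact M m)"
    using f by (simp_all add: doi_hom_hopf_morphism_def hom_map_def)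
  note f_closed = linear_map_closed[OF lin]
  have bil: "bilinear_map R A' M (F N) (\<lambda>a m. N.bt a (f m))"
    by ((assumption | rule N.induction_rules M.M_smodule f_closed linear_map_comp[OF lin])+)
  have bal: "\<forall>x\<in>carrier A'. \<forall>a\<in>carrier A. \<forall>m\<in>carrier M.
      N.bt (restricted_act D' \<psi> x a) (f m) = N.bt (aut A' x) (f (act M a (inv_aut M m)))"
  proof (intro ballI)
    fix x a m assume xam: "x \<in> carrier A'" "a \<in> carrier A" "m \<in> carrier M"
    have m': "inv_aut M m \<in> carrier M" "f (inv_aut M m) \<in> carrier N"
      by (simp_all add: inv_aut_closed[OF M.M_object] xam f_closed)
    have "aut N (f (inv_aut M m)) = f m"
      using hom_map_aut[OF f_map m'(1)] xam by (simp add: aut_inv_aut[OF M.M_object])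
    then show "N.bt (restricted_act D' \<psi> x a) (f m) = N.bt (aut A' x) (f (act M a (inv_aut M m)))"
      using N.bt_balanced[OF xam(1,2) m'(2)] m'(1) xam by (simp add: restricted_act_def f_act)
  qed
  have hl: "linear_map R Z (F N) (\<lambda>z. h (g z))" if "linear_map R Z (F M) g" for Z :: "('k, 'v, 'w) module_scheme" and g
    unfolding h_def induced_mor_def
    by (rule linear_map_comp[OF M.lift_linear[OF N.module_Q bil bal] that])
  have h_bt: "h (M.bt a m) = N.bt a (f m)" if "a \<in> carrier A'" "m \<in> carrier M" for a m
    unfolding h_def induced_mor_def by (rule M.lift_bt[OF N.module_Q bil bal that])
  show "\<lbrakk>a \<in> carrier A'; m \<in> carrier M\<rbrakk> \<Longrightarrow> h (M.bt a m) = N.bt a (f m)" by (rule h_bt)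
  have h_closed: "h q \<in> carrier (F N)" if "q \<in> carrier (F M)" for q
    by (rule linear_map_closed[OF hl[OF linear_map_id] that])
  note s = M.coaction_rules M.actQ_linear_right M.actQ_closed N.coaction_rules N.actQ_linear_right N.actQ_closed f_closed
    linear_map_comp[OF lin] h_closed
  have "linear_map R (F M) (F N) h" using hl[OF linear_map_id] by simp
  moreover have "h (aut (F M) q) = aut (F N) (h q)" if q: "q \<in> carrier (F M)" for q
    by (rule M.Q_eqI[OF N.module_Q _ _ _ q])
      (simp add: M.aut_bt N.aut_bt h_bt aut_closed[OF A'_object] aut_closed[OF M.M_object] f_closed hom_map_aut[OF f_map]
        | (assumption | rule hl s)+)+
  moreover have "h (M.actQ b q) = N.actQ b (h q)" if b: "b \<in> carrier A'" and q: "q \<in> carrier (F M)" for b q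
    by (rule M.Q_eqI[OF N.module_Q _ _ _ q])
      (simp add: M.actQ_bt N.actQ_bt h_bt b bilinear_closed inv_aut_closed[OF A'_object] aut_closed[OF M.M_object] f_closed
          hom_map_aut[OF f_map]
        | (assumption | rule hl s b)+)+
  moreover have "N.coQ (h q) = N.liftQC (\<lambda>q0 q1. N.tQC (h q0) q1) (M.coQ q)" if q: "q \<in> carrier (F M)" for q
  proof (rule M.Q_eqI[OF N.module_QC _ _ _ q])
    show "linear_map R (F M) N.QC (\<lambda>q. N.coQ (h q))"
      "linear_map R (F M) N.QC (\<lambda>q. N.liftQC (\<lambda>q0 q1. N.tQC (h q0) q1) (M.coQ q))"
      by ((assumption | rule hl s)+)
    fix a m assume a: "a \<in> carrier A'" and m: "m \<in> carrier M"
    have "N.coQ (h (M.bt a m)) = N.comap a (f m)"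
      by (simp add: h_bt a m N.coQ_bt f_closed)
    also have "\<dots> = N.liftQC (\<lambda>a0 a1. N.liftQC (\<lambda>m0 m1.
        N.tQC (h (M.bt a0 m0)) (coalg_act D' a1 (\<chi> m1))) (coact M m)) (alg_coact D' a)"
      unfolding induced_coact_bimap_def
    proof (rule tensor_lift_cong)
      fix a0 a1 assume a01: "a0 \<in> carrier A'" "a1 \<in> carrier H'"
      have "N.liftQC (\<lambda>n0 n1. N.tQC (N.bt a0 n0) (coalg_act D' a1 (\<chi> n1))) (coact N (f m)) =
        N.liftQC (\<lambda>m0 m1. N.tQC (N.bt a0 (f m0)) (coalg_act D' a1 (\<chi> m1))) (coact M m)"
        unfolding f_coact[OF m] by (rule tensor_lift_bind) ((assumption | rule s hl a m a01)+)
      also have "\<dots> = N.liftQC (\<lambda>m0 m1. N.tQC (h (M.bt a0 m0)) (coalg_act D' a1 (\<chi> m1))) (coact M m)"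
      proof (rule tensor_lift_cong)
        fix m0 m1 assume "m0 \<in> carrier M" "m1 \<in> carrier C"
        then show "N.tQC (N.bt a0 (f m0)) (coalg_act D' a1 (\<chi> m1)) =
          N.tQC (h (M.bt a0 m0)) (coalg_act D' a1 (\<chi> m1))"
          by (simp add: h_bt a01)
      qed ((assumption | rule s hl a m a01)+)
      finally show "N.liftQC (\<lambda>n0 n1. N.tQC (N.bt a0 n0) (coalg_act D' a1 (\<chi> n1))) (coact N (f m)) =
        N.liftQC (\<lambda>m0 m1. N.tQC (h (M.bt a0 m0)) (coalg_act D' a1 (\<chi> m1))) (coact M m)" .
    qed ((assumption | rule s hl a m)+)
    also have "\<dots> = N.liftQC (\<lambda>q0 q1. N.tQC (h q0) q1) (M.coQ (M.bt a m))"
      by (rule M.coQ_lift[symmetric]) ((assumption | rule s hl a m)+)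
    finally show "N.coQ (h (M.bt a m)) = N.liftQC (\<lambda>q0 q1. N.tQC (h q0) q1) (M.coQ (M.bt a m))" .
  qed
  ultimately show "doi_hom_hopf_morphism R D' (F M) (F N) h"
    unfolding doi_hom_hopf_morphism_def hom_map_def induced_module_simps by blast
qed

abbreviation "F_mor M N f \<equiv> restrict (induced_mor R D D' \<psi> \<chi> M N f) (carrier (F M))"

lemma functor_F: "category_functor (doi_category R D) (doi_category R D') F F_mor"
proof (intro category_functor.intro category_functor_axioms.intro category_doi)
  fix X assume "X \<in> Ob (doi_category R D)"
  then have X: "doi_hom_hopf_module R D X" by (simp add: doi_category_def)
  show "F X \<in> Ob (doi_category R D')" using doi_module_F[OF X] by (simp add: doi_category_def)
  interpret X: doi_induction R D D' \<phi> \<psi> \<chi> X "F X" by (rule doi_inductionI[OF X])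
  have id: "doi_hom_hopf_morphism R D X X (\<lambda>x\<in>carrier X. x)"
    by (rule doi_morphism_cong[OF X X doi_morphism_id[OF X]]) simp
  have "induced_mor R D D' \<psi> \<chi> X X (\<lambda>x\<in>carrier X. x) q = q" if "q \<in> carrier (F X)" for q
    by (rule X.Q_eqI[OF X.module_Q doi_morphism_linear[OF induced_mor(2)[OF X X id]] linear_map_id _ that])
      (simp add: induced_mor(1)[OF X X id])
  then show "F_mor X X (Ident (doi_category R D) X) = Ident (doi_category R D') (F X)"
    by (simp add: doi_category_def cong: restrict_cong)
next
  fix X Y f assume "X \<in> Ob (doi_category R D)" "Y \<in> Ob (doi_category R D)" "f \<in> Hom (doi_category R D) X Y"
  then have X: "doi_hom_hopf_module R D X" and Y: "doi_hom_hopf_module R D Y" and f: "doi_hom_hopf_morphism R D X Y f"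
    by (simp_all add: doi_category_def)
  show "F_mor X Y f \<in> Hom (doi_category R D') (F X) (F Y)"
    using doi_morphism_cong[OF doi_module_F[OF X] doi_module_F[OF Y] induced_mor(2)[OF X Y f]]
    by (simp add: doi_category_def)
next
  fix X Y Z f g
  assume "X \<in> Ob (doi_category R D)" "Y \<in> Ob (doi_category R D)" "Z \<in> Ob (doi_category R D)"
    "f \<in> Hom (doi_category R D) X Y" "g \<in> Hom (doi_category R D) Y Z"
  then have X: "doi_hom_hopf_module R D X" and Y: "doi_hom_hopf_module R D Y" and Z: "doi_hom_hopf_module R D Z"
    and f: "doi_hom_hopf_morphism R D X Y f" and g: "doi_hom_hopf_morphism R D Y Z g"
    by (simp_all add: doi_category_def)
  have gf: "doi_hom_hopf_morphism R D X Z (compose (carrier X) g f)"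
    by (rule doi_morphism_cong[OF X Z doi_morphism_comp[OF X Y Z f g]]) (simp add: compose_eq)
  interpret X: doi_induction R D D' \<phi> \<psi> \<chi> X "F X" by (rule doi_inductionI[OF X])
  interpret Z: doi_induction R D D' \<phi> \<psi> \<chi> Z "F Z" by (rule doi_inductionI[OF Z])
  note mf = induced_mor[OF X Y f] and mg = induced_mor[OF Y Z g] and mgf = induced_mor[OF X Z gf]
  note lf = doi_morphism_linear[OF mf(2)]
  have "induced_mor R D D' \<psi> \<chi> X Z (compose (carrier X) g f) q =
      induced_mor R D D' \<psi> \<chi> Y Z g (induced_mor R D D' \<psi> \<chi> X Y f q)" if "q \<in> carrier (F X)" for q
    by (rule X.Q_eqI[OF Z.module_Q doi_morphism_linear[OF mgf(2)]
          linear_map_comp[OF doi_morphism_linear[OF mg(2)] lf] _ that])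
      (simp add: mf(1) mg(1) mgf(1) linear_map_closed[OF doi_morphism_linear[OF f]] compose_eq)
  then show "F_mor X Z (Comp (doi_category R D) X Y Z g f) =
      Comp (doi_category R D') (F X) (F Y) (F Z) (F_mor Y Z g) (F_mor X Y f)"
    by (auto simp: doi_category_def compose_def restrict_def fun_eq_iff linear_map_closed[OF lf])
qed

end

theorem theorem4p1:
  fixes R :: "('k, 'r) ring_scheme"
    and D :: "('k, 'h, 'a, 'c) doi_datum"
    and D' :: "('k, 'h1, 'a1, 'c1) doi_datum"
    and \<phi> :: "'h \<Rightarrow> 'h1" and \<psi> :: "'a \<Rightarrow> 'a1" and \<chi> :: "'c \<Rightarrow> 'c1"
  assumes "cring R"
    and "doi_hom_hopf_datum R D"
    and "doi_hom_hopf_datum R D'"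
    and "doi_datum_map R D D' \<phi> \<psi> \<chi>"
  shows "right_hom_module R (alg D) (alg D') (\<lambda>a' a. a' \<otimes>\<^bsub>alg D'\<^esub> \<psi> a) \<and>
    (\<exists>(F :: ('k, 'a, 'c, 'm) doi_obj \<Rightarrow> ('k, 'a1, 'c1, ('k, 'a1, 'm) tensor_elt set) doi_obj) F_mor.
      category_functor (doi_category R D) (doi_category R D') F F_mor \<and>
      (\<forall>M \<in> Ob (doi_category R D).
        hom_obj.truncate (F M) = induced_obj R D D' \<psi> M \<and>
        (\<forall>b' \<in> carrier (alg D'). \<forall>a' \<in> carrier (alg D'). \<forall>m \<in> carrier M.
          act (F M) b' (induced_tens R D D' \<psi> M a' m) =
          induced_tens R D D' \<psi> M (inv_aut (alg D') b' \<otimes>\<^bsub>alg D'\<^esub> a') (aut M m)) \<and>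
        (\<forall>a' \<in> carrier (alg D'). \<forall>m \<in> carrier M.
          coact (F M) (induced_tens R D D' \<psi> M a' m) =
          tensor_lift R (tensor R (F M) (coalg D')) (\<lambda>a0 a1.
            tensor_lift R (tensor R (F M) (coalg D')) (\<lambda>m0 m1.
              tens R (F M) (coalg D')
                (induced_tens R D D' \<psi> M a0 m0) (coalg_act D' a1 (\<chi> m1)))
              (coact M m))
            (alg_coact D' a'))) \<and>
      (\<forall>M \<in> Ob (doi_category R D). \<forall>N \<in> Ob (doi_category R D).
        \<forall>f \<in> Hom (doi_category R D) M N.
        \<forall>a' \<in> carrier (alg D'). \<forall>m \<in> carrier M.
          F_mor M N f (induced_tens R D D' \<psi> M a' m) = induced_tens R D D' \<psi> N a' (f m)))"
proof -
  interpret doi_map R D D' \<phi> \<psi> \<chi> by unfold_locales (fact assms)+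
  have obj: "hom_obj.truncate (F M) = induced_obj R D D' \<psi> M \<and>
        (\<forall>b' \<in> carrier (alg D'). \<forall>a' \<in> carrier (alg D'). \<forall>m \<in> carrier M.
          act (F M) b' (induced_tens R D D' \<psi> M a' m) =
          induced_tens R D D' \<psi> M (inv_aut (alg D') b' \<otimes>\<^bsub>alg D'\<^esub> a') (aut M m)) \<and>
        (\<forall>a' \<in> carrier (alg D'). \<forall>m \<in> carrier M.
          coact (F M) (induced_tens R D D' \<psi> M a' m) =
          tensor_lift R (tensor R (F M) (coalg D')) (\<lambda>a0 a1.
            tensor_lift R (tensor R (F M) (coalg D')) (\<lambda>m0 m1.
              tens R (F M) (coalg D')
                (induced_tens R D D' \<psi> M a0 m0) (coalg_act D' a1 (\<chi> m1)))
              (coact M m))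
            (alg_coact D' a'))" if "M \<in> Ob (doi_category R D)" for M :: "('k, 'a, 'c, 'm) doi_obj"
  proof -
    interpret M: doi_induction R D D' \<phi> \<psi> \<chi> M "F M"
      by (rule doi_inductionI) (use that in \<open>simp add: doi_category_def\<close>)
    show ?thesis
      by (simp add: truncate_induced_module induced_module_simps M.actQ_bt M.coQ_bt induced_coact_bimap_def)
  qed
  have mor: "F_mor M N f (induced_tens R D D' \<psi> M a' m) = induced_tens R D D' \<psi> N a' (f m)"
    if "M \<in> Ob (doi_category R D)" "N \<in> Ob (doi_category R D)" "f \<in> Hom (doi_category R D) M N"
      "a' \<in> carrier A'" "m \<in> carrier M" for M N :: "('k, 'a, 'c, 'm) doi_obj" and f a' m
  proof -
    have M: "doi_hom_hopf_module R D M" and N: "doi_hom_hopf_module R D N" and f: "doi_hom_hopf_morphism R D M N f"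
      using that by (simp_all add: doi_category_def)
    interpret M: doi_induction R D D' \<phi> \<psi> \<chi> M "F M" by (rule doi_inductionI[OF M])
    show ?thesis using that(4,5) by (simp add: induced_mor(1)[OF M N f] M.bt_closed)
  qed
  show ?thesis
    by (intro conjI restricted_module exI[of _ F] exI[of _ F_mor] functor_F ballI obj mor)
qed

end
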